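(* Let $(M,g,J_a,F^a)$, $a=1,2,3$, be a compact AHKT 8-manifold with torsion 3-form $T$. The following conditions are equivalent: a) The torsion is closed, $dT=0$. b) The interior multiplications of the 4-form $dT$ with the three Kähler 2-forms vanish, $F^a\lrcorner dT=0$ for $a=1,2,3$.
   Context: An almost hyperhermitian 8-manifold $(M,g,J_1,J_2,J_3)$ is a Riemannian 8-manifold with three almost complex structures satisfying $J_1J_2=-J_2J_1=J_3$, $J_a^2=-1$, $g(J_aX,J_aY)=g(X,Y)$; its Kähler forms are $F^a(X,Y)=g(X,J_aY)$. It is called AHKT if it admits a linear connection $\nabla$ with $\nabla g=\nabla J_1=\nabla J_2=\nabla J_3=0$ and totally skew-symmetric torsion $T(X,Y,Z)=g(\nabla_XY-\nabla_YX-[X,Y],Z)$ (such $\nabla$ is then unique). For a 2-form $F$ and a 4-form $\beta$, $(F\lrcorner\beta)(X,Y)=\frac12\sum_{i,j}F(e_i,e_j)\beta(e_i,e_j,X,Y)$ for a local orthonormal frame $\{e_i\}$. *)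

theory Defs
  imports "HOL-Analysis.Analysis"
begin

section \<open>Smooth manifolds\<close>

fun Ck_on :: "nat \<Rightarrow> 'e::real_normed_vector set \<Rightarrow> ('e \<Rightarrow> 'f::real_normed_vector) \<Rightarrow> bool" where
  "Ck_on 0 S f \<longleftrightarrow> continuous_on S f"
| "Ck_on (Suc k) S f \<longleftrightarrow>
     (\<forall>x\<in>S. f differentiable (at x)) \<and> (\<forall>v. Ck_on k S (\<lambda>x. frechet_derivative f (at x) v))"

text \<open>Only used for open \<open>S\<close>; over a finite-dimensional domain this is the usual
  \<open>C\<^sup>\<infinity>\<close> condition (all iterated directional derivatives exist and are continuous).\<close>

definition smooth_on :: "'e::real_normed_vector set \<Rightarrow> ('e \<Rightarrow> 'f::real_normed_vector) \<Rightarrow> bool" where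
  "smooth_on S f \<longleftrightarrow> (\<forall>k. Ck_on k S f)"

text \<open>The points of the manifold are all points of the topological space \<open>'a\<close>. A chart
  \<open>(U, \<phi>)\<close> consists of its domain and its coordinate map; the values of \<open>\<phi>\<close> outside
  \<open>U\<close> are irrelevant. Boundary is excluded since coordinate images are open, and connectedness
  is not required.\<close>

type_synonym ('a, 'n) atlas = "('a set \<times> ('a \<Rightarrow> real^'n)) set"

definition smooth_atlas ::
  "('a::{t2_space, second_countable_topology}, 'n::finite) atlas \<Rightarrow> bool" where
  "smooth_atlas A \<longleftrightarrow>
     (\<Union>(U, \<phi>)\<in>A. U) = UNIV \<and>
     (\<forall>(U, \<phi>)\<in>A. open U \<and> open (\<phi> ` U) \<and> homeomorphism U (\<phi> ` U) \<phi> (inv_into U \<phi>)) \<and>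
     (\<forall>(U, \<phi>)\<in>A. \<forall>(V, \<psi>)\<in>A. smooth_on (\<phi> ` (U \<inter> V)) (\<psi> \<circ> inv_into U \<phi>))"

definition smooth_funs :: "('a, 'n::finite) atlas \<Rightarrow> ('a \<Rightarrow> real) set" where
  "smooth_funs A = {f. \<forall>(U, \<phi>)\<in>A. smooth_on (\<phi> ` U) (f \<circ> inv_into U \<phi>)}"

section \<open>Tangent vectors and vector fields\<close>

text \<open>Tangent vectors at \<open>p\<close> are the derivations at \<open>p\<close> of the algebra of smooth functions.
  They are set to \<open>0\<close> on non-smooth functions, so that equality of tangent vectors (and of vector
  fields) is equality in HOL.\<close>

type_synonym 'a tvec = "('a \<Rightarrow> real) \<Rightarrow> real"

type_synonym 'a vfield = "'a \<Rightarrow> 'a tvec"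

definition tangent_space :: "('a, 'n::finite) atlas \<Rightarrow> 'a \<Rightarrow> 'a tvec set" where
  "tangent_space A p = {v.
     (\<forall>f\<in>smooth_funs A. \<forall>h\<in>smooth_funs A. \<forall>a b.
        v (\<lambda>x. a * f x + b * h x) = a * v f + b * v h) \<and>
     (\<forall>f\<in>smooth_funs A. \<forall>h\<in>smooth_funs A.
        v (\<lambda>x. f x * h x) = f p * v h + v f * h p) \<and>
     (\<forall>f. f \<notin> smooth_funs A \<longrightarrow> v f = 0)}"

definition vector_fields :: "('a, 'n::finite) atlas \<Rightarrow> 'a vfield set" where
  "vector_fields A = {X. (\<forall>p. X p \<in> tangent_space A p) \<and>
     (\<forall>f\<in>smooth_funs A. (\<lambda>p. X p f) \<in> smooth_funs A)}"

definition tv_lincomb :: "real \<Rightarrow> 'a tvec \<Rightarrow> real \<Rightarrow> 'a tvec \<Rightarrow> 'a tvec" where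
  "tv_lincomb a u b v = (\<lambda>f. a * u f + b * v f)"

definition vf_add :: "'a vfield \<Rightarrow> 'a vfield \<Rightarrow> 'a vfield" where
  "vf_add X Y = (\<lambda>p f. X p f + Y p f)"

definition vf_diff :: "'a vfield \<Rightarrow> 'a vfield \<Rightarrow> 'a vfield" where
  "vf_diff X Y = (\<lambda>p f. X p f - Y p f)"

definition vf_scale :: "('a \<Rightarrow> real) \<Rightarrow> 'a vfield \<Rightarrow> 'a vfield" where
  "vf_scale h X = (\<lambda>p f. h p * X p f)"

definition vf_deriv :: "'a vfield \<Rightarrow> ('a \<Rightarrow> real) \<Rightarrow> 'a \<Rightarrow> real" where
  "vf_deriv X f = (\<lambda>p. X p f)"

definition lie_bracket :: "'a vfield \<Rightarrow> 'a vfield \<Rightarrow> 'a vfield" where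
  "lie_bracket X Y = (\<lambda>p f. X p (vf_deriv Y f) - Y p (vf_deriv X f))"

section \<open>Metrics and almost complex structures\<close>

type_synonym 'a bilinear_field = "'a \<Rightarrow> 'a tvec \<Rightarrow> 'a tvec \<Rightarrow> real"

type_synonym 'a endo_field = "'a \<Rightarrow> 'a tvec \<Rightarrow> 'a tvec"

definition vf_inner :: "'a bilinear_field \<Rightarrow> 'a vfield \<Rightarrow> 'a vfield \<Rightarrow> 'a \<Rightarrow> real" where
  "vf_inner g X Y = (\<lambda>p. g p (X p) (Y p))"

definition vf_apply :: "'a endo_field \<Rightarrow> 'a vfield \<Rightarrow> 'a vfield" where
  "vf_apply J X = (\<lambda>p. J p (X p))"

definition riemannian_metric :: "('a, 'n::finite) atlas \<Rightarrow> 'a bilinear_field \<Rightarrow> bool" where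
  "riemannian_metric A g \<longleftrightarrow>
     (\<forall>p. \<forall>u\<in>tangent_space A p. \<forall>v\<in>tangent_space A p. g p u v = g p v u) \<and>
     (\<forall>p. \<forall>u\<in>tangent_space A p. \<forall>v\<in>tangent_space A p. \<forall>w\<in>tangent_space A p. \<forall>a b.
        g p (tv_lincomb a u b v) w = a * g p u w + b * g p v w) \<and>
     (\<forall>p. \<forall>u\<in>tangent_space A p. u \<noteq> (\<lambda>f. 0) \<longrightarrow> g p u u > 0) \<and>
     (\<forall>X\<in>vector_fields A. \<forall>Y\<in>vector_fields A. vf_inner g X Y \<in> smooth_funs A)"

definition endomorphism_field :: "('a, 'n::finite) atlas \<Rightarrow> 'a endo_field \<Rightarrow> bool" where
  "endomorphism_field A J \<longleftrightarrow>
     (\<forall>p. \<forall>u\<in>tangent_space A p. J p u \<in> tangent_space A p) \<and>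
     (\<forall>p. \<forall>u\<in>tangent_space A p. \<forall>v\<in>tangent_space A p. \<forall>a b.
        J p (tv_lincomb a u b v) = tv_lincomb a (J p u) b (J p v)) \<and>
     (\<forall>X\<in>vector_fields A. vf_apply J X \<in> vector_fields A)"

definition almost_complex_structure :: "('a, 'n::finite) atlas \<Rightarrow> 'a endo_field \<Rightarrow> bool" where
  "almost_complex_structure A J \<longleftrightarrow> endomorphism_field A J \<and>
     (\<forall>p. \<forall>u\<in>tangent_space A p. J p (J p u) = (\<lambda>f. - u f))"

text \<open>The three structures are \<open>J 1\<close>, \<open>J 2\<close>, \<open>J 3\<close>; other values of \<open>J\<close> are irrelevant.\<close>

definition almost_hyperhermitian ::
  "('a::{t2_space, second_countable_topology}, 'n::finite) atlas \<Rightarrow>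
     'a bilinear_field \<Rightarrow> (nat \<Rightarrow> 'a endo_field) \<Rightarrow> bool" where
  "almost_hyperhermitian A g J \<longleftrightarrow>
     smooth_atlas A \<and> riemannian_metric A g \<and>
     (\<forall>a\<in>{1,2,3}. almost_complex_structure A (J a)) \<and>
     (\<forall>p. \<forall>u\<in>tangent_space A p.
        J 1 p (J 2 p u) = J 3 p u \<and> J 2 p (J 1 p u) = (\<lambda>f. - J 3 p u f)) \<and>
     (\<forall>a\<in>{1,2,3}. \<forall>p. \<forall>u\<in>tangent_space A p. \<forall>v\<in>tangent_space A p.
        g p (J a p u) (J a p v) = g p u v)"

section \<open>Connections and torsion\<close>

type_synonym 'a connection = "'a vfield \<Rightarrow> 'a vfield \<Rightarrow> 'a vfield"

definition linear_connection :: "('a, 'n::finite) atlas \<Rightarrow> 'a connection \<Rightarrow> bool" where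
  "linear_connection A D \<longleftrightarrow>
     (\<forall>X\<in>vector_fields A. \<forall>Y\<in>vector_fields A. D X Y \<in> vector_fields A) \<and>
     (\<forall>X\<in>vector_fields A. \<forall>Y\<in>vector_fields A. \<forall>Z\<in>vector_fields A.
        D (vf_add X Y) Z = vf_add (D X Z) (D Y Z) \<and>
        D X (vf_add Y Z) = vf_add (D X Y) (D X Z)) \<and>
     (\<forall>X\<in>vector_fields A. \<forall>Y\<in>vector_fields A. \<forall>f\<in>smooth_funs A.
        D (vf_scale f X) Y = vf_scale f (D X Y) \<and>
        D X (vf_scale f Y) = vf_add (vf_scale (vf_deriv X f) Y) (vf_scale f (D X Y)))"

definition cov_deriv_metric ::
  "'a connection \<Rightarrow> 'a bilinear_field \<Rightarrow> 'a vfield \<Rightarrow> 'a vfield \<Rightarrow> 'a vfield \<Rightarrow> 'a \<Rightarrow> real" where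
  "cov_deriv_metric D g X Y Z = (\<lambda>p. vf_deriv X (vf_inner g Y Z) p
     - vf_inner g (D X Y) Z p - vf_inner g Y (D X Z) p)"

definition cov_deriv_endo ::
  "'a connection \<Rightarrow> 'a endo_field \<Rightarrow> 'a vfield \<Rightarrow> 'a vfield \<Rightarrow> 'a vfield" where
  "cov_deriv_endo D J X Y = vf_diff (D X (vf_apply J Y)) (vf_apply J (D X Y))"

text \<open>Differential forms are represented by their action on smooth vector fields.\<close>

type_synonym 'a form2 = "'a vfield \<Rightarrow> 'a vfield \<Rightarrow> 'a \<Rightarrow> real"

type_synonym 'a form3 = "'a vfield \<Rightarrow> 'a vfield \<Rightarrow> 'a vfield \<Rightarrow> 'a \<Rightarrow> real"

type_synonym 'a form4 = "'a vfield \<Rightarrow> 'a vfield \<Rightarrow> 'a vfield \<Rightarrow> 'a vfield \<Rightarrow> 'a \<Rightarrow> real"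

definition torsion :: "'a bilinear_field \<Rightarrow> 'a connection \<Rightarrow> 'a form3" where
  "torsion g D X Y Z = vf_inner g (vf_diff (vf_diff (D X Y) (D Y X)) (lie_bracket X Y)) Z"

definition totally_skew :: "('a, 'n::finite) atlas \<Rightarrow> 'a form3 \<Rightarrow> bool" where
  "totally_skew A T \<longleftrightarrow>
     (\<forall>X\<in>vector_fields A. \<forall>Y\<in>vector_fields A. \<forall>Z\<in>vector_fields A. \<forall>p.
        T Y X Z p = - T X Y Z p \<and> T X Z Y p = - T X Y Z p)"

definition AHKT_connection ::
  "('a, 'n::finite) atlas \<Rightarrow> 'a bilinear_field \<Rightarrow> (nat \<Rightarrow> 'a endo_field) \<Rightarrow>
     'a connection \<Rightarrow> bool" where
  "AHKT_connection A g J D \<longleftrightarrow>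
     linear_connection A D \<and>
     (\<forall>X\<in>vector_fields A. \<forall>Y\<in>vector_fields A. \<forall>Z\<in>vector_fields A. \<forall>p.
        cov_deriv_metric D g X Y Z p = 0) \<and>
     (\<forall>a\<in>{1,2,3}. \<forall>X\<in>vector_fields A. \<forall>Y\<in>vector_fields A.
        cov_deriv_endo D (J a) X Y = (\<lambda>p f. 0)) \<and>
     totally_skew A (torsion g D)"

section \<open>Exterior derivative, Kaehler forms and interior multiplication\<close>

text \<open>The invariant formula
  \<open>d\<omega>(X\<^sub>0,\<dots>,X\<^sub>3) = \<Sum>\<^sub>i (-1)\<^sup>i X\<^sub>i(\<omega>(\<dots>)) + \<Sum>\<^sub>i\<^sub><\<^sub>j (-1)\<^sup>i\<^sup>+\<^sup>j \<omega>([X\<^sub>i,X\<^sub>j],\<dots>)\<close>,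
  where the dots stand for the remaining fields.\<close>

definition ext_deriv3 :: "'a form3 \<Rightarrow> 'a form4" where
  "ext_deriv3 T W X Y Z = (\<lambda>p.
     vf_deriv W (T X Y Z) p - vf_deriv X (T W Y Z) p
     + vf_deriv Y (T W X Z) p - vf_deriv Z (T W X Y) p
     - T (lie_bracket W X) Y Z p + T (lie_bracket W Y) X Z p
     - T (lie_bracket W Z) X Y p - T (lie_bracket X Y) W Z p
     + T (lie_bracket X Z) W Y p - T (lie_bracket Y Z) W X p)"

definition kaehler_form :: "'a bilinear_field \<Rightarrow> 'a endo_field \<Rightarrow> 'a form2" where
  "kaehler_form g J X Y = vf_inner g X (vf_apply J Y)"

text \<open>A local orthonormal frame on \<open>U\<close> is given by global vector fields that are orthonormal on
  \<open>U\<close>. This is no restriction on germs of frames: after shrinking its domain, a frame defined only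
  locally extends to global vector fields by means of a bump function.\<close>

definition orthonormal_frame_on ::
  "('a::topological_space, 'n::finite) atlas \<Rightarrow> 'a bilinear_field \<Rightarrow> 'a set \<Rightarrow>
     ('n \<Rightarrow> 'a vfield) \<Rightarrow> bool" where
  "orthonormal_frame_on A g U E \<longleftrightarrow> open U \<and> (\<forall>i. E i \<in> vector_fields A) \<and>
     (\<forall>p\<in>U. \<forall>i j. vf_inner g (E i) (E j) p = (if i = j then 1 else 0))"

text \<open>The contraction does not depend on the chosen frame around \<open>p\<close>.\<close>

definition interior_mult ::
  "('a::topological_space, 'n::finite) atlas \<Rightarrow> 'a bilinear_field \<Rightarrow>
     'a form2 \<Rightarrow> 'a form4 \<Rightarrow> 'a form2" where
  "interior_mult A g F \<beta> X Y = (\<lambda>p.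
     let E = (SOME E. \<exists>U. p \<in> U \<and> orthonormal_frame_on A g U E)
     in 1 / 2 * (\<Sum>i\<in>UNIV. \<Sum>j\<in>UNIV. F (E i) (E j) p * \<beta> (E i) (E j) X Y p))"

end

theory Submission
  imports Defs
begin

text \<open>Pointwise, a 4-form \<open>\<beta>\<close> on a quaternionic hermitian 8-space whose contractions with the three
  Kaehler forms vanish is self-dual for the quaternionic orientation (the kernel of the contractions is the
  14-dimensional irreducible summand of \<open>\<Lambda>\<^sup>4\<close> under \<open>Sp(2)\<close>). Hence, if all
      \<open>F\<^sup>a \<lrcorner> dT\<close> vanish,
  \<open>d(T \<and> dT) = dT \<and> dT = |dT|\<^sup>2 vol\<close>, and Stokes' theorem on the compact manifold gives \<open>dT = 0\<close>.
  The integral is taken with a partition of unity and the orientation is the sign of \<open>(F\<^sup>1)\<^sup>4\<close> in charts.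
  Conversely the contraction is defined by choosing an orthonormal frame, so \<open>dT = 0\<close> yields the
  vanishing of the contractions as soon as local orthonormal frames exist.\<close>

subsection \<open>Calculus of smooth functions\<close>

lemma has_frechet_derivative:
  "f differentiable (at x) \<Longrightarrow> (f has_derivative frechet_derivative f (at x)) (at x)"
  by (simp add: frechet_derivative_works)

lemma Ck_on_cong:
  assumes "open S" "\<And>x. x \<in> S \<Longrightarrow> f x = g x" "Ck_on k S f"
  shows "Ck_on k S g"
  using assms(2,3)
proof (induction k arbitrary: f g)
  case 0
  then show ?case by (simp cong: continuous_on_cong)
next
  case (Suc k)
  have D: "(g has_derivative frechet_derivative f (at x)) (at x)" if "x \<in> S" for x
    using has_derivative_transform_within_open[OF has_frechet_derivative \<open>open S\<close> that, of f g]
      Suc.prems that by simp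
  have eq: "frechet_derivative g (at x) = frechet_derivative f (at x)" if "x \<in> S" for x
    using frechet_derivative_at[OF D[OF that]] by simp
  have "Ck_on k S (\<lambda>x. frechet_derivative g (at x) v)" for v
    using Suc.IH[of "\<lambda>x. frechet_derivative f (at x) v" "\<lambda>x. frechet_derivative g (at x) v"] Suc.prems eq
    by simp
  then show ?case
    using D by (auto simp: differentiable_def)
qed

lemma Ck_on_SucI:
  assumes "open S" "\<And>x. x \<in> S \<Longrightarrow> (f has_derivative f' x) (at x)"
    "\<And>v. Ck_on k S (\<lambda>x. f' x v)"
  shows "Ck_on (Suc k) S f"
proof -
  have "Ck_on k S (\<lambda>x. frechet_derivative f (at x) v)" for v
    using Ck_on_cong[OF assms(1) _ assms(3)[of v], of "\<lambda>x. frechet_derivative f (at x) v"]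
      frechet_derivative_at[OF assms(2)] by simp
  then show ?thesis
    using assms(2) by (auto simp: differentiable_def)
qed

lemma Ck_on_SucD:
  assumes "open S" "Ck_on (Suc k) S f"
  shows "Ck_on k S f"
  using assms(2)
proof (induction k arbitrary: f)
  case 0
  then show ?case
    by (auto intro!: continuous_at_imp_continuous_on differentiable_imp_continuous_within)
next
  case (Suc k)
  then show ?case by simp
qed

lemma Ck_on_subset: "Ck_on k S f \<Longrightarrow> T \<subseteq> S \<Longrightarrow> Ck_on k T f"
  by (induction k arbitrary: f) (auto intro: continuous_on_subset)

lemma Ck_on_local:
  assumes "\<And>x. x \<in> S \<Longrightarrow> \<exists>T. open T \<and> x \<in> T \<and> Ck_on k T f"
  shows "Ck_on k S f"
  using assms
proof (induction k arbitrary: f)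
  case 0
  have "isCont f x" if "x \<in> S" for x
    using 0[OF that] continuous_on_eq_continuous_at by auto
  then show ?case by (simp add: continuous_at_imp_continuous_on)
next
  case (Suc k)
  have 1: "f differentiable (at x)" if "x \<in> S" for x
    using Suc.prems[OF that] by auto
  have "Ck_on k S (\<lambda>x. frechet_derivative f (at x) v)" for v
  proof (rule Suc.IH)
    fix x assume "x \<in> S"
    from Suc.prems[OF this] show "\<exists>T. open T \<and> x \<in> T \<and> Ck_on k T (\<lambda>x. frechet_derivative f (at x) v)"
      by auto
  qed
  with 1 show ?case by simp
qed

lemma Ck_on_const:
  assumes "open S"
  shows "Ck_on k S (\<lambda>x. c)"
proof (induction k arbitrary: c)
  case 0
  show ?case by simp
next
  case (Suc k)
  show ?case
    by (rule Ck_on_SucI[OF assms, where f' = "\<lambda>x v. 0"]) (simp_all add: Suc)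
qed

lemma Ck_on_linear:
  assumes "open S" "bounded_linear f"
  shows "Ck_on k S f"
proof (cases k)
  case 0
  then show ?thesis using assms by (simp add: linear_continuous_on)
next
  case (Suc j)
  show ?thesis unfolding Suc
    by (rule Ck_on_SucI[OF assms(1), where f' = "\<lambda>x. f"])
      (use assms in \<open>simp_all add: bounded_linear_imp_has_derivative Ck_on_const\<close>)
qed

lemma Ck_on_add:
  assumes "open S" "Ck_on k S f" "Ck_on k S g"
  shows "Ck_on k S (\<lambda>x. f x + g x)"
  using assms(2,3)
proof (induction k arbitrary: f g)
  case 0
  then show ?case by (simp add: continuous_on_add)
next
  case (Suc k)
  show ?case
    by (rule Ck_on_SucI[OF assms(1), where
        f' = "\<lambda>x v. frechet_derivative f (at x) v + frechet_derivative g (at x) v"])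
      (use Suc in \<open>auto intro!: has_derivative_add has_frechet_derivative\<close>)
qed

lemma Ck_on_linear_comp:
  assumes "open S" "bounded_linear L" "Ck_on k S f"
  shows "Ck_on k S (\<lambda>x. L (f x))"
  using assms(3)
proof (induction k arbitrary: f)
  case 0
  then show ?case using assms(2) by (simp add: bounded_linear.continuous_on)
next
  case (Suc k)
  show ?case
    by (rule Ck_on_SucI[OF assms(1), where f' = "\<lambda>x v. L (frechet_derivative f (at x) v)"])
      (use Suc in \<open>auto intro!: bounded_linear.has_derivative[OF assms(2)] has_frechet_derivative\<close>)
qed

lemma Ck_on_mult:
  fixes f g :: "'a::real_normed_vector \<Rightarrow> real"
  assumes "open S" "Ck_on k S f" "Ck_on k S g"
  shows "Ck_on k S (\<lambda>x. f x * g x)"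
  using assms(2,3)
proof (induction k arbitrary: f g)
  case 0
  then show ?case by (simp add: continuous_on_mult)
next
  case (Suc k)
  show ?case
  proof (rule Ck_on_SucI[OF assms(1), where
        f' = "\<lambda>x v. f x * frechet_derivative g (at x) v + frechet_derivative f (at x) v * g x"])
    show "((\<lambda>x. f x * g x) has_derivative
        (\<lambda>v. f x * frechet_derivative g (at x) v + frechet_derivative f (at x) v * g x)) (at x)"
      if "x \<in> S" for x
      using Suc.prems that by (auto intro!: has_derivative_mult has_frechet_derivative)
    show "Ck_on k S (\<lambda>x. f x * frechet_derivative g (at x) v + frechet_derivative f (at x) v * g x)" for v
      using Suc.prems Suc.prems[THEN Ck_on_SucD[OF assms(1)]]
      by (intro Ck_on_add[OF assms(1)] Suc.IH) simp_all
  qed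
qed

lemma Ck_on_sum:
  assumes "open S" "\<And>i. i \<in> I \<Longrightarrow> Ck_on k S (f i)"
  shows "Ck_on k S (\<lambda>x. \<Sum>i\<in>I. f i x)"
  using assms(2)
  by (induction I rule: infinite_finite_induct) (simp_all add: Ck_on_const Ck_on_add assms(1))

lemma Ck_on_compose:
  fixes f :: "'b::euclidean_space \<Rightarrow> real" and g :: "'a::real_normed_vector \<Rightarrow> 'b"
  assumes "open S" "open T" "Ck_on k T f" "Ck_on k S g" "\<And>x. x \<in> S \<Longrightarrow> g x \<in> T"
  shows "Ck_on k S (\<lambda>x. f (g x))"
  using assms(3,4)
proof (induction k arbitrary: f)
  case 0
  then show ?case
    using assms(5) by (auto intro: continuous_on_compose2)
next
  case (Suc k)
  let ?f' = "\<lambda>x v. \<Sum>i\<in>Basis. (frechet_derivative g (at x) v \<bullet> i) * frechet_derivative f (at (g x)) i"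
  show ?case
  proof (rule Ck_on_SucI[OF assms(1), where f' = ?f'])
    fix x assume x: "x \<in> S"
    have f: "f differentiable (at (g x))" and g: "g differentiable (at x)"
      using Suc.prems x assms(5) by auto
    have lin: "linear (frechet_derivative f (at (g x)))"
      by (rule linear_frechet_derivative[OF f])
    have *: "frechet_derivative f (at (g x)) w = (\<Sum>i\<in>Basis. (w \<bullet> i) * frechet_derivative f (at (g x)) i)" for w
    proof -
      have "frechet_derivative f (at (g x)) (\<Sum>i\<in>Basis. (w \<bullet> i) *\<^sub>R i) =
          (\<Sum>i\<in>Basis. (w \<bullet> i) * frechet_derivative f (at (g x)) i)"
        by (simp add: linear_sum[OF lin] linear_scale[OF lin])
      then show ?thesis by (simp add: euclidean_representation)
    qed
    show "((\<lambda>x. f (g x)) has_derivative ?f' x) (at x)"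
      by (rule has_derivative_eq_rhs[OF has_derivative_compose[OF has_frechet_derivative[OF g] has_frechet_derivative[OF f]]])
        (rule ext, rule *)
  next
    fix v
    have fk: "Ck_on k T f" and gk: "Ck_on k S g" and gv: "Ck_on k S (\<lambda>x. frechet_derivative g (at x) v)"
      using Ck_on_SucD[OF assms(1) Suc.prems(2)] Ck_on_SucD[OF assms(2) Suc.prems(1)] Suc.prems(2) by simp_all
    show "Ck_on k S (\<lambda>x. ?f' x v)"
    proof (intro Ck_on_sum Ck_on_mult assms(1))
      fix i :: 'b assume "i \<in> Basis"
      show "Ck_on k S (\<lambda>x. frechet_derivative g (at x) v \<bullet> i)"
        by (rule Ck_on_linear_comp[OF assms(1) bounded_linear_inner_left gv])
      show "Ck_on k S (\<lambda>x. frechet_derivative f (at (g x)) i)"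
        using Suc.prems(1) gk by (intro Suc.IH[of "\<lambda>y. frechet_derivative f (at y) i"]) simp_all
    qed
  qed
qed

lemma Ck_on_inverse:
  fixes f :: "'a::real_normed_vector \<Rightarrow> real"
  assumes "open S" "Ck_on k S f" "\<And>x. x \<in> S \<Longrightarrow> f x \<noteq> 0"
  shows "Ck_on k S (\<lambda>x. inverse (f x))"
  using assms(2)
proof (induction k)
  case 0
  then show ?case using assms(3) by (simp add: continuous_on_inverse)
next
  case (Suc k)
  show ?case
  proof (rule Ck_on_SucI[OF assms(1), where
        f' = "\<lambda>x v. - (inverse (f x) * frechet_derivative f (at x) v * inverse (f x))"])
    fix x assume x: "x \<in> S"
    show "((\<lambda>x. inverse (f x)) has_derivative
        (\<lambda>v. - (inverse (f x) * frechet_derivative f (at x) v * inverse (f x)))) (at x)"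
      using Suc.prems x assms(3) by (intro Deriv.has_derivative_inverse has_frechet_derivative) auto
  next
    fix v
    show "Ck_on k S (\<lambda>x. - (inverse (f x) * frechet_derivative f (at x) v * inverse (f x)))"
      using Suc.prems Suc.IH[OF Ck_on_SucD[OF assms(1) Suc.prems]]
      by (intro Ck_on_linear_comp[OF assms(1), of uminus] Ck_on_mult assms(1) bounded_linear_minus bounded_linear_ident) simp_all
  qed
qed

lemma Ck_on_inverse_sqrt:
  fixes f :: "'a::real_normed_vector \<Rightarrow> real"
  assumes "open S" "Ck_on k S f" "\<And>x. x \<in> S \<Longrightarrow> f x > 0"
  shows "Ck_on k S (\<lambda>x. inverse (sqrt (f x)))"
  using assms(2)
proof (induction k)
  case 0
  then show ?case using assms(3)
    unfolding Ck_on.simps by (intro continuous_on_inverse continuous_on_real_sqrt) force+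
next
  case (Suc k)
  let ?r = "\<lambda>x. inverse (sqrt (f x))"
  let ?d = "\<lambda>x. frechet_derivative f (at x)"
  have f: "Ck_on k S f"
    by (rule Ck_on_SucD[OF assms(1) Suc.prems])
  then have IH: "Ck_on k S ?r"
    by (rule Suc.IH)
  show ?case
  proof (rule Ck_on_SucI[OF assms(1), where f' = "\<lambda>x v. - (?r x * (1 / 2 * ?r x * ?d x v) * ?r x)"])
    fix x assume x: "x \<in> S"
    have "(sqrt has_derivative (\<lambda>a. 1 / 2 * ?r x * a)) (at (f x))"
      using DERIV_real_sqrt[OF assms(3)[OF x]] unfolding has_field_derivative_def
      by (rule has_derivative_eq_rhs) (simp add: fun_eq_iff)
    moreover have "(f has_derivative ?d x) (at x)"
      using Suc.prems x by (simp add: has_frechet_derivative)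
    ultimately have "((\<lambda>x. sqrt (f x)) has_derivative (\<lambda>v. 1 / 2 * ?r x * ?d x v)) (at x)"
      by (rule has_derivative_compose[rotated])
    then show "(?r has_derivative (\<lambda>v. - (?r x * (1 / 2 * ?r x * ?d x v) * ?r x))) (at x)"
      using assms(3)[OF x] by (intro Deriv.has_derivative_inverse) simp_all
  next
    fix v
    have "Ck_on k S (\<lambda>x. ?d x v)"
      using Suc.prems by simp
    then show "Ck_on k S (\<lambda>x. - (?r x * (1 / 2 * ?r x * ?d x v) * ?r x))"
      by (intro Ck_on_linear_comp[OF assms(1), of uminus] Ck_on_mult assms(1) IH Ck_on_const
          bounded_linear_minus bounded_linear_ident)
  qed
qed

lemma smooth_onD: "smooth_on S f \<Longrightarrow> Ck_on k S f"
  by (simp add: smooth_on_def)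

lemma smooth_on_cong: "open S \<Longrightarrow> (\<And>x. x \<in> S \<Longrightarrow> f x = g x) \<Longrightarrow> smooth_on S
    f \<Longrightarrow> smooth_on S g"
  unfolding smooth_on_def using Ck_on_cong by blast

lemma smooth_on_subset: "smooth_on S f \<Longrightarrow> T \<subseteq> S \<Longrightarrow> smooth_on T f"
  unfolding smooth_on_def using Ck_on_subset by blast

lemma smooth_on_local:
  "(\<And>x. x \<in> S \<Longrightarrow> \<exists>T. open T \<and> x \<in> T \<and> smooth_on T f) \<Longrightarrow> smooth_on S f"
  unfolding smooth_on_def by (intro allI Ck_on_local) blast

lemma smooth_on_const: "open S \<Longrightarrow> smooth_on S (\<lambda>x. c)"
  by (simp add: smooth_on_def Ck_on_const)

lemma smooth_on_linear: "open S \<Longrightarrow> bounded_linear f \<Longrightarrow> smooth_on S f"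
  by (simp add: smooth_on_def Ck_on_linear)

lemma smooth_on_add: "open S \<Longrightarrow> smooth_on S f \<Longrightarrow> smooth_on S g \<Longrightarrow> smooth_on S (\<lambda>x. f x + g x)"
  by (simp add: smooth_on_def Ck_on_add)

lemma smooth_on_linear_comp:
  "open S \<Longrightarrow> bounded_linear L \<Longrightarrow> smooth_on S f \<Longrightarrow> smooth_on S (\<lambda>x. L (f x))"
  unfolding smooth_on_def by (intro allI Ck_on_linear_comp[of S L]) blast+

lemma smooth_on_mult:
  fixes f g :: "'a::real_normed_vector \<Rightarrow> real"
  shows "open S \<Longrightarrow> smooth_on S f \<Longrightarrow> smooth_on S g \<Longrightarrow> smooth_on S (\<lambda>x. f x * g x)"
  by (simp add: smooth_on_def Ck_on_mult)

lemma smooth_on_minus: "open S \<Longrightarrow> smooth_on S f \<Longrightarrow> smooth_on S (\<lambda>x. - f x)"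
  by (rule smooth_on_linear_comp[of S uminus f]) (simp_all add: bounded_linear_minus bounded_linear_ident)

lemma smooth_on_diff: "open S \<Longrightarrow> smooth_on S f \<Longrightarrow> smooth_on S g \<Longrightarrow> smooth_on S (\<lambda>x. f x - g x)"
  using smooth_on_add[of S f "\<lambda>x. - g x"] smooth_on_minus[of S g] by simp

lemma smooth_on_sum:
  "open S \<Longrightarrow> (\<And>i. i \<in> I \<Longrightarrow> smooth_on S (f i)) \<Longrightarrow> smooth_on S (\<lambda>x. \<Sum>i\<in>I. f i x)"
  by (simp add: smooth_on_def Ck_on_sum)

lemma smooth_on_compose:
  fixes f :: "'b::euclidean_space \<Rightarrow> real" and g :: "'a::real_normed_vector \<Rightarrow> 'b"
  assumes "open S" "open T" "smooth_on T f" "smooth_on S g" "\<And>x. x \<in> S \<Longrightarrow> g x \<in> T"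
  shows "smooth_on S (\<lambda>x. f (g x))"
  using assms Ck_on_compose[of S T] unfolding smooth_on_def by blast

lemma smooth_on_inverse:
  fixes f :: "'a::real_normed_vector \<Rightarrow> real"
  shows "open S \<Longrightarrow> smooth_on S f \<Longrightarrow> (\<And>x. x \<in> S \<Longrightarrow> f x \<noteq> 0)
      \<Longrightarrow> smooth_on S (\<lambda>x. inverse (f x))"
  by (simp add: smooth_on_def Ck_on_inverse)

lemma smooth_on_inverse_sqrt:
  fixes f :: "'a::real_normed_vector \<Rightarrow> real"
  shows "open S \<Longrightarrow> smooth_on S f \<Longrightarrow> (\<And>x. x \<in> S \<Longrightarrow> f x > 0) \<Longrightarrow>
    smooth_on S (\<lambda>x. inverse (sqrt (f x)))"
  by (simp add: smooth_on_def Ck_on_inverse_sqrt)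

lemma smooth_on_frechet_derivative:
  assumes "smooth_on S f"
  shows "smooth_on S (\<lambda>x. frechet_derivative f (at x) v)"
  unfolding smooth_on_def
proof
  fix k
  have "Ck_on (Suc k) S f" using assms by (rule smooth_onD)
  then show "Ck_on k S (\<lambda>x. frechet_derivative f (at x) v)" by simp
qed

lemma smooth_on_has_derivative:
  assumes "smooth_on S f" "x \<in> S"
  shows "(f has_derivative frechet_derivative f (at x)) (at x)"
proof -
  have "Ck_on (Suc 0) S f" using assms(1) by (rule smooth_onD)
  then show ?thesis using assms(2) by (simp add: has_frechet_derivative)
qed

lemma smooth_on_continuous:
  assumes "smooth_on S f"
  shows "continuous_on S f"
  using smooth_onD[OF assms, of 0] by simp

definition flat :: "nat \<Rightarrow> real \<Rightarrow> real" where
  "flat n t = (if t > 0 then exp (- inverse t) * inverse t ^ n else 0)"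

lemma flat_tendsto_0: "(flat n \<longlongrightarrow> 0) (at 0)"
proof (rule filterlim_split_at)
  have "((\<lambda>t. 0) \<longlongrightarrow> 0) (at_left (0::real))" by simp
  moreover have "eventually (\<lambda>t. 0 = flat n t) (at_left (0::real))"
    by (auto simp: flat_def eventually_at_left_field intro: exI[of _ "- 1"])
  ultimately show "(flat n \<longlongrightarrow> 0) (at_left 0)"
    by (rule Lim_transform_eventually)
next
  have "((\<lambda>t. inverse t ^ n / exp (inverse t)) \<longlongrightarrow> 0) (at_right (0::real))"
    by (rule filterlim_compose[OF tendsto_power_div_exp_0 filterlim_inverse_at_top_right])
  moreover have "eventually (\<lambda>t. inverse t ^ n / exp (inverse t) = flat n t) (at_right (0::real))"
    by (auto simp: flat_def eventually_at_right_field exp_minus divide_inverse mult.commute intro!: exI[of _ 1])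
  ultimately show "(flat n \<longlongrightarrow> 0) (at_right 0)"
    by (rule Lim_transform_eventually)
qed

lemma flat_has_derivative:
  "(flat n has_real_derivative flat (n + 2) t - real n * flat (n + 1) t) (at t)"
proof -
  consider "t > 0" | "t = 0" | "t < 0" by linarith
  then show ?thesis
  proof cases
    case 1
    have "((\<lambda>t. exp (- inverse t) * inverse t ^ n) has_real_derivative
        exp (- inverse t) * inverse t ^ n * (inverse t * inverse t)
        - exp (- inverse t) * (real n * inverse t ^ (n - 1) * (inverse t * inverse t))) (at t)"
      by (rule derivative_eq_intros refl | use 1 in \<open>simp add: power2_eq_square\<close>)+
    moreover have "exp (- inverse t) * inverse t ^ n * (inverse t * inverse t)
        - exp (- inverse t) * (real n * inverse t ^ (n - 1) * (inverse t * inverse t))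
        = flat (n + 2) t - real n * flat (n + 1) t"
      using 1 by (cases n) (simp_all add: flat_def)
    ultimately have "((\<lambda>t. exp (- inverse t) * inverse t ^ n) has_real_derivative
        flat (n + 2) t - real n * flat (n + 1) t) (at t)" by simp
    then show ?thesis
      by (rule has_field_derivative_transform_within_open[of _ _ _ "{0<..}"]) (use 1 in \<open>auto simp: flat_def\<close>)
  next
    case 2
    have "((\<lambda>h. (flat n (0 + h) - flat n 0) / h) \<longlongrightarrow> 0) (at 0)"
    proof (rule Lim_transform_eventually[OF flat_tendsto_0[of "Suc n"]])
      show "\<forall>\<^sub>F h in at 0. flat (Suc n) h = (flat n (0 + h) - flat n 0) / h"
        by (auto simp: flat_def divide_inverse)
    qed
    then show ?thesis
      using 2 by (simp add: DERIV_def flat_def)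
  next
    case 3
    have "((\<lambda>t. 0) has_real_derivative 0) (at t)" by simp
    then have "(flat n has_real_derivative 0) (at t)"
      by (rule has_field_derivative_transform_within_open[of _ _ _ "{..<0}"]) (use 3 in \<open>auto simp: flat_def\<close>)
    with 3 show ?thesis by (simp add: flat_def)
  qed
qed

lemma flat_smooth: "smooth_on UNIV (flat n)"
proof -
  have "Ck_on k UNIV (flat n)" for k
  proof (induction k arbitrary: n)
    case 0
    have "isCont (flat n) x" for x
      by (rule DERIV_isCont[OF flat_has_derivative])
    then show ?case by (simp add: continuous_at_imp_continuous_on)
  next
    case (Suc k)
    show ?case
    proof (rule Ck_on_SucI[where f' = "\<lambda>t v. (flat (n + 2) t + (- real n) * flat (n + 1) t) * v"])
      show "(flat n has_derivative (\<lambda>v. (flat (n + 2) t + (- real n) * flat (n + 1) t) * v)) (at t)" for t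
        using flat_has_derivative[of n t] by (simp add: has_field_derivative_def)
      show "Ck_on k UNIV (\<lambda>t. (flat (n + 2) t + (- real n) * flat (n + 1) t) * v)" for v
        by (intro Ck_on_mult Ck_on_add Ck_on_const open_UNIV Suc)
    qed simp
  qed
  then show ?thesis by (simp add: smooth_on_def)
qed

definition cutoff :: "real \<Rightarrow> real" where
  "cutoff t = flat 0 t * inverse (flat 0 t + flat 0 (1 - t))"

lemma flat_nonneg: "flat n t \<ge> 0"
  by (simp add: flat_def)

lemma cutoff_denominator: "flat 0 t + flat 0 (1 - t) > 0"
  by (auto simp: flat_def add_pos_nonneg add_nonneg_pos)

lemma cutoff_smooth: "smooth_on UNIV cutoff"
proof -
  have "smooth_on UNIV (\<lambda>t. flat 0 (1 - t))"
    by (rule smooth_on_compose[OF _ _ flat_smooth[of 0]])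
      (simp_all add: smooth_on_diff[of UNIV "\<lambda>_. 1" "\<lambda>t. t"] smooth_on_const smooth_on_linear bounded_linear_ident)
  then have "smooth_on UNIV (\<lambda>t. flat 0 t * inverse (flat 0 t + flat 0 (1 - t)))"
    by (intro smooth_on_mult smooth_on_inverse smooth_on_add flat_smooth open_UNIV)
      (simp_all add: cutoff_denominator[THEN less_imp_neq, symmetric])
  then show ?thesis by (simp add: cutoff_def[abs_def])
qed

lemma cutoff_range: "0 \<le> cutoff t" "cutoff t \<le> 1"
  using flat_nonneg[of 0 t] flat_nonneg[of 0 "1 - t"] cutoff_denominator[of t]
  by (auto simp: cutoff_def divide_inverse[symmetric] divide_simps)

lemma cutoff_eq_1: "t \<ge> 1 \<Longrightarrow> cutoff t = 1"
  by (auto simp: cutoff_def flat_def)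

lemma cutoff_eq_0: "t \<le> 0 \<Longrightarrow> cutoff t = 0"
  by (auto simp: cutoff_def flat_def)

lemma smooth_bump_function:
  fixes c :: "'a::euclidean_space"
  assumes "r > 0"
  obtains b :: "'a \<Rightarrow> real" where "smooth_on UNIV b" "\<And>x. 0 \<le> b x" 
    "\<And>x. x \<in> ball c r \<Longrightarrow> b x = 1" "\<And>x. x \<notin> cball c (2 * r) \<Longrightarrow> b x = 0"
proof
  define q where "q = (\<lambda>x::'a. 2 - (\<Sum>i\<in>Basis. ((x \<bullet> i - c \<bullet> i) * (x \<bullet> i - c \<bullet>
      i)) * inverse (r * r)))"
  have q: "q x = 2 - (dist c x)\<^sup>2 / r\<^sup>2" for x
  proof -
    have "(dist c x)\<^sup>2 = (\<Sum>i\<in>Basis. (x \<bullet> i - c \<bullet> i) * (x \<bullet> i - c \<bullet> i))"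
      unfolding dist_norm power2_norm_eq_inner
      by (subst euclidean_inner) (simp add: inner_diff_left algebra_simps)
    then show ?thesis
      by (simp add: q_def sum_distrib_right[symmetric] divide_inverse power2_eq_square)
  qed
  have "smooth_on UNIV q"
    unfolding q_def
    by (intro smooth_on_diff smooth_on_sum smooth_on_mult smooth_on_const open_UNIV
        smooth_on_linear bounded_linear_inner_left)
  then show "smooth_on UNIV (\<lambda>x. cutoff (q x))"
    by (intro smooth_on_compose[OF _ _ cutoff_smooth]) auto
  show "0 \<le> cutoff (q x)" for x
    by (rule cutoff_range)
  show "cutoff (q x) = 1" if "x \<in> ball c r" for x
  proof -
    have "(dist c x)\<^sup>2 \<le> r\<^sup>2"
      using that by (intro power_mono) auto
    then show ?thesis
      using assms by (intro cutoff_eq_1) (simp add: q)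
  qed
  show "cutoff (q x) = 0" if "x \<notin> cball c (2 * r)" for x
  proof -
    have "(2 * r)\<^sup>2 \<le> (dist c x)\<^sup>2"
      using that assms by (intro power_mono) auto
    then have "4 * r\<^sup>2 \<le> (dist c x)\<^sup>2" by (simp add: power2_eq_square)
    then have "4 \<le> (dist c x)\<^sup>2 / r\<^sup>2"
      using assms by (simp add: pos_le_divide_eq)
    then show ?thesis
      by (intro cutoff_eq_0) (simp add: q)
  qed
qed

lemma second_difference_mvt:
  fixes f :: "'a::real_normed_vector \<Rightarrow> real"
  assumes f: "smooth_on S f" and "h > 0"
    and S: "\<And>s t. 0 \<le> s \<Longrightarrow> s \<le> h \<Longrightarrow> 0 \<le> t \<Longrightarrow> t \<le> h
        \<Longrightarrow> x + s *\<^sub>R u + t *\<^sub>R v \<in> S"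
  obtains s t where "0 \<le> s" "s \<le> h" "0 \<le> t" "t \<le> h"
    "f (x + h *\<^sub>R u + h *\<^sub>R v) - f (x + h *\<^sub>R u) - f (x + h *\<^sub>R v) + f x =
      h * h * frechet_derivative (\<lambda>y. frechet_derivative f (at y) u) (at (x + s *\<^sub>R u + t *\<^sub>R v)) v"
proof -
  have line: "((\<lambda>s. k (p + s *\<^sub>R w)) has_real_derivative frechet_derivative k (at (p + s *\<^sub>R w)) w) (at s)"
    if "smooth_on S k" "p + s *\<^sub>R w \<in> S" for k :: "'a \<Rightarrow> real" and p w s
  proof -
    have k: "(k has_derivative frechet_derivative k (at (p + s *\<^sub>R w))) (at (p + s *\<^sub>R w))"
      using that by (rule smooth_on_has_derivative)
    have "((\<lambda>s. p + s *\<^sub>R w) has_derivative (\<lambda>r. r *\<^sub>R w)) (at s)"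
      by (auto intro!: derivative_eq_intros)
    from has_derivative_compose[OF this k] show ?thesis
      using linear_scale[OF has_derivative_linear[OF k]]
      by (simp add: has_field_derivative_def mult_commute_abs)
  qed
  let ?fu = "\<lambda>y. frechet_derivative f (at y) u"
  have fu: "smooth_on S ?fu" by (rule smooth_on_frechet_derivative[OF f])
  have "\<exists>s>0. s < h \<and> (\<lambda>s. f ((x + h *\<^sub>R v) + s *\<^sub>R u) - f (x + s *\<^sub>R u)) h -
      (\<lambda>s. f ((x + h *\<^sub>R v) + s *\<^sub>R u) - f (x + s *\<^sub>R u)) 0
      = (h - 0) * (?fu ((x + h *\<^sub>R v) + s *\<^sub>R u) - ?fu (x + s *\<^sub>R u))"
  proof (rule MVT2[OF \<open>h > 0\<close>], rule DERIV_diff)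
    fix s assume s: "0 \<le> s" "s \<le> h"
    show "((\<lambda>s. f ((x + h *\<^sub>R v) + s *\<^sub>R u)) has_real_derivative ?fu ((x + h *\<^sub>R v) + s *\<^sub>R u)) (at s)"
      by (rule line[OF f]) (use S[OF s, of h] \<open>h > 0\<close> in \<open>simp add: add_ac\<close>)
    show "((\<lambda>s. f (x + s *\<^sub>R u)) has_real_derivative ?fu (x + s *\<^sub>R u)) (at s)"
      by (rule line[OF f]) (use S[OF s, of 0] \<open>h > 0\<close> in simp)
  qed
  then obtain s where s: "0 < s" "s < h"
    "(f (x + h *\<^sub>R u + h *\<^sub>R v) - f (x + h *\<^sub>R u)) - (f (x + h *\<^sub>R v) - f x)
      = h * (?fu (x + s *\<^sub>R u + h *\<^sub>R v) - ?fu (x + s *\<^sub>R u))"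
    by (auto simp: add_ac)
  have "\<exists>t>0. t < h \<and> ?fu ((x + s *\<^sub>R u) + h *\<^sub>R v) - ?fu ((x + s *\<^sub>R u) + 0 *\<^sub>R v)
      = (h - 0) * frechet_derivative ?fu (at ((x + s *\<^sub>R u) + t *\<^sub>R v)) v"
    by (rule MVT2[OF \<open>h > 0\<close>], rule line[OF fu]) (use S[of s] s in simp)
  then obtain t where t: "0 < t" "t < h"
    "?fu (x + s *\<^sub>R u + h *\<^sub>R v) - ?fu (x + s *\<^sub>R u)
      = h * frechet_derivative ?fu (at (x + s *\<^sub>R u + t *\<^sub>R v)) v"
    by auto
  show ?thesis
    by (rule that[of s t]) (use s t in \<open>auto simp: algebra_simps\<close>)
qed

lemma smooth_on_mixed_derivatives:
  fixes f :: "'a::real_normed_vector \<Rightarrow> real"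
  assumes "open S" "smooth_on S f" "x \<in> S"
  shows "frechet_derivative (\<lambda>y. frechet_derivative f (at y) u) (at x) v =
    frechet_derivative (\<lambda>y. frechet_derivative f (at y) v) (at x) u"
proof (rule ccontr)
  let ?A = "\<lambda>x. frechet_derivative (\<lambda>y. frechet_derivative f (at y) u) (at x) v"
  let ?B = "\<lambda>x. frechet_derivative (\<lambda>y. frechet_derivative f (at y) v) (at x) u"
  assume ne: "?A x \<noteq> ?B x"
  define e where "e = \<bar>?A x - ?B x\<bar> / 2"
  have "e > 0" using ne by (simp add: e_def)
  have "continuous_on S ?A" "continuous_on S ?B"
    by (intro smooth_on_continuous smooth_on_frechet_derivative assms(2))+
  then have "isCont ?A x" "isCont ?B x"
    using assms(1,3) by (simp_all add: continuous_on_eq_continuous_at)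
  then obtain d1 d2 where d: "d1 > 0" "\<And>y. dist y x < d1 \<Longrightarrow> dist (?A y) (?A x) < e"
    "d2 > 0" "\<And>y. dist y x < d2 \<Longrightarrow> dist (?B y) (?B x) < e"
    using \<open>e > 0\<close> unfolding continuous_at_eps_delta by metis
  obtain d3 where d3: "d3 > 0" "ball x d3 \<subseteq> S"
    using assms(1,3) open_contains_ball by blast
  define d where "d = min d1 (min d2 d3)"
  have "d > 0" using d d3 by (simp add: d_def)
  define h where "h = d / (2 * (norm u + norm v + 1))"
  have n: "norm u + norm v + 1 > 0" by (simp add: add_nonneg_pos)
  have "h > 0" using \<open>d > 0\<close> n by (simp add: h_def)
  have close: "dist (x + s *\<^sub>R u + t *\<^sub>R v) x < d" if "0 \<le> s" "s \<le> h" "0 \<le> t" "t \<le> h" for s t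
  proof -
    have "norm (s *\<^sub>R u + t *\<^sub>R v) \<le> s * norm u + t * norm v"
      using that by (intro order_trans[OF norm_triangle_ineq]) simp
    also have "\<dots> \<le> h * norm u + h * norm v"
      using that by (intro add_mono mult_right_mono) auto
    also have "\<dots> \<le> h * (norm u + norm v + 1)"
      using \<open>h > 0\<close> by (simp add: algebra_simps)
    also have "\<dots> = d / 2" using n by (simp add: h_def field_simps)
    also have "\<dots> < d" using \<open>d > 0\<close> by simp
    finally show ?thesis by (simp add: dist_norm add.assoc)
  qed
  have inS: "x + s *\<^sub>R u + t *\<^sub>R v \<in> S" "x + s *\<^sub>R v + t *\<^sub>R u \<in> S"
    if "0 \<le> s" "s \<le> h" "0 \<le> t" "t \<le> h" for s t
    using close[OF that] close[OF that(3,4,1,2)] d3(2) 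
    by (auto simp: subset_iff dist_commute d_def add_ac)
  obtain s t where st: "0 \<le> s" "s \<le> h" "0 \<le> t" "t \<le> h"
    "f (x + h *\<^sub>R u + h *\<^sub>R v) - f (x + h *\<^sub>R u) - f (x + h *\<^sub>R v) + f x = h * h * ?A (x + s *\<^sub>R u + t *\<^sub>R v)"
    by (rule second_difference_mvt[OF assms(2) \<open>h > 0\<close> inS(1)])
  obtain s' t' where st': "0 \<le> s'" "s' \<le> h" "0 \<le> t'" "t' \<le> h"
    "f (x + h *\<^sub>R v + h *\<^sub>R u) - f (x + h *\<^sub>R v) - f (x + h *\<^sub>R u) + f x = h * h * ?B (x + s' *\<^sub>R v + t' *\<^sub>R u)"
    by (rule second_difference_mvt[OF assms(2) \<open>h > 0\<close> inS(2)])
  have "h * h * ?A (x + s *\<^sub>R u + t *\<^sub>R v) = h * h * ?B (x + s' *\<^sub>R v + t' *\<^sub>R u)"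
  proof -
    have "f (x + h *\<^sub>R u + h *\<^sub>R v) = f (x + h *\<^sub>R v + h *\<^sub>R u)" by (simp add: add_ac)
    then show ?thesis using st(5) st'(5) by linarith
  qed
  then have eq: "?A (x + s *\<^sub>R u + t *\<^sub>R v) = ?B (x + t' *\<^sub>R u + s' *\<^sub>R v)"
    using \<open>h > 0\<close> by (simp add: add_ac)
  have "dist (?A (x + s *\<^sub>R u + t *\<^sub>R v)) (?A x) < e"
    using close[OF st(1-4)] by (intro d(2)) (simp add: d_def)
  moreover have "dist (?B (x + t' *\<^sub>R u + s' *\<^sub>R v)) (?B x) < e"
    using close[OF st'(3,4,1,2)] by (intro d(4)) (simp add: d_def)
  ultimately show False
    unfolding eq dist_real_def e_def by argo
qed

text \<open>The weight \<open>t ^ m\<close> makes the induction work: differentiating under the integral raises \<open>m\<close>.\<close>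

lemma Ck_on_radial_integral:
  fixes f :: "'a::euclidean_space \<Rightarrow> real"
  assumes "Ck_on k (ball p r) f"
  shows "Ck_on k (ball p r) (\<lambda>x. integral (cbox 0 1) (\<lambda>t. t ^ m * f (p + t *\<^sub>R (x - p))))"
  using assms
proof (induction k arbitrary: f m)
  have inball: "p + t *\<^sub>R (x - p) \<in> ball p r" if "x \<in> ball p r" "t \<in> cbox (0::real) 1" for x t
  proof -
    have "t * norm (x - p) \<le> norm (x - p)"
      using that by (intro mult_left_le_one_le) auto
    then show ?thesis
      using that by (auto simp: dist_norm norm_minus_commute)
  qed
  have cont: "continuous_on (ball p r \<times> cbox 0 1) (\<lambda>(x, t). t ^ m * f (p + t *\<^sub>R (x - p)))"
    if "continuous_on (ball p r) f" for f :: "'a \<Rightarrow> real" and m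
    unfolding case_prod_beta
    by (intro continuous_intros continuous_on_compose2[OF that]) (use inball in auto)
  {
    case 0
    then show ?case
      using integral_continuous_on_param[OF cont] by simp
  next
    case (Suc k)
    let ?D = "\<lambda>y. frechet_derivative f (at y)"
    let ?y = "\<lambda>x t. p + t *\<^sub>R (x - p)"
    define fx where "fx x t = Blinfun (\<lambda>v. t ^ Suc m * ?D (?y x t) v)" for x t
    have D: "(f has_derivative ?D y) (at y)" if "y \<in> ball p r" for y
      using Suc.prems that by (simp add: has_frechet_derivative)
    have bl: "bounded_linear (\<lambda>v. t ^ Suc m * ?D (?y x t) v)" if "x \<in> ball p r" "t \<in> cbox 0 1" for x t
      by (intro bounded_linear_const_mult has_derivative_bounded_linear[OF D[OF inball[OF that]]])
    have fx: "blinfun_apply (fx x t) v = t ^ Suc m * ?D (?y x t) v" if "x \<in> ball p r" "t \<in> cbox 0 1" for x t v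
      unfolding fx_def by (simp only: bounded_linear_Blinfun_apply[OF bl[OF that]])
    have contf: "continuous_on (ball p r) f"
      using Ck_on_SucD[OF open_ball Suc.prems] D
      by (intro continuous_at_imp_continuous_on ballI has_derivative_continuous[OF D]) 
    have contD: "continuous_on (ball p r) (\<lambda>y. ?D y v)" for v
    proof -
      have "Ck_on k (ball p r) (\<lambda>y. ?D y v)" using Suc.prems by simp
      then show ?thesis
        by (induction k) (simp, metis Ck_on_SucD open_ball)
    qed
    have cfx: "continuous_on (ball p r \<times> cbox 0 1) (\<lambda>(x, t). fx x t)"
    proof (rule continuous_on_blinfun_componentwise)
      fix i :: 'a
      show "continuous_on (ball p r \<times> cbox 0 1) (\<lambda>z. blinfun_apply (case z of (x, t) \<Rightarrow> fx x t) i)"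
        using cont[OF contD[of i], of "Suc m"]
        by (rule continuous_on_cong[THEN iffD1, rotated -1]) (auto simp: fx)
    qed
    show ?case
    proof (rule Ck_on_SucI[OF open_ball, where
          f' = "\<lambda>x v. integral (cbox 0 1) (\<lambda>t. t ^ Suc m * ?D (?y x t) v)"])
      fix x assume x: "x \<in> ball p r"
      have "((\<lambda>x. integral (cbox 0 1) (\<lambda>t. t ^ m * f (?y x t))) has_derivative
          integral (cbox 0 1) (fx x)) (at x within ball p r)"
      proof (rule leibniz_rule[OF _ _ cfx x convex_ball])
        fix x t assume xt: "x \<in> ball p r" "t \<in> cbox (0::real) 1"
        have "((\<lambda>x. ?y x t) has_derivative (\<lambda>v. t *\<^sub>R v)) (at x)"
          by (auto intro!: derivative_eq_intros)
        from has_derivative_compose[OF this D[OF inball[OF xt]]]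
        have "((\<lambda>x. t ^ m * f (?y x t)) has_derivative (\<lambda>v. t ^ m * ?D (?y x t) (t *\<^sub>R v))) (at x)"
          by (intro has_derivative_mult_right)
        moreover have "t ^ m * ?D (?y x t) (t *\<^sub>R v) = blinfun_apply (fx x t) v" for v
          using linear_scale[OF has_derivative_linear[OF D[OF inball[OF xt]]]] by (simp add: fx[OF xt])
        ultimately show "((\<lambda>x. t ^ m * f (?y x t)) has_derivative blinfun_apply (fx x t)) (at x within ball p r)"
          by (simp add: has_derivative_at_withinI)
      next
        fix x assume x: "x \<in> ball p r"
        show "(\<lambda>t. t ^ m * f (?y x t)) integrable_on cbox 0 1"
          by (intro integrable_continuous continuous_intros continuous_on_compose2[OF contf])
            (use inball[OF x] in auto)
      qed
      moreover have "blinfun_apply (integral (cbox 0 1) (fx x)) v = integral (cbox 0 1) (\<lambda>t. t ^ Suc m * ?D (?y x t) v)" for v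
      proof -
        have "continuous_on (cbox 0 1) (fx x)"
          using continuous_on_compose2[OF cfx, of "cbox 0 1" "\<lambda>t. (x, t)"] x
          by (force simp: continuous_on_Pair)
        then have "blinfun_apply (integral (cbox 0 1) (fx x)) v = integral (cbox 0 1) (\<lambda>t. blinfun_apply (fx x t) v)"
          by (intro blinfun_apply_integral integrable_continuous)
        also have "\<dots> = integral (cbox 0 1) (\<lambda>t. t ^ Suc m * ?D (?y x t) v)"
          by (intro integral_cong fx[OF x])
        finally show ?thesis .
      qed
      ultimately show "((\<lambda>x. integral (cbox 0 1) (\<lambda>t. t ^ m * f (?y x t))) has_derivative
          (\<lambda>v. integral (cbox 0 1) (\<lambda>t. t ^ Suc m * ?D (?y x t) v))) (at x)"
        unfolding at_within_open[OF x open_ball]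
        by (auto elim!: has_derivative_eq_rhs simp: fun_eq_iff)
    next
      fix v
      show "Ck_on k (ball p r) (\<lambda>x. integral (cbox 0 1) (\<lambda>t. t ^ Suc m * ?D (?y x t) v))"
        using Suc.prems by (intro Suc.IH) simp
    qed
  }
qed

lemma hadamard:
  fixes f :: "'a::euclidean_space \<Rightarrow> real"
  assumes "smooth_on (ball p r) f"
  obtains h where "\<And>i. smooth_on (ball p r) (h i)"
    "\<And>x. x \<in> ball p r \<Longrightarrow> f x = f p + (\<Sum>i\<in>Basis. ((x - p) \<bullet> i) * h i x)"
proof
  let ?D = "\<lambda>y. frechet_derivative f (at y)"
  let ?h = "\<lambda>i x. integral (cbox 0 1) (\<lambda>t. t ^ 0 * ?D (p + t *\<^sub>R (x - p)) i)"
  have sm: "smooth_on (ball p r) (\<lambda>y. ?D y i)" for i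
    by (rule smooth_on_frechet_derivative[OF assms])
  show "smooth_on (ball p r) (?h i)" for i
    using sm[of i] unfolding smooth_on_def by (intro allI Ck_on_radial_integral) blast
  fix x assume x: "x \<in> ball p r"
  have inball: "p + t *\<^sub>R (x - p) \<in> ball p r" if "t \<in> {0..1}" for t
  proof -
    have "t * norm (x - p) \<le> norm (x - p)"
      using that by (intro mult_left_le_one_le) auto
    then show ?thesis
      using that x by (auto simp: dist_norm norm_minus_commute)
  qed
  have der: "((\<lambda>t. f (p + t *\<^sub>R (x - p))) has_vector_derivative ?D (p + t *\<^sub>R (x - p)) (x - p)) (at t within {0..1})"
    if t: "t \<in> {0..1}" for t
  proof -
    have 1: "((\<lambda>t. p + t *\<^sub>R (x - p)) has_derivative (\<lambda>s. s *\<^sub>R (x - p))) (at t within {0..1})"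
      by (auto intro!: derivative_eq_intros)
    have 2: "(f has_derivative ?D (p + t *\<^sub>R (x - p))) (at (p + t *\<^sub>R (x - p)))"
      by (rule smooth_on_has_derivative[OF assms inball[OF t]])
    from has_derivative_compose[OF 1 2] show ?thesis
      using linear_scale[OF has_derivative_linear[OF 2]] by (simp add: has_vector_derivative_def)
  qed
  have "((\<lambda>t. ?D (p + t *\<^sub>R (x - p)) (x - p)) has_integral
      (f (p + 1 *\<^sub>R (x - p)) - f (p + 0 *\<^sub>R (x - p)))) {0..1}"
    by (rule fundamental_theorem_of_calculus) (use der in auto)
  then have 1: "integral {0..1} (\<lambda>t. ?D (p + t *\<^sub>R (x - p)) (x - p)) = f x - f p"
    by (simp add: integral_unique)
  have int: "(\<lambda>t. ?D (p + t *\<^sub>R (x - p)) i) integrable_on {0..1}" for i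
    by (intro integrable_continuous_real continuous_on_compose2[OF smooth_on_continuous[OF sm]] continuous_intros)
      (use inball in auto)
  have "integral {0..1} (\<lambda>t. ?D (p + t *\<^sub>R (x - p)) (x - p)) =
      integral {0..1} (\<lambda>t. \<Sum>i\<in>Basis. ((x - p) \<bullet> i) * ?D (p + t *\<^sub>R (x - p)) i)"
  proof (rule integral_cong)
    fix t :: real assume t: "t \<in> {0..1}"
    have lin: "linear (?D (p + t *\<^sub>R (x - p)))"
      by (rule has_derivative_linear[OF smooth_on_has_derivative[OF assms inball[OF t]]])
    have "?D (p + t *\<^sub>R (x - p)) (\<Sum>i\<in>Basis. ((x - p) \<bullet> i) *\<^sub>R i) =
        (\<Sum>i\<in>Basis. ((x - p) \<bullet> i) * ?D (p + t *\<^sub>R (x - p)) i)"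
      by (simp add: linear_sum[OF lin] linear_scale[OF lin])
    then show "?D (p + t *\<^sub>R (x - p)) (x - p) = (\<Sum>i\<in>Basis. ((x - p) \<bullet> i) * ?D (p + t *\<^sub>R (x - p)) i)"
      by (simp add: euclidean_representation)
  qed
  also have "\<dots> = (\<Sum>i\<in>Basis. integral {0..1} (\<lambda>t. ((x - p) \<bullet> i) * ?D (p + t *\<^sub>R (x - p)) i))"
    by (rule integral_sum) (auto intro: integrable_on_mult_right int)
  also have "\<dots> = (\<Sum>i\<in>Basis. ((x - p) \<bullet> i) * ?h i x)"
    by simp
  finally show "f x = f p + (\<Sum>i\<in>Basis. ((x - p) \<bullet> i) * ?h i x)"
    using 1 by simp
qed

lemma has_integral_derivative_compact_support:
  fixes f :: "'a::euclidean_space \<Rightarrow> real"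
  assumes f: "\<And>x. (f has_derivative f' x) (at x)"
    and cont: "continuous_on UNIV (\<lambda>x. f' x v)"
    and K: "compact K" "\<And>x. x \<notin> K \<Longrightarrow> f x = 0"
  shows "((\<lambda>x. f' x v) has_integral 0) UNIV"
proof -
  have "bounded ((\<lambda>(x, t). x + t *\<^sub>R v) ` (K \<times> {-1..1}))"
    using K(1) by (intro compact_imp_bounded compact_continuous_image compact_Times)
      (auto simp: case_prod_beta intro!: continuous_intros)
  then obtain a where a: "(\<lambda>(x, t). x + t *\<^sub>R v) ` (K \<times> {-1..1}) \<subseteq> cbox (- a) a"
    using bounded_subset_cbox_symmetric by blast
  have a: "x + t *\<^sub>R v \<in> cbox (- a) a" if "x \<in> K" "-1 \<le> t" "t \<le> 1" for x t
    using that a by (force simp: image_subset_iff)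
  have contf: "continuous_on S f" for S
    using f by (intro continuous_at_imp_continuous_on ballI has_derivative_continuous)
  define I where "I = integral (cbox (- a) a) f"
  have I: "(f has_integral I) UNIV"
  proof (rule has_integral_on_superset[where S = "cbox (- a) a"])
    show "(f has_integral I) (cbox (- a) a)"
      unfolding I_def by (intro integrable_integral integrable_continuous contf)
    show "f x = 0" if "x \<notin> cbox (- a) a" for x
      using that a[of x 0] K(2) by auto
  qed simp
  have const: "integral (cbox (- a) a) (\<lambda>x. f (x + t *\<^sub>R v)) = I" if t: "t \<in> {-1..1}" for t
  proof -
    define I' where "I' = integral (cbox (- a + t *\<^sub>R v) (a + t *\<^sub>R v)) f"
    have 1: "(f has_integral I') (cbox (- a + t *\<^sub>R v) (a + t *\<^sub>R v))"
      unfolding I'_def by (intro integrable_integral integrable_continuous contf)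
    have "(f has_integral I') UNIV"
    proof (rule has_integral_on_superset[OF 1])
      fix x assume x: "x \<notin> cbox (- a + t *\<^sub>R v) (a + t *\<^sub>R v)"
      have "x + (- t) *\<^sub>R v \<notin> cbox (- a) a"
        using x by (auto simp: mem_box inner_add_left inner_diff_left algebra_simps)
      then show "f x = 0"
        using a[of x "- t"] K(2) t by auto
    qed simp
    then have "I' = I" using I has_integral_unique by blast
    moreover have "((f \<circ> (+) (t *\<^sub>R v)) has_integral I') (cbox (- a) a)"
      unfolding has_integral_shift_cbox_iff by (rule 1)
    ultimately show ?thesis
      by (auto simp: o_def add.commute integral_unique)
  qed
  have "((\<lambda>t. integral (cbox (- a) a) (\<lambda>x. f (x + t *\<^sub>R v))) has_real_derivative
      integral (cbox (- a) a) (\<lambda>x. f' (x + 0 *\<^sub>R v) v)) (at 0 within {-1..1})"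
  proof (rule leibniz_rule_field_derivative)
    fix t x
    have 1: "((\<lambda>t. x + t *\<^sub>R v) has_derivative (\<lambda>s. s *\<^sub>R v)) (at t within {-1..1})"
      by (auto intro!: derivative_eq_intros)
    from has_derivative_compose[OF 1 f]
    show "((\<lambda>t. f (x + t *\<^sub>R v)) has_real_derivative f' (x + t *\<^sub>R v) v) (at t within {-1..1})"
      using linear_scale[OF has_derivative_linear[OF f]] by (simp add: has_field_derivative_def mult_commute_abs)
  next
    show "(\<lambda>x. f (x + t *\<^sub>R v)) integrable_on cbox (- a) a" for t
      by (intro integrable_continuous continuous_on_compose2[OF contf[of UNIV]] continuous_intros) auto
    show "continuous_on ({- 1..1} \<times> cbox (- a) a) (\<lambda>(t, x). f' (x + t *\<^sub>R v) v)"
      unfolding case_prod_beta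
      by (intro continuous_on_compose2[OF cont] continuous_intros) auto
  qed auto
  then have "((\<lambda>t. I) has_real_derivative integral (cbox (- a) a) (\<lambda>x. f' x v)) (at 0 within {-1..1})"
    by (subst has_field_derivative_cong_eventually[where g = "\<lambda>t. integral (cbox (- a) a) (\<lambda>x. f (x + t *\<^sub>R v))"])
      (use const[of 0] const in \<open>auto simp: eventually_at_filter\<close>)
  moreover have "((\<lambda>t. I) has_real_derivative 0) (at 0 within {-1..1})" by simp
  moreover have "at (0::real) within {-1..1} = at 0"
    by (rule at_within_Icc_at) auto
  ultimately have "integral (cbox (- a) a) (\<lambda>x. f' x v) = 0"
    using DERIV_unique by metis
  moreover have "(\<lambda>x. f' x v) integrable_on cbox (- a) a"
    by (intro integrable_continuous continuous_on_subset[OF cont]) simp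
  ultimately have "((\<lambda>x. f' x v) has_integral 0) (cbox (- a) a)"
    by (metis integrable_integral)
  then show ?thesis
  proof (rule has_integral_on_superset)
    fix x assume "x \<notin> cbox (- a) a"
    then have x: "x \<in> - K" using a[of x 0] by auto
    have "((\<lambda>x. 0) has_derivative (\<lambda>v. 0)) (at x)" by simp
    then have "(f has_derivative (\<lambda>v. 0)) (at x)"
      by (rule has_derivative_transform_within_open[OF _ open_Compl[OF compact_imp_closed[OF K(1)]] x])
        (use K(2) in auto)
    then show "f' x v = 0"
      using f has_derivative_unique by metis
  qed simp
qed

subsection \<open>Smooth manifolds\<close>

locale manifold =
  fixes A :: "('a::{t2_space, second_countable_topology}, 'n::finite) atlas"
  assumes atlas: "smooth_atlas A"
begin

lemma chart_exists: obtains U \<phi> where "(U, \<phi>) \<in> A" "p \<in> U"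
  using atlas unfolding smooth_atlas_def by (metis (no_types, lifting) UN_E UNIV_I case_prod_unfold prod.collapse)

lemma chart_open: "(U, \<phi>) \<in> A \<Longrightarrow> open U" "(U, \<phi>) \<in> A \<Longrightarrow> open (\<phi> ` U)"
  and chart_homeomorphism: "(U, \<phi>) \<in> A \<Longrightarrow> homeomorphism U (\<phi> ` U) \<phi> (inv_into U \<phi>)"
  using atlas unfolding smooth_atlas_def by fast+

lemma chart_inv: "(U, \<phi>) \<in> A \<Longrightarrow> p \<in> U \<Longrightarrow> inv_into U \<phi> (\<phi> p) = p"
  using chart_homeomorphism[of U \<phi>] by (simp add: homeomorphism_def)

lemma chart_continuous: "(U, \<phi>) \<in> A \<Longrightarrow> continuous_on U \<phi>"
  "(U, \<phi>) \<in> A \<Longrightarrow> continuous_on (\<phi> ` U) (inv_into U \<phi>)"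
  using chart_homeomorphism[of U \<phi>] by (simp_all add: homeomorphism_def)

lemma chart_transition:
  "(U, \<phi>) \<in> A \<Longrightarrow> (V, \<psi>) \<in> A \<Longrightarrow> smooth_on (\<phi> ` (U \<inter> V)) (\<psi> \<circ> inv_into U \<phi>)"
  using atlas unfolding smooth_atlas_def by fast

lemma chart_image_open:
  assumes "(U, \<phi>) \<in> A" "open W" "W \<subseteq> U"
  shows "open (\<phi> ` W)"
proof -
  have "\<phi> ` W = \<phi> ` U \<inter> inv_into U \<phi> -` W"
    using assms chart_inv[OF assms(1)] by (auto simp: subset_iff image_iff)
  then show ?thesis
    using chart_open[OF assms(1)] chart_continuous[OF assms(1)] assms(2)
    by (metis continuous_on_open_vimage Int_commute)
qed

lemma chart_vimage_open:
  assumes "(U, \<phi>) \<in> A" "open B"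
  shows "open (U \<inter> \<phi> -` B)"
  using chart_continuous(1)[OF assms(1)] assms(2)
  unfolding continuous_on_open_vimage[OF chart_open(1)[OF assms(1)]] by (metis Int_commute)

lemma smooth_funs_localI:
  assumes "\<And>p. \<exists>U \<phi> W. (U, \<phi>) \<in> A \<and> open W \<and> p \<in> W \<and> W \<subseteq> U \<and>
      smooth_on (\<phi> ` W) (f \<circ> inv_into U \<phi>)"
  shows "f \<in> smooth_funs A"
proof -
  have "smooth_on (\<psi> ` V) (f \<circ> inv_into V \<psi>)" if V: "(V, \<psi>) \<in> A" for V \<psi>
  proof (rule smooth_on_local)
    fix y assume "y \<in> \<psi> ` V"
    then obtain p where p: "p \<in> V" "y = \<psi> p" by auto
    obtain U \<phi> W where W: "(U, \<phi>) \<in> A" "open W" "p \<in> W" "W \<subseteq> U" "smooth_on (\<phi> ` W) (f \<circ> inv_into U \<phi>)"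
      using assms by blast
    have o: "open (\<psi> ` (V \<inter> W))"
      by (rule chart_image_open[OF V]) (use W chart_open[OF V] in auto)
    have "smooth_on (\<psi> ` (V \<inter> W)) (\<lambda>z. (f \<circ> inv_into U \<phi>) ((\<phi> \<circ> inv_into V \<psi>) z))"
    proof (rule smooth_on_compose[OF o chart_image_open[OF W(1,2,4)] W(5)])
      show "smooth_on (\<psi> ` (V \<inter> W)) (\<phi> \<circ> inv_into V \<psi>)"
        by (rule smooth_on_subset[OF chart_transition[OF V W(1)]]) (use W(4) in auto)
      show "(\<phi> \<circ> inv_into V \<psi>) z \<in> \<phi> ` W" if "z \<in> \<psi> ` (V \<inter> W)" for z
        using that chart_inv[OF V] by auto
    qed
    then have "smooth_on (\<psi> ` (V \<inter> W)) (f \<circ> inv_into V \<psi>)"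
      by (rule smooth_on_cong[OF o, rotated]) (use chart_inv[OF V] chart_inv[OF W(1)] W(4) in auto)
    then show "\<exists>T. open T \<and> y \<in> T \<and> smooth_on T (f \<circ> inv_into V \<psi>)"
      using o p W(3) by blast
  qed
  then show ?thesis by (auto simp: smooth_funs_def)
qed

lemma smooth_funsD: "f \<in> smooth_funs A \<Longrightarrow> (U, \<phi>) \<in> A \<Longrightarrow> smooth_on (\<phi> ` U) (f
    \<circ> inv_into U \<phi>)"
  unfolding smooth_funs_def by fast

lemma smooth_funsI: "(\<And>U \<phi>. (U, \<phi>) \<in> A \<Longrightarrow> smooth_on (\<phi> ` U) (\<lambda>x. f (inv_into U
    \<phi> x))) \<Longrightarrow> f \<in> smooth_funs A"
  unfolding smooth_funs_def comp_def by fast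

lemma smooth_funsD': "f \<in> smooth_funs A \<Longrightarrow> (U, \<phi>) \<in> A \<Longrightarrow> smooth_on (\<phi> ` U)
    (\<lambda>x. f (inv_into U \<phi> x))"
  using smooth_funsD by (simp add: comp_def)

lemma smooth_funs_const: "(\<lambda>p. c) \<in> smooth_funs A"
  by (rule smooth_funsI, rule smooth_on_const[OF chart_open(2)])

lemma smooth_funs_add: "f \<in> smooth_funs A \<Longrightarrow> h \<in> smooth_funs A \<Longrightarrow> (\<lambda>p. f p + h p) \<in> smooth_funs A"
  by (rule smooth_funsI, rule smooth_on_add[OF chart_open(2) smooth_funsD' smooth_funsD'])

lemma smooth_funs_mult: "f \<in> smooth_funs A \<Longrightarrow> h \<in> smooth_funs A \<Longrightarrow> (\<lambda>p. f p * h p) \<in> smooth_funs A"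
  by (rule smooth_funsI, rule smooth_on_mult[OF chart_open(2) smooth_funsD' smooth_funsD'])

lemma smooth_funs_diff: "f \<in> smooth_funs A \<Longrightarrow> h \<in> smooth_funs A \<Longrightarrow> (\<lambda>p. f p - h p) \<in> smooth_funs A"
  by (rule smooth_funsI, rule smooth_on_diff[OF chart_open(2) smooth_funsD' smooth_funsD'])

lemma smooth_funs_sum: "(\<And>i. i \<in> I \<Longrightarrow> f i \<in> smooth_funs A) \<Longrightarrow> (\<lambda>p.
    \<Sum>i\<in>I. f i p) \<in> smooth_funs A"
  by (rule smooth_funsI, rule smooth_on_sum[OF chart_open(2) smooth_funsD'])

lemma smooth_funs_inverse:
  "f \<in> smooth_funs A \<Longrightarrow> (\<And>p. f p \<noteq> 0) \<Longrightarrow> (\<lambda>p. inverse (f p)) \<in> smooth_funs A"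
  by (rule smooth_funsI, rule smooth_on_inverse[OF chart_open(2) smooth_funsD'])

lemma smooth_funs_continuous:
  assumes "f \<in> smooth_funs A"
  shows "continuous_on UNIV f"
proof -
  have "isCont f p" for p
  proof -
    obtain U \<phi> where U: "(U, \<phi>) \<in> A" "p \<in> U" by (rule chart_exists)
    have "continuous_on U (\<lambda>q. (f \<circ> inv_into U \<phi>) (\<phi> q))"
      by (rule continuous_on_compose2[OF smooth_on_continuous[OF smooth_funsD[OF assms U(1)]] chart_continuous(1)[OF U(1)]]) simp
    then have "continuous_on U f"
      by (rule continuous_on_cong[THEN iffD1, rotated -1]) (simp_all add: chart_inv[OF U(1)])
    then show ?thesis
      using U chart_open[OF U(1)] by (simp add: continuous_on_eq_continuous_at)
  qed
  then show ?thesis by (simp add: continuous_at_imp_continuous_on)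
qed

lemma smooth_funs_extend_by_zero:
  assumes U: "(U, \<phi>) \<in> A" and h: "smooth_on (\<phi> ` U) h" and K: "compact K"
    and 0: "\<And>q. q \<in> U \<Longrightarrow> q \<notin> K \<Longrightarrow> h (\<phi> q) = 0" and "K \<subseteq> U"
  shows "(\<lambda>q. if q \<in> U then h (\<phi> q) else 0) \<in> smooth_funs A" (is "?f \<in> _")
proof (rule smooth_funs_localI)
  fix p
  show "\<exists>U \<phi> W. (U, \<phi>) \<in> A \<and> open W \<and> p \<in> W \<and> W \<subseteq> U \<and> smooth_on (\<phi>
      ` W) (?f \<circ> inv_into U \<phi>)"
  proof (cases "p \<in> U")
    case True
    have "smooth_on (\<phi> ` U) (?f \<circ> inv_into U \<phi>)"
      by (rule smooth_on_cong[OF chart_open(2)[OF U] _ h]) (use chart_inv[OF U] in auto)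
    then show ?thesis using True U chart_open[OF U] by blast
  next
    case False
    obtain V \<psi> where V: "(V, \<psi>) \<in> A" "p \<in> V" by (rule chart_exists)
    have o: "open (V - K)"
      using chart_open[OF V(1)] K by (intro open_Diff compact_imp_closed)
    have o': "open (\<psi> ` (V - K))"
      by (rule chart_image_open[OF V(1) o]) auto
    have "smooth_on (\<psi> ` (V - K)) (?f \<circ> inv_into V \<psi>)"
      by (rule smooth_on_cong[OF o' _ smooth_on_const[OF o', of 0]]) (use chart_inv[OF V(1)] 0 in auto)
    then show ?thesis using V o False \<open>K \<subseteq> U\<close> by blast
  qed
qed

lemma chart_bump:
  assumes U: "(U, \<phi>) \<in> A" and p: "p \<in> U" "p \<in> W" "open W"
  obtains \<beta> :: "real^'n \<Rightarrow> real" and K N where "smooth_on UNIV \<beta>" "\<And>x. 0 \<le> \<beta> x" "compact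
      K" "K \<subseteq> U \<inter> W" "open N" "p \<in> N" "N \<subseteq> K"
    "\<And>q. q \<in> N \<Longrightarrow> \<beta> (\<phi> q) = 1" "\<And>q. q \<in> U \<Longrightarrow> q \<notin> K
        \<Longrightarrow> \<beta> (\<phi> q) = 0"
proof -
  have "open (\<phi> ` (U \<inter> W))"
    by (rule chart_image_open[OF U]) (use p chart_open[OF U] in auto)
  then obtain e where e: "e > 0" "cball (\<phi> p) e \<subseteq> \<phi> ` (U \<inter> W)"
    using p open_contains_cball by blast
  define r where "r = e / 2"
  have r: "r > 0" "2 * r = e" using e by (simp_all add: r_def)
  obtain \<beta> :: "real^'n \<Rightarrow> real" where \<beta>: "smooth_on UNIV \<beta>" "\<And>x. 0 \<le> \<beta> x"
    "\<And>x. x \<in> ball (\<phi> p) r \<Longrightarrow> \<beta> x = 1" "\<And>x. x \<notin> cball (\<phi> p) (2 * r)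
        \<Longrightarrow> \<beta> x = 0"
    using smooth_bump_function[OF r(1), of "\<phi> p"] by metis
  let ?K = "inv_into U \<phi> ` cball (\<phi> p) e"
  let ?N = "U \<inter> \<phi> -` ball (\<phi> p) r"
  show ?thesis
  proof (rule that[of \<beta> ?K ?N])
    show "compact ?K"
      by (intro compact_continuous_image continuous_on_subset[OF chart_continuous(2)[OF U]]) (use e in auto)
    show "?K \<subseteq> U \<inter> W"
    proof
      fix q assume "q \<in> ?K"
      then obtain x where x: "x \<in> cball (\<phi> p) e" "q = inv_into U \<phi> x" by blast
      then obtain q' where "q' \<in> U \<inter> W" "x = \<phi> q'" using e(2) by blast
      then show "q \<in> U \<inter> W" using x chart_inv[OF U] by simp
    qed
    show "open ?N"
      by (rule chart_vimage_open[OF U open_ball])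
    show "p \<in> ?N" using p r by simp
    show "?N \<subseteq> ?K"
    proof
      fix q assume "q \<in> ?N"
      then have "q \<in> U" "\<phi> q \<in> cball (\<phi> p) e" using r by auto
      then show "q \<in> ?K" using chart_inv[OF U, of q] by (metis image_eqI)
    qed
    show "\<beta> (\<phi> q) = 0" if "q \<in> U" "q \<notin> ?K" for q
    proof (rule \<beta>(4), unfold r(2), rule notI)
      assume "\<phi> q \<in> cball (\<phi> p) e"
      then show False using that chart_inv[OF U, of q] by (metis image_eqI)
    qed
  qed (use \<beta> in auto)
qed

lemma smooth_bump:
  assumes "p \<in> W" "open W"
  obtains b N where "b \<in> smooth_funs A" "open N" "p \<in> N" "N \<subseteq> W" "\<And>q. q \<in> N \<Longrightarrow> b q = 1"
    "\<And>q. q \<notin> W \<Longrightarrow> b q = 0"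
proof -
  obtain U \<phi> where U: "(U, \<phi>) \<in> A" "p \<in> U" by (rule chart_exists)
  obtain \<beta> :: "real^'n \<Rightarrow> real" and K N where *: "smooth_on UNIV \<beta>" "\<And>x. 0 \<le> \<beta> x"
      "compact K" "K \<subseteq> U \<inter> W" "open N" "p \<in> N" "N \<subseteq> K"
    "\<And>q. q \<in> N \<Longrightarrow> \<beta> (\<phi> q) = 1" "\<And>q. q \<in> U \<Longrightarrow> q \<notin> K
        \<Longrightarrow> \<beta> (\<phi> q) = 0"
    by (rule chart_bump[OF U assms]) blast
  show ?thesis
  proof (rule that[of "\<lambda>q. if q \<in> U then \<beta> (\<phi> q) else 0" N])
    show "(\<lambda>q. if q \<in> U then \<beta> (\<phi> q) else 0) \<in> smooth_funs A"
      by (rule smooth_funs_extend_by_zero[OF U(1) smooth_on_subset[OF *(1)] *(3)]) (use * in auto)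
    show "(if q \<in> U then \<beta> (\<phi> q) else 0) = 0" if "q \<notin> W" for q
      using that * by (simp add: subset_iff) blast
  qed (use * in auto)
qed

lemma smooth_extension:
  assumes U: "(U, \<phi>) \<in> A" and p: "p \<in> W" "open W" "W \<subseteq> U" and h: "smooth_on (\<phi> ` W) h"
  obtains f N where "f \<in> smooth_funs A" "open N" "p \<in> N" "N \<subseteq> W" "\<And>q. q \<in> N \<Longrightarrow> f q = h (\<phi> q)"
proof -
  obtain \<beta> :: "real^'n \<Rightarrow> real" and K N where *: "smooth_on UNIV \<beta>" "\<And>x. 0 \<le> \<beta> x"
      "compact K" "K \<subseteq> U \<inter> W" "open N" "p \<in> N" "N \<subseteq> K"
    "\<And>q. q \<in> N \<Longrightarrow> \<beta> (\<phi> q) = 1" "\<And>q. q \<in> U \<Longrightarrow> q \<notin> K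
        \<Longrightarrow> \<beta> (\<phi> q) = 0"
    by (rule chart_bump[OF U _ p(1,2)]) (use p in auto)
  define h' where "h' x = (if x \<in> \<phi> ` W then \<beta> x * h x else 0)" for x
  have oW: "open (\<phi> ` W)" by (rule chart_image_open[OF U p(2,3)])
  have oUK: "open (\<phi> ` (U - K))"
    by (rule chart_image_open[OF U]) (use chart_open[OF U] compact_imp_closed[OF *(3)] in auto)
  have "smooth_on (\<phi> ` U) h'"
  proof (rule smooth_on_local)
    fix x assume x: "x \<in> \<phi> ` U"
    show "\<exists>T. open T \<and> x \<in> T \<and> smooth_on T h'"
    proof (cases "x \<in> \<phi> ` W")
      case True
      have "smooth_on (\<phi> ` W) h'"
        by (rule smooth_on_cong[OF oW _ smooth_on_mult[OF oW smooth_on_subset[OF *(1)] h]]) (auto simp: h'_def)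
      then show ?thesis using True oW by blast
    next
      case False
      have "smooth_on (\<phi> ` (U - K)) h'"
        by (rule smooth_on_cong[OF oUK _ smooth_on_const[OF oUK, of 0]]) (auto simp: h'_def dest: *(9))
      moreover have "x \<in> \<phi> ` (U - K)" using x False * by blast
      ultimately show ?thesis using oUK by blast
    qed
  qed
  then have sm: "(\<lambda>q. if q \<in> U then h' (\<phi> q) else 0) \<in> smooth_funs A"
    by (rule smooth_funs_extend_by_zero[OF U _ *(3)]) (use * in \<open>auto simp: h'_def\<close>)
  show ?thesis
    by (rule that[OF sm *(5,6)]) (use * in \<open>auto simp: h'_def\<close>)
qed

lemma tangentD:
  assumes "v \<in> tangent_space A p"
  shows "f \<in> smooth_funs A \<Longrightarrow> h \<in> smooth_funs A \<Longrightarrow> v (\<lambda>x. a * f x + b * h x) = a * v f + b * v h"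
    and "f \<in> smooth_funs A \<Longrightarrow> h \<in> smooth_funs A \<Longrightarrow> v (\<lambda>x. f x * h x) = f p * v h + v f * h p"
    and "f \<notin> smooth_funs A \<Longrightarrow> v f = 0"
  using assms unfolding tangent_space_def by blast+

lemma tangent_add:
  assumes "v \<in> tangent_space A p" "f \<in> smooth_funs A" "h \<in> smooth_funs A"
  shows "v (\<lambda>x. f x + h x) = v f + v h"
  using tangentD(1)[OF assms, of 1 1] by simp

lemma tangent_const:
  assumes "v \<in> tangent_space A p"
  shows "v (\<lambda>x. c) = 0"
proof -
  have "v (\<lambda>x. c * 1 + 0 * 1) = c * v (\<lambda>x. 1) + 0 * v (\<lambda>x. 1)"
    by (rule tangentD(1)[OF assms smooth_funs_const smooth_funs_const])
  moreover have "v (\<lambda>x. 1 * 1) = 1 * v (\<lambda>x. 1) + v (\<lambda>x. 1) * 1"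
    by (rule tangentD(2)[OF assms smooth_funs_const smooth_funs_const])
  ultimately show ?thesis by simp
qed

lemma tangent_sum:
  assumes "v \<in> tangent_space A p" "\<And>i. i \<in> I \<Longrightarrow> f i \<in> smooth_funs A"
  shows "v (\<lambda>x. \<Sum>i\<in>I. f i x) = (\<Sum>i\<in>I. v (f i))"
  using assms(2)
proof (induction I rule: infinite_finite_induct)
  case (insert i I)
  then show ?case
    by (simp add: tangent_add[OF assms(1)] smooth_funs_sum)
qed (simp_all add: tangent_const[OF assms(1)])

lemma tangent_local:
  assumes v: "v \<in> tangent_space A p" and f: "f \<in> smooth_funs A" and h: "h \<in> smooth_funs A"
    and N: "open N" "p \<in> N" "\<And>q. q \<in> N \<Longrightarrow> f q = h q"
  shows "v f = v h"
proof -
  obtain b M where b: "b \<in> smooth_funs A" "open M" "p \<in> M" "\<And>q. q \<in> M \<Longrightarrow> b q = 1"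
    "\<And>q. q \<notin> N \<Longrightarrow> b q = 0"
    by (rule smooth_bump[OF N(2,1)]) blast
  have "(\<lambda>q. b q * f q) = (\<lambda>q. b q * h q)"
    using N(3) b(5) by force
  moreover have "v (\<lambda>q. b q * f q) = b p * v f + v b * f p"
    by (rule tangentD(2)[OF v b(1) f])
  moreover have "v (\<lambda>q. b q * h q) = b p * v h + v b * h p"
    by (rule tangentD(2)[OF v b(1) h])
  ultimately show ?thesis using b(3,4) N by simp
qed

definition tvec_of :: "'a set \<Rightarrow> ('a \<Rightarrow> real^'n) \<Rightarrow> 'a \<Rightarrow> real^'n \<Rightarrow> 'a tvec" where
  "tvec_of U \<phi> p c = (\<lambda>f. if f \<in> smooth_funs A then frechet_derivative (f \<circ> inv_into U \<phi>) (at (\<phi> p)) c else 0)"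

lemma chart_has_derivative:
  assumes "(U, \<phi>) \<in> A" "p \<in> U" "f \<in> smooth_funs A"
  shows "((f \<circ> inv_into U \<phi>) has_derivative frechet_derivative (f \<circ> inv_into U \<phi>) (at (\<phi> p))) (at (\<phi> p))"
  using assms by (intro smooth_on_has_derivative[OF smooth_funsD]) auto

lemma tvec_of_tangent:
  assumes U: "(U, \<phi>) \<in> A" and p: "p \<in> U"
  shows "tvec_of U \<phi> p c \<in> tangent_space A p"
proof -
  note D = chart_has_derivative[OF U p]
  have 1: "frechet_derivative ((\<lambda>x. a * f x + b * h x) \<circ> inv_into U \<phi>) (at (\<phi> p)) c =
      a * frechet_derivative (f \<circ> inv_into U \<phi>) (at (\<phi> p)) c + b * frechet_derivative (h \<circ> inv_into U \<phi>) (at (\<phi> p)) c"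
    if "f \<in> smooth_funs A" "h \<in> smooth_funs A" for f h a b
    using fun_cong[OF frechet_derivative_at[OF has_derivative_add[OF has_derivative_mult_right[OF D[OF that(1)], of a]
        has_derivative_mult_right[OF D[OF that(2)], of b]]], of c, symmetric]
    by (simp add: comp_def)
  have 2: "frechet_derivative ((\<lambda>x. f x * h x) \<circ> inv_into U \<phi>) (at (\<phi> p)) c =
      f p * frechet_derivative (h \<circ> inv_into U \<phi>) (at (\<phi> p)) c + frechet_derivative (f \<circ> inv_into U
          \<phi>) (at (\<phi> p)) c * h p"
    if "f \<in> smooth_funs A" "h \<in> smooth_funs A" for f h
    using fun_cong[OF frechet_derivative_at[OF has_derivative_mult[OF D[OF that(1)] D[OF that(2)]]], of c, symmetric]
      chart_inv[OF U p]
    by (simp add: comp_def)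
  show ?thesis
    unfolding tangent_space_def tvec_of_def mem_Collect_eq
    using 1 2 by (simp add: smooth_funs_add smooth_funs_mult smooth_funs_const)
qed

lemma tvec_of_lincomb:
  assumes U: "(U, \<phi>) \<in> A" and p: "p \<in> U"
  shows "tvec_of U \<phi> p (a *\<^sub>R c + b *\<^sub>R d) = tv_lincomb a (tvec_of U \<phi> p c) b (tvec_of U \<phi> p d)"
proof -
  have "frechet_derivative (f \<circ> inv_into U \<phi>) (at (\<phi> p)) (a *\<^sub>R c + b *\<^sub>R d) =
      a * frechet_derivative (f \<circ> inv_into U \<phi>) (at (\<phi> p)) c + b * frechet_derivative (f \<circ> inv_into U \<phi>) (at (\<phi> p)) d"
    if f: "f \<in> smooth_funs A" for f
  proof -
    note lin = has_derivative_linear[OF chart_has_derivative[OF U p f]]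
    show ?thesis by (simp add: linear_add[OF lin] linear_scale[OF lin])
  qed
  then show ?thesis by (simp add: tvec_of_def tv_lincomb_def fun_eq_iff)
qed

lemma chart_coordinates:
  assumes U: "(U, \<phi>) \<in> A" and p: "p \<in> U"
  obtains x N where "\<And>i. x i \<in> smooth_funs A" "open N" "p \<in> N" "N \<subseteq> U" 
    "\<And>i q. q \<in> N \<Longrightarrow> x i q = \<phi> q $ i" "\<And>i q c. q \<in> N \<Longrightarrow> tvec_of U \<phi> q c (x i) = c $ i"
proof -
  have "\<exists>f N. f \<in> smooth_funs A \<and> open N \<and> p \<in> N \<and> N \<subseteq> U \<and> (\<forall>q\<in>N. f q = \<phi> q $ i)" for i
  proof -
    have "smooth_on (\<phi> ` U) (\<lambda>x. x $ i)"
      by (rule smooth_on_linear[OF chart_open(2)[OF U] bounded_linear_vec_nth])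
    then obtain f N where "f \<in> smooth_funs A" "open N" "p \<in> N" "N \<subseteq> U" "\<And>q. q \<in> N \<Longrightarrow> f q = \<phi> q $ i"
      by (rule smooth_extension[OF U p chart_open(1)[OF U] subset_refl]) blast
    then show ?thesis by blast
  qed
  then obtain x M where x: "\<And>i. x i \<in> smooth_funs A" "\<And>i. open (M i)" "\<And>i. p \<in> M i" "\<And>i. M i \<subseteq> U"
    "\<And>i q. q \<in> M i \<Longrightarrow> x i q = \<phi> q $ i"
    by metis
  let ?N = "\<Inter>i. M i"
  show ?thesis
  proof (rule that[of x ?N])
    show N: "open ?N" "?N \<subseteq> U" using x(2) x(4)[of undefined] by (auto intro!: open_INT)
    fix i q c assume q: "q \<in> ?N"
    have qU: "q \<in> U" using q N by auto
    have "((\<lambda>x. x $ i) has_derivative (\<lambda>c. c $ i)) (at (\<phi> q))"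
      by (rule bounded_linear_imp_has_derivative[OF bounded_linear_vec_nth])
    then have "((x i \<circ> inv_into U \<phi>) has_derivative (\<lambda>c. c $ i)) (at (\<phi> q))"
    proof (rule has_derivative_transform_within_open)
      show "open (\<phi> ` ?N)" by (rule chart_image_open[OF U N])
      show "y $ i = (x i \<circ> inv_into U \<phi>) y" if "y \<in> \<phi> ` ?N" for y
        using that x(4,5) chart_inv[OF U] by (auto simp: subset_iff)
    qed (use q in simp)
    then show "tvec_of U \<phi> q c (x i) = c $ i"
      using x(1) by (simp add: tvec_of_def frechet_derivative_at[symmetric])
  qed (use x in auto)
qed

lemma tangent_eq_tvec_of:
  assumes U: "(U, \<phi>) \<in> A" and p: "p \<in> U" and v: "v \<in> tangent_space A p"
    and x: "\<And>i. x i \<in> smooth_funs A" "open N" "p \<in> N" "N \<subseteq> U" "\<And>i q. q \<in> N \<Longrightarrow> x i q = \<phi> q $ i"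
    and dx: "\<And>i c. tvec_of U \<phi> p c (x i) = c $ i"
  shows "v = tvec_of U \<phi> p (\<chi> i. v (x i))"
proof
  fix f
  show "v f = tvec_of U \<phi> p (\<chi> i. v (x i)) f"
  proof (cases "f \<in> smooth_funs A")
    case False
    then show ?thesis using tangentD(3)[OF v] by (simp add: tvec_of_def)
  next
    case f: True
    let ?F = "f \<circ> inv_into U \<phi>"
    have "open (\<phi> ` N)" by (rule chart_image_open[OF U x(2,4)])
    then obtain r where r: "r > 0" "ball (\<phi> p) r \<subseteq> \<phi> ` N"
      using x(3) open_contains_ball by blast
    have "smooth_on (ball (\<phi> p) r) ?F"
      by (rule smooth_on_subset[OF smooth_funsD[OF f U]]) (use r x(4) in blast)
    then obtain h where h: "\<And>i. smooth_on (ball (\<phi> p) r) (h i)"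
      "\<And>y. y \<in> ball (\<phi> p) r \<Longrightarrow> ?F y = ?F (\<phi> p) + (\<Sum>i\<in>Basis. ((y - \<phi> p) \<bullet> i) * h i y)"
      by (rule hadamard) blast
    let ?W = "U \<inter> \<phi> -` ball (\<phi> p) r"
    have W: "open ?W" "p \<in> ?W" "?W \<subseteq> U"
      using chart_vimage_open[OF U open_ball] p r by auto
    have "\<exists>k M. k \<in> smooth_funs A \<and> open M \<and> p \<in> M \<and> M \<subseteq> ?W \<and> (\<forall>q\<in>M.
        k q = h (axis i 1) (\<phi> q))" for i
    proof (rule smooth_extension[OF U W(2,1,3)])
      show "smooth_on (\<phi> ` ?W) (h (axis i 1))"
        by (rule smooth_on_subset[OF h(1)]) auto
    qed blast
    then obtain k M where k: "\<And>i. k i \<in> smooth_funs A" "\<And>i. open (M i)" "\<And>i. p \<in> M i" "\<And>i. M i \<subseteq> ?W"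
      "\<And>i q. q \<in> M i \<Longrightarrow> k i q = h (axis i 1) (\<phi> q)"
      by metis
    let ?g = "\<lambda>q. f p + (\<Sum>i\<in>UNIV. (x i q - x i p) * k i q)"
    have xs: "(\<lambda>q. x i q - x i p) \<in> smooth_funs A" for i
      by (intro smooth_funs_diff x smooth_funs_const)
    have ts: "(\<lambda>q. (x i q - x i p) * k i q) \<in> smooth_funs A" for i
      by (intro smooth_funs_mult xs k)
    have gs: "?g \<in> smooth_funs A"
      by (intro smooth_funs_add smooth_funs_const smooth_funs_sum ts)
    have eq: "f q = ?g q" if q: "q \<in> N \<inter> (\<Inter>i. M i)" for q
    proof -
      have qU: "q \<in> U" using q x(4) by auto
      have "\<phi> q \<in> ball (\<phi> p) r" using q k(4)[of undefined] by auto
      from h(2)[OF this] have "f q = f p + (\<Sum>i\<in>Basis. ((\<phi> q - \<phi> p) \<bullet> i) * h i (\<phi> q))"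
        using chart_inv[OF U p] chart_inv[OF U qU] by simp
      also have "(\<Sum>i\<in>Basis. ((\<phi> q - \<phi> p) \<bullet> i) * h i (\<phi> q)) = (\<Sum>i\<in>UNIV. (x i q - x i p) * k i q)"
      proof -
        have inj: "inj (\<lambda>i::'n. axis i (1::real))"
          by (auto simp: inj_on_def axis_eq_axis)
        have B: "(Basis :: (real^'n) set) = range (\<lambda>i. axis i 1)"
          by (auto simp: Basis_vec_def)
        show ?thesis
          unfolding B using q k(5) x(3,5) by (subst sum.reindex[OF inj]) (simp add: inner_axis)
      qed
      finally show ?thesis .
    qed
    have main: "w f = (\<Sum>i\<in>UNIV. w (x i) * k i p)" if w: "w \<in> tangent_space A p" for w
    proof -
      have "w f = w ?g"
      proof (rule tangent_local[OF w f gs])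
        show "open (N \<inter> (\<Inter>i. M i))"
          by (intro open_Int open_INT x(2)) (simp_all add: k(2))
        show "p \<in> N \<inter> (\<Inter>i. M i)" using x(3) k(3) by simp
      qed (rule eq)
      also have "\<dots> = w (\<lambda>q. f p) + w (\<lambda>q. \<Sum>i\<in>UNIV. (x i q - x i p) * k i q)"
        by (intro tangent_add[OF w] smooth_funs_const smooth_funs_sum ts)
      also have "\<dots> = (\<Sum>i\<in>UNIV. w (\<lambda>q. (x i q - x i p) * k i q))"
        by (simp only: tangent_const[OF w] tangent_sum[OF w ts] add_0)
      also have "\<dots> = (\<Sum>i\<in>UNIV. w (x i) * k i p)"
      proof (rule sum.cong[OF refl])
        fix i
        have "w (\<lambda>q. x i q - x i p) = w (x i)"
            using tangentD(1)[OF w x(1) smooth_funs_const, of 1 i "- x i p" 1] tangent_const[OF w, of 1] by simp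
        then show "w (\<lambda>q. (x i q - x i p) * k i q) = w (x i) * k i p"
          using tangentD(2)[OF w xs k(1), of i i] by simp
      qed
      finally show ?thesis .
    qed
    have "tvec_of U \<phi> p (\<chi> i. v (x i)) f = (\<Sum>i\<in>UNIV. tvec_of U \<phi> p (\<chi> i. v (x i)) (x i) * k i p)"
      by (rule main[OF tvec_of_tangent[OF U p]])
    also have "\<dots> = v f"
      by (simp add: main[OF v] dx)
    finally show ?thesis by simp
  qed
qed

lemma tvec_of_surj:
  assumes "(U, \<phi>) \<in> A" "p \<in> U" "v \<in> tangent_space A p"
  obtains c where "v = tvec_of U \<phi> p c"
proof (rule chart_coordinates[OF assms(1,2)])
  fix x N
  assume x: "\<And>i. x i \<in> smooth_funs A" "open N" "p \<in> N" "N \<subseteq> U" 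
    "\<And>i q. q \<in> N \<Longrightarrow> x i q = \<phi> q $ i" "\<And>i q c. q \<in> N \<Longrightarrow> tvec_of U \<phi> q c (x i) = c $ i"
  show thesis
    by (rule that, rule tangent_eq_tvec_of[OF assms x(1-5) x(6)[OF x(3)]])
qed

lemma tvec_of_inj:
  assumes "(U, \<phi>) \<in> A" "p \<in> U" "tvec_of U \<phi> p c = tvec_of U \<phi> p d"
  shows "c = d"
proof (rule chart_coordinates[OF assms(1,2)])
  fix x N
  assume "p \<in> N" and x: "\<And>i q c. q \<in> N \<Longrightarrow> tvec_of U \<phi> q c (x i) = c $ i"
  then show "c = d"
    using x[OF \<open>p \<in> N\<close>, of c] x[OF \<open>p \<in> N\<close>, of d] assms(3) by (simp add: vec_eq_iff)
qed

lemma tvec_of_transition: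
  assumes U: "(U, \<phi>) \<in> A" and V: "(V, \<psi>) \<in> A" and p: "p \<in> U" "p \<in> V"
  shows "tvec_of U \<phi> p c = tvec_of V \<psi> p (frechet_derivative (\<psi> \<circ> inv_into U \<phi>) (at (\<phi> p)) c)"
proof
  fix f
  show "tvec_of U \<phi> p c f = tvec_of V \<psi> p (frechet_derivative (\<psi> \<circ> inv_into U \<phi>) (at (\<phi> p)) c) f"
  proof (cases "f \<in> smooth_funs A")
    case True
    have 1: "((\<psi> \<circ> inv_into U \<phi>) has_derivative frechet_derivative (\<psi> \<circ> inv_into U \<phi>) (at
        (\<phi> p))) (at (\<phi> p))"
      by (rule smooth_on_has_derivative[OF chart_transition[OF U V]]) (use p in auto)
    have 2: "((f \<circ> inv_into V \<psi>) has_derivative frechet_derivative (f \<circ> inv_into V \<psi>) (at (\<psi> p)))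
        (at ((\<psi> \<circ> inv_into U \<phi>) (\<phi> p)))"
      using chart_has_derivative[OF V p(2) True] chart_inv[OF U p(1)] by simp
    have o: "open (\<phi> ` (U \<inter> V))"
      by (rule chart_image_open[OF U]) (use chart_open[OF U] chart_open[OF V] in auto)
    have "((f \<circ> inv_into U \<phi>) has_derivative (\<lambda>c. frechet_derivative (f \<circ> inv_into V \<psi>) (at (\<psi> p))
        (frechet_derivative (\<psi> \<circ> inv_into U \<phi>) (at (\<phi> p)) c))) (at (\<phi> p))"
      by (rule has_derivative_transform_within_open[OF has_derivative_compose[OF 1 2] o])
        (use p chart_inv[OF U] chart_inv[OF V] in auto)
    from fun_cong[OF frechet_derivative_at[OF this], of c] True show ?thesis
      by (simp add: tvec_of_def)
  qed (simp add: tvec_of_def)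
qed

end

lemma frechet_derivative_cong:
  assumes "open S" "x \<in> S" "\<And>y. y \<in> S \<Longrightarrow> f y = g y"
  shows "frechet_derivative f (at x) = frechet_derivative g (at x)"
proof -
  have "(f has_derivative f') (at x) \<longleftrightarrow> (g has_derivative f') (at x)" for f'
    using has_derivative_transform_within_open[OF _ assms(1,2), of f f' UNIV g]
      has_derivative_transform_within_open[OF _ assms(1,2), of g f' UNIV f] assms(3) by auto
  then show ?thesis by (simp add: frechet_derivative_def)
qed

context manifold
begin

subsection \<open>Vector fields and tensoriality\<close>

abbreviation "VF \<equiv> vector_fields A"
abbreviation "SF \<equiv> smooth_funs A"

lemma VF_tangent: "X \<in> VF \<Longrightarrow> X p \<in> tangent_space A p"
  by (simp add: vector_fields_def)

lemma VF_smooth: "X \<in> VF \<Longrightarrow> f \<in> SF \<Longrightarrow> vf_deriv X f \<in> SF"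
  by (simp add: vector_fields_def vf_deriv_def)

lemma VF_I: "(\<And>p. X p \<in> tangent_space A p) \<Longrightarrow> (\<And>f. f \<in> SF \<Longrightarrow> vf_deriv X f \<in>
    SF) \<Longrightarrow> X \<in> VF"
  by (simp add: vector_fields_def vf_deriv_def)

lemma tangent_lincomb:
  assumes "u \<in> tangent_space A p" "v \<in> tangent_space A p"
  shows "tv_lincomb a u b v \<in> tangent_space A p"
proof -
  note u = tangentD[OF assms(1)] and v = tangentD[OF assms(2)]
  show ?thesis
    unfolding tangent_space_def mem_Collect_eq tv_lincomb_def
    using u v by (simp add: algebra_simps)
qed

lemma tangent_zero: "(\<lambda>f. 0) \<in> tangent_space A p"
  by (simp add: tangent_space_def)

lemma VF_deriv_nonsmooth: "X \<in> VF \<Longrightarrow> f \<notin> SF \<Longrightarrow> vf_deriv X f = (\<lambda>p. 0)"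
  using tangentD(3)[OF VF_tangent] by (auto simp: vf_deriv_def)

lemma vf_add_VF: "X \<in> VF \<Longrightarrow> Y \<in> VF \<Longrightarrow> vf_add X Y \<in> VF"
proof (rule VF_I)
  fix p assume "X \<in> VF" "Y \<in> VF"
  then show "vf_add X Y p \<in> tangent_space A p"
    using tangent_lincomb[OF VF_tangent[of X p] VF_tangent[of Y p], where a = 1 and b = 1] by (simp add: tv_lincomb_def vf_add_def)
next
  fix f assume "X \<in> VF" "Y \<in> VF" "f \<in> SF"
  then show "vf_deriv (vf_add X Y) f \<in> SF"
    using smooth_funs_add[OF VF_smooth VF_smooth, of X f Y f] by (simp add: vf_deriv_def vf_add_def)
qed

lemma vf_scale_VF: "h \<in> SF \<Longrightarrow> X \<in> VF \<Longrightarrow> vf_scale h X \<in> VF"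
proof (rule VF_I)
  fix p assume "X \<in> VF"
  then show "vf_scale h X p \<in> tangent_space A p"
    using tangent_lincomb[OF VF_tangent[of X p] VF_tangent[of X p], where a = "h p" and b = 0] by (simp add: tv_lincomb_def vf_scale_def)
next
  fix f assume "h \<in> SF" "X \<in> VF" "f \<in> SF"
  then show "vf_deriv (vf_scale h X) f \<in> SF"
    using smooth_funs_mult[OF _ VF_smooth, of h X f] by (simp add: vf_deriv_def vf_scale_def)
qed

lemma vf_diff_eq: "vf_diff X Y = vf_add X (vf_scale (\<lambda>p. - 1) Y)"
  by (simp add: vf_diff_def vf_add_def vf_scale_def)

lemma vf_diff_VF: "X \<in> VF \<Longrightarrow> Y \<in> VF \<Longrightarrow> vf_diff X Y \<in> VF"
  unfolding vf_diff_eq by (intro vf_add_VF vf_scale_VF smooth_funs_const)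

lemma vf_zero_VF: "(\<lambda>p f. 0) \<in> VF"
  by (rule VF_I) (simp_all add: tangent_zero vf_deriv_def smooth_funs_const)

definition vf_sum :: "('i \<Rightarrow> 'a vfield) \<Rightarrow> 'i set \<Rightarrow> 'a vfield" where
  "vf_sum F I = (\<lambda>p f. \<Sum>i\<in>I. F i p f)"

lemma vf_sum_empty: "vf_sum F {} = (\<lambda>p f. 0)"
  by (simp add: vf_sum_def)

lemma vf_sum_insert: "finite I \<Longrightarrow> i \<notin> I \<Longrightarrow> vf_sum F (insert i I) = vf_add (F i) (vf_sum F I)"
  by (simp add: vf_sum_def vf_add_def)

lemma vf_sum_VF: "finite I \<Longrightarrow> (\<And>i. i \<in> I \<Longrightarrow> F i \<in> VF) \<Longrightarrow> vf_sum F I \<in> VF"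
  by (induction I rule: finite_induct) (simp_all add: vf_sum_empty vf_zero_VF vf_sum_insert vf_add_VF)

lemma VF_deriv_mult:
  assumes "X \<in> VF" "f \<in> SF" "h \<in> SF"
  shows "vf_deriv X (\<lambda>q. f q * h q) = (\<lambda>p. f p * vf_deriv X h p + vf_deriv X f p * h p)"
  using tangentD(2)[OF VF_tangent[OF assms(1)] assms(2,3)] by (simp add: vf_deriv_def)

lemma VF_deriv_lincomb:
  assumes "X \<in> VF" "f \<in> SF" "h \<in> SF"
  shows "vf_deriv X (\<lambda>q. a * f q + b * h q) = (\<lambda>p. a * vf_deriv X f p + b * vf_deriv X h p)"
  using tangentD(1)[OF VF_tangent[OF assms(1)] assms(2,3)] by (simp add: vf_deriv_def)

lemma VF_deriv_minus:
  assumes "X \<in> VF" "f \<in> SF"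
  shows "vf_deriv X (\<lambda>q. - f q) p = - vf_deriv X f p"
  using VF_deriv_lincomb[OF assms smooth_funs_const, of "-1" 0 0] by (simp add: fun_eq_iff)

lemma VF_deriv_add:
  assumes "X \<in> VF" "f \<in> SF" "h \<in> SF"
  shows "vf_deriv X (\<lambda>q. f q + h q) p = vf_deriv X f p + vf_deriv X h p"
  using VF_deriv_lincomb[OF assms, of 1 1] by (simp add: fun_eq_iff)

lemma lie_bracket_eq: "lie_bracket X Y p f = vf_deriv X (vf_deriv Y f) p - vf_deriv Y (vf_deriv X f) p"
  by (simp add: lie_bracket_def vf_deriv_def)

lemma VF_deriv_zero: "X \<in> VF \<Longrightarrow> vf_deriv X (\<lambda>q. 0) p = 0"
  using tangent_const[OF VF_tangent] by (simp add: vf_deriv_def)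

lemma lie_bracket_VF:
  assumes X: "X \<in> VF" and Y: "Y \<in> VF"
  shows "lie_bracket X Y \<in> VF"
proof (rule VF_I)
  fix p
  show "lie_bracket X Y p \<in> tangent_space A p"
    unfolding tangent_space_def mem_Collect_eq
  proof (intro conjI ballI allI impI)
    fix f h a b assume fh: "f \<in> SF" "h \<in> SF"
    show "lie_bracket X Y p (\<lambda>x. a * f x + b * h x) = a * lie_bracket X Y p f + b * lie_bracket X Y p h"
      using fh by (simp add: lie_bracket_eq VF_deriv_lincomb[OF X] VF_deriv_lincomb[OF Y]
          VF_smooth[OF X] VF_smooth[OF Y] algebra_simps)
    note sm = smooth_funs_mult[OF fh(1) VF_smooth[OF X fh(2)]] smooth_funs_mult[OF VF_smooth[OF X fh(1)] fh(2)]
      smooth_funs_mult[OF fh(1) VF_smooth[OF Y fh(2)]] smooth_funs_mult[OF VF_smooth[OF Y fh(1)] fh(2)]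
    show "lie_bracket X Y p (\<lambda>x. f x * h x) = f p * lie_bracket X Y p h + lie_bracket X Y p f * h p"
      unfolding lie_bracket_eq VF_deriv_mult[OF X fh] VF_deriv_mult[OF Y fh]
        VF_deriv_add[OF X sm(3,4)] VF_deriv_add[OF Y sm(1,2)]
        VF_deriv_mult[OF X fh(1) VF_smooth[OF Y fh(2)]] VF_deriv_mult[OF X VF_smooth[OF Y fh(1)] fh(2)]
        VF_deriv_mult[OF Y fh(1) VF_smooth[OF X fh(2)]] VF_deriv_mult[OF Y VF_smooth[OF X fh(1)] fh(2)]
      by (simp add: algebra_simps)
  next
    fix f assume "f \<notin> SF"
    then show "lie_bracket X Y p f = 0"
      by (simp add: lie_bracket_eq VF_deriv_nonsmooth[OF X] VF_deriv_nonsmooth[OF Y] VF_deriv_zero[OF X] VF_deriv_zero[OF Y])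
  qed
next
  fix f assume f: "f \<in> SF"
  show "vf_deriv (lie_bracket X Y) f \<in> SF"
    using smooth_funs_diff[OF VF_smooth[OF X VF_smooth[OF Y f]] VF_smooth[OF Y VF_smooth[OF X f]]]
    by (simp add: lie_bracket_def vf_deriv_def)
qed

lemma lie_bracket_swap: "lie_bracket Y X = vf_scale (\<lambda>p. - 1) (lie_bracket X Y)"
  by (simp add: lie_bracket_def vf_scale_def)

lemma VF_deriv_smooth_all: "X \<in> VF \<Longrightarrow> vf_deriv X f \<in> SF"
  using VF_smooth VF_deriv_nonsmooth smooth_funs_const by (cases "f \<in> SF") auto

lemma lie_bracket_add_left:
  assumes X: "X \<in> VF" and X': "X' \<in> VF" and Y: "Y \<in> VF"
  shows "lie_bracket (vf_add X X') Y = vf_add (lie_bracket X Y) (lie_bracket X' Y)"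
proof (intro ext)
  fix p f
  have "vf_deriv (vf_add X X') f = (\<lambda>q. vf_deriv X f q + vf_deriv X' f q)"
    by (simp add: vf_deriv_def vf_add_def)
  then show "lie_bracket (vf_add X X') Y p f = vf_add (lie_bracket X Y) (lie_bracket X' Y) p f"
    using VF_deriv_add[OF Y VF_deriv_smooth_all[OF X] VF_deriv_smooth_all[OF X'], of f f p]
    by (simp add: lie_bracket_eq vf_add_def) (simp add: vf_deriv_def vf_add_def)
qed

lemma lie_bracket_scale_left:
  assumes X: "X \<in> VF" and h: "h \<in> SF" and Y: "Y \<in> VF"
  shows "lie_bracket (vf_scale h X) Y = vf_add (vf_scale h (lie_bracket X Y)) (vf_scale (\<lambda>p. - vf_deriv Y h p) X)"
proof (intro ext)
  fix p f
  have "vf_deriv (vf_scale h X) f = (\<lambda>q. h q * vf_deriv X f q)"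
    by (simp add: vf_deriv_def vf_scale_def)
  then show "lie_bracket (vf_scale h X) Y p f = vf_add (vf_scale h (lie_bracket X Y)) (vf_scale (\<lambda>p. - vf_deriv Y h p) X) p f"
    using VF_deriv_mult[OF Y h VF_deriv_smooth_all[OF X], of f]
    by (simp add: lie_bracket_eq vf_add_def vf_scale_def) (simp add: vf_deriv_def vf_add_def vf_scale_def algebra_simps)
qed

definition chart_frame :: "'a set \<Rightarrow> ('a \<Rightarrow> real^'n) \<Rightarrow> 'a set \<Rightarrow> ('n \<Rightarrow>
    'a \<Rightarrow> real) \<Rightarrow> ('n \<Rightarrow> 'a vfield) \<Rightarrow> bool" where
  "chart_frame U \<phi> N x E \<longleftrightarrow> open N \<and> N \<subseteq> U \<and> (\<forall>i. x i \<in> SF \<and> E i \<in> VF) \<and>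
    (\<forall>q\<in>N. \<forall>i. x i q = \<phi> q $ i \<and> E i q = tvec_of U \<phi> q (axis i 1)) \<and>
    (\<forall>q\<in>N. \<forall>i c. tvec_of U \<phi> q c (x i) = c $ i) \<and>
    (\<forall>q\<in>N. \<forall>v\<in>tangent_space A q. v = tvec_of U \<phi> q (\<chi> i. v (x i)))"

lemma chart_frame_exists:
  assumes U: "(U, \<phi>) \<in> A" and p: "p \<in> U"
  obtains N x E where "chart_frame U \<phi> N x E" "p \<in> N"
proof -
  obtain x M where x: "\<And>i. x i \<in> SF" "open M" "p \<in> M" "M \<subseteq> U" 
    "\<And>i q. q \<in> M \<Longrightarrow> x i q = \<phi> q $ i" "\<And>i q c. q \<in> M \<Longrightarrow> tvec_of U \<phi> q c (x i) = c $ i"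
    by (rule chart_coordinates[OF U p]) blast
  obtain \<beta> :: "real^'n \<Rightarrow> real" and K N where b: "smooth_on UNIV \<beta>" "\<And>x. 0 \<le> \<beta> x"
      "compact K" "K \<subseteq> U \<inter> M" "open N" "p \<in> N" "N \<subseteq> K"
    "\<And>q. q \<in> N \<Longrightarrow> \<beta> (\<phi> q) = 1" "\<And>q. q \<in> U \<Longrightarrow> q \<notin> K
        \<Longrightarrow> \<beta> (\<phi> q) = 0"
    by (rule chart_bump[OF U p x(3,2)]) blast
  have NM: "N \<subseteq> M" using b(4,7) by blast
  define E where "E i = (\<lambda>q f. if q \<in> U then \<beta> (\<phi> q) * tvec_of U \<phi> q (axis i 1) f else 0)" for i
  have "E i \<in> VF" for i
  proof (rule VF_I)
    fix q
    show "E i q \<in> tangent_space A q"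
    proof (cases "q \<in> U")
      case True
      have "E i q = tv_lincomb (\<beta> (\<phi> q)) (tvec_of U \<phi> q (axis i 1)) 0 (tvec_of U \<phi> q (axis i 1))"
        using True by (simp add: E_def tv_lincomb_def)
      then show ?thesis
        by (simp only: tangent_lincomb[OF tvec_of_tangent[OF U True] tvec_of_tangent[OF U True]])
    qed (simp add: E_def tangent_zero)
  next
    fix f assume f: "f \<in> SF"
    have "smooth_on (\<phi> ` U) (\<lambda>x. \<beta> x * frechet_derivative (f \<circ> inv_into U \<phi>) (at x) (axis i 1))" (is "smooth_on _ ?h")
      by (intro smooth_on_mult chart_open(2)[OF U] smooth_on_subset[OF b(1)] smooth_on_frechet_derivative
          smooth_funsD[OF f U]) simp
    from smooth_funs_extend_by_zero[OF U this b(3)]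
    have "(\<lambda>q. if q \<in> U then ?h (\<phi> q) else 0) \<in> SF"
      using b(4,9) by simp
    moreover have "vf_deriv (E i) f = (\<lambda>q. if q \<in> U then ?h (\<phi> q) else 0)"
      using f by (auto simp: vf_deriv_def E_def tvec_of_def)
    ultimately show "vf_deriv (E i) f \<in> SF" by simp
  qed
  moreover have "E i q = tvec_of U \<phi> q (axis i 1)" if "q \<in> N" for i q
    using that b(8) NM x(4) by (auto simp: E_def)
  moreover have "v = tvec_of U \<phi> q (\<chi> i. v (x i))" if "q \<in> N" "v \<in> tangent_space A q" for q v
    by (rule tangent_eq_tvec_of[OF U _ that(2) x(1,2) _ x(4,5) x(6)]) (use that NM x(4) in auto)
  ultimately have "chart_frame U \<phi> N x E"
    unfolding chart_frame_def using x NM b(5) by blast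
  then show ?thesis using b(6) by (rule that)
qed

definition pt_linear :: "'a \<Rightarrow> ('a vfield \<Rightarrow> real) \<Rightarrow> bool" where
  "pt_linear p \<Theta> \<longleftrightarrow> (\<forall>X\<in>VF. \<forall>Y\<in>VF. \<Theta> (vf_add X Y) = \<Theta> X + \<Theta> Y) \<and>
    (\<forall>f\<in>SF. \<forall>X\<in>VF. \<Theta> (vf_scale f X) = f p * \<Theta> X)"

lemma pt_linearD:
  assumes "pt_linear p \<Theta>"
  shows "X \<in> VF \<Longrightarrow> Y \<in> VF \<Longrightarrow> \<Theta> (vf_add X Y) = \<Theta> X + \<Theta> Y"
    and "f \<in> SF \<Longrightarrow> X \<in> VF \<Longrightarrow> \<Theta> (vf_scale f X) = f p * \<Theta> X"
  using assms by (auto simp: pt_linear_def)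

lemma pt_linear_minus:
  assumes "pt_linear p \<Theta>" "\<And>X. X \<in> VF \<Longrightarrow> \<Theta>' X = - \<Theta> X"
  shows "pt_linear p \<Theta>'"
  using assms unfolding pt_linear_def by (simp add: vf_add_VF vf_scale_VF)

lemma pt_linear_sum:
  assumes "pt_linear p \<Theta>" "finite I" "\<And>i. i \<in> I \<Longrightarrow> F i \<in> VF"
  shows "\<Theta> (vf_sum F I) = (\<Sum>i\<in>I. \<Theta> (F i))"
  using assms(2,3)
proof (induction I rule: finite_induct)
  case empty
  show ?case
    using pt_linearD(2)[OF assms(1) smooth_funs_const[of 0] vf_zero_VF] by (simp add: vf_sum_empty vf_scale_def)
next
  case (insert i I)
  then show ?case
    by (simp add: vf_sum_insert pt_linearD(1)[OF assms(1)] vf_sum_VF)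
qed

lemma tvec_of_sum:
  assumes U: "(U, \<phi>) \<in> A" and p: "p \<in> U" and "finite I"
  shows "tvec_of U \<phi> p (\<Sum>i\<in>I. a i *\<^sub>R c i) f = (\<Sum>i\<in>I. a i * tvec_of U \<phi> p (c i) f)"
proof (cases "f \<in> SF")
  case f: True
  note lin = has_derivative_linear[OF chart_has_derivative[OF U p f]]
  show ?thesis using f by (simp add: tvec_of_def linear_sum[OF lin] linear_scale[OF lin])
qed (simp add: tvec_of_def)

lemma tvec_of_axis_expansion:
  assumes U: "(U, \<phi>) \<in> A" and p: "p \<in> U"
  shows "tvec_of U \<phi> p c f = (\<Sum>i\<in>UNIV. c $ i * tvec_of U \<phi> p (axis i 1) f)"
proof -
  have "c = (\<Sum>i\<in>UNIV. c $ i *\<^sub>R axis i 1)"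
    by (simp add: basis_expansion flip: scalar_mult_eq_scaleR)
  then show ?thesis using tvec_of_sum[OF U p, of UNIV "\<lambda>i. c $ i" "\<lambda>i. axis i 1" f] by simp
qed

lemma pt_linear_expand:
  assumes U: "(U, \<phi>) \<in> A" and fr: "chart_frame U \<phi> N x E" "p \<in> N"
    and lin: "pt_linear p \<Theta>" and X: "X \<in> VF"
  shows "\<Theta> X = (\<Sum>i\<in>UNIV. X p (x i) * \<Theta> (E i))"
proof -
  note fr' = fr(1)[unfolded chart_frame_def]
  have N: "open N" using fr' by blast
  obtain b M where b: "b \<in> SF" "p \<in> M" "\<And>q. q \<in> M \<Longrightarrow> b q = 1" "\<And>q. q \<notin> N \<Longrightarrow> b q = 0"
    by (rule smooth_bump[OF fr(2) N]) blast
  let ?F = "\<lambda>i. vf_scale (\<lambda>q. b q * vf_deriv X (x i) q) (E i)"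
  have sm: "(\<lambda>q. b q * vf_deriv X (x i) q) \<in> SF" and E: "E i \<in> VF" for i
    using fr' by (blast intro: smooth_funs_mult b(1) VF_smooth[OF X])+
  have F: "?F i \<in> VF" for i by (rule vf_scale_VF[OF sm E])
  have "vf_scale b X = vf_sum ?F UNIV"
  proof (intro ext)
    fix q f
    show "vf_scale b X q f = vf_sum ?F UNIV q f"
    proof (cases "q \<in> N")
      case True
      have qU: "q \<in> U" using True fr' by blast
      have "X q f = tvec_of U \<phi> q (\<chi> i. X q (x i)) f"
        using True fr' VF_tangent[OF X, of q] by metis
      also have "\<dots> = (\<Sum>i\<in>UNIV. X q (x i) * E i q f)"
        using True fr' by (subst tvec_of_axis_expansion[OF U qU]) simp
      finally have "b q * X q f = b q * (\<Sum>i\<in>UNIV. X q (x i) * E i q f)" by simp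
      then show ?thesis
        by (simp add: vf_scale_def vf_sum_def vf_deriv_def sum_distrib_left mult.assoc)
    qed (simp add: vf_scale_def vf_sum_def b(4))
  qed
  then have "\<Theta> (vf_scale b X) = (\<Sum>i\<in>UNIV. \<Theta> (?F i))"
    using pt_linear_sum[OF lin finite F] by simp
  also have "\<dots> = (\<Sum>i\<in>UNIV. X p (x i) * \<Theta> (E i))"
    unfolding pt_linearD(2)[OF lin sm E] using b(2,3) by (simp add: vf_deriv_def)
  finally show ?thesis
    using pt_linearD(2)[OF lin b(1) X] b(2,3) by simp
qed

lemma pt_linear_cong:
  assumes lin: "pt_linear p \<Theta>" and XY: "X \<in> VF" "Y \<in> VF" "X p = Y p"
  shows "\<Theta> X = \<Theta> Y"
proof -
  obtain U \<phi> where U: "(U, \<phi>) \<in> A" "p \<in> U" by (rule chart_exists)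
  obtain N x E where fr: "chart_frame U \<phi> N x E" "p \<in> N" by (rule chart_frame_exists[OF U])
  show ?thesis
    unfolding pt_linear_expand[OF U(1) fr lin XY(1)] pt_linear_expand[OF U(1) fr lin XY(2)] XY(3) ..
qed

lemma VF_extension_exists:
  assumes u: "u \<in> tangent_space A p"
  shows "\<exists>X. X \<in> VF \<and> X p = u"
proof -
  obtain U \<phi> where U: "(U, \<phi>) \<in> A" "p \<in> U" by (rule chart_exists)
  obtain N x E where fr: "chart_frame U \<phi> N x E" "p \<in> N" by (rule chart_frame_exists[OF U])
  note fr' = fr(1)[unfolded chart_frame_def]
  let ?X = "vf_sum (\<lambda>i. vf_scale (\<lambda>q. u (x i)) (E i)) UNIV"
  have "?X \<in> VF"
    using fr' by (intro vf_sum_VF vf_scale_VF smooth_funs_const) auto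
  moreover have "?X p = u"
  proof
    fix f
    have "u f = tvec_of U \<phi> p (\<chi> i. u (x i)) f"
      using fr(2) fr' u by metis
    also have "\<dots> = (\<Sum>i\<in>UNIV. u (x i) * E i p f)"
      using fr(2) fr' by (subst tvec_of_axis_expansion[OF U]) simp
    finally show "?X p f = u f" by (simp add: vf_sum_def vf_scale_def)
  qed
  ultimately show ?thesis by blast
qed

definition vext :: "'a \<Rightarrow> 'a tvec \<Rightarrow> 'a vfield" where
  "vext p u = (SOME X. X \<in> VF \<and> X p = u)"

lemma vext: "u \<in> tangent_space A p \<Longrightarrow> vext p u \<in> VF" "u \<in> tangent_space A p \<Longrightarrow> vext p u p = u"
  using someI_ex[OF VF_extension_exists, of u p] unfolding vext_def by blast+

lemma pt_linear_vext: "pt_linear p \<Theta> \<Longrightarrow> X \<in> VF \<Longrightarrow> \<Theta> (vext p (X p)) = \<Theta> X"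
  using pt_linear_cong vext VF_tangent by metis

lemma pt_linear_vext_lincomb:
  assumes "pt_linear p \<Theta>" "u \<in> tangent_space A p" "v \<in> tangent_space A p"
  shows "\<Theta> (vext p (tv_lincomb a u b v)) = a * \<Theta> (vext p u) + b * \<Theta> (vext p v)"
proof -
  note uv = vext[OF assms(2)] vext[OF assms(3)]
  let ?Y = "vf_add (vf_scale (\<lambda>q. a) (vext p u)) (vf_scale (\<lambda>q. b) (vext p v))"
  have Y: "vf_scale (\<lambda>q. a) (vext p u) \<in> VF" "vf_scale (\<lambda>q. b) (vext p v) \<in> VF"
    by (intro vf_scale_VF smooth_funs_const uv)+
  have "?Y p = tv_lincomb a u b v"
    using uv by (simp add: vf_add_def vf_scale_def tv_lincomb_def)
  then have "\<Theta> (vext p (tv_lincomb a u b v)) = \<Theta> ?Y"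
    using pt_linear_vext[OF assms(1) vf_add_VF[OF Y]] by simp
  also have "\<dots> = a * \<Theta> (vext p u) + b * \<Theta> (vext p v)"
    by (simp add: pt_linearD[OF assms(1)] Y uv smooth_funs_const)
  finally show ?thesis .
qed

lemma pt_linear_tvec_of:
  assumes "pt_linear p \<Theta>" "(U, \<phi>) \<in> A" "p \<in> U"
  shows "linear (\<lambda>c. \<Theta> (vext p (tvec_of U \<phi> p c)))"
proof (rule linearI)
  note l = pt_linear_vext_lincomb[OF assms(1) tvec_of_tangent[OF assms(2,3)] tvec_of_tangent[OF assms(2,3)]]
    and c = tvec_of_lincomb[OF assms(2,3)]
  show "\<Theta> (vext p (tvec_of U \<phi> p (c + d))) = \<Theta> (vext p (tvec_of U \<phi> p c)) + \<Theta> (vext p (tvec_of U \<phi> p d))" for c d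
    using l[of 1 c 1 d] c[of 1 c 1 d] by simp
  show "\<Theta> (vext p (tvec_of U \<phi> p (r *\<^sub>R c))) = r *\<^sub>R \<Theta> (vext p (tvec_of U \<phi> p c))" for r c
    using l[of r c 0 c] c[of r c 0 c] by simp
qed

end

locale three_form = manifold A
  for A :: "('a::{t2_space, second_countable_topology}, 'n::finite) atlas" +
  fixes T :: "'a form3"
  assumes T_smooth: "X \<in> VF \<Longrightarrow> Y \<in> VF \<Longrightarrow> Z \<in> VF \<Longrightarrow> T X Y Z \<in> SF"
    and T_linear: "Y \<in> VF \<Longrightarrow> Z \<in> VF \<Longrightarrow> pt_linear p (\<lambda>X. T X Y Z p)"
    and T_swap12: "X \<in> VF \<Longrightarrow> Y \<in> VF \<Longrightarrow> Z \<in> VF \<Longrightarrow> T Y X Z p = - T X Y Z p"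
    and T_swap23: "X \<in> VF \<Longrightarrow> Y \<in> VF \<Longrightarrow> Z \<in> VF \<Longrightarrow> T X Z Y p = - T X Y Z p"
begin

lemma T_linear2: "X \<in> VF \<Longrightarrow> Z \<in> VF \<Longrightarrow> pt_linear p (\<lambda>Y. T X Y Z p)"
  by (rule pt_linear_minus[OF T_linear[of X Z p]]) (rule T_swap12 | assumption)+

lemma T_linear3: "X \<in> VF \<Longrightarrow> Y \<in> VF \<Longrightarrow> pt_linear p (\<lambda>Z. T X Y Z p)"
  by (rule pt_linear_minus[OF T_linear2[of X Y p]]) (rule T_swap23 | assumption)+

abbreviation "\<beta> \<equiv> ext_deriv3 T"

lemma T_bracket_swap:
  assumes "X \<in> VF" "Y \<in> VF" "Z \<in> VF" "W \<in> VF"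
  shows "T (lie_bracket Y X) Z W p = - T (lie_bracket X Y) Z W p"
  using pt_linearD(2)[OF T_linear[OF assms(3,4), of p] smooth_funs_const[of "- 1"] lie_bracket_VF[OF assms(1,2)]]
  by (simp add: lie_bracket_swap[of Y X])

lemma T_deriv_swap:
  assumes "V \<in> VF" "X \<in> VF" "Y \<in> VF" "Z \<in> VF"
  shows "vf_deriv V (T Y X Z) p = - vf_deriv V (T X Y Z) p" "vf_deriv V (T X Z Y) p = - vf_deriv V (T X Y Z) p"
proof -
  have "T Y X Z = (\<lambda>q. - T X Y Z q)" "T X Z Y = (\<lambda>q. - T X Y Z q)"
    using T_swap12[OF assms(2-4)] T_swap23[OF assms(2-4)] by (auto simp: fun_eq_iff)
  then show "vf_deriv V (T Y X Z) p = - vf_deriv V (T X Y Z) p" "vf_deriv V (T X Z Y) p = - vf_deriv V (T X Y Z) p"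
    using VF_deriv_minus[OF assms(1) T_smooth[OF assms(2-4)]] by simp_all
qed

lemma ext_deriv3_swap:
  assumes "W \<in> VF" "X \<in> VF" "Y \<in> VF" "Z \<in> VF"
  shows "\<beta> X W Y Z p = - \<beta> W X Y Z p" "\<beta> W Y X Z p = - \<beta> W X Y Z p" "\<beta> W X Z Y p = - \<beta> W X Y Z p"
proof -
  note [simp] = assms lie_bracket_VF
  show "\<beta> X W Y Z p = - \<beta> W X Y Z p"
    unfolding ext_deriv3_def
    using T_deriv_swap(1)[of Y W X Z p] T_deriv_swap(1)[of Z W X Y p] T_bracket_swap[of W X Y Z p]
      T_swap12[of "lie_bracket Y Z" W X p] T_swap23[of "lie_bracket Y Z" W X p]
    by simp
  show "\<beta> W Y X Z p = - \<beta> W X Y Z p"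
    unfolding ext_deriv3_def
    using T_deriv_swap(1)[of W X Y Z p] T_deriv_swap(2)[of Z W X Y p] T_bracket_swap[of X Y W Z p]
      T_swap23[of "lie_bracket W Z" X Y p]
    by simp
  show "\<beta> W X Z Y p = - \<beta> W X Y Z p"
    unfolding ext_deriv3_def
    using T_deriv_swap(2)[of W X Y Z p] T_deriv_swap(2)[of X W Y Z p] T_bracket_swap[of Y Z W X p]
      T_swap23[of "lie_bracket W X" Y Z p]
    by simp
qed

lemma ext_deriv3_linear:
  assumes X: "X \<in> VF" and Y: "Y \<in> VF" and Z: "Z \<in> VF"
  shows "pt_linear p (\<lambda>W. \<beta> W X Y Z p)"
  unfolding pt_linear_def
proof (intro conjI ballI)
  note [simp] = X Y Z lie_bracket_VF vf_add_VF vf_scale_VF T_smooth VF_smooth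
  fix W W' assume [simp]: "W \<in> VF" "W' \<in> VF"
  have T: "T (vf_add W W') Y' Z' = (\<lambda>q. T W Y' Z' q + T W' Y' Z' q)" if "Y' \<in> VF" "Z' \<in> VF" for Y' Z'
    using pt_linearD(1)[OF T_linear[OF that]] by auto
  have D: "vf_deriv V (T (vf_add W W') Y' Z') p = vf_deriv V (T W Y' Z') p + vf_deriv V (T W' Y' Z') p"
    if "V \<in> VF" "Y' \<in> VF" "Z' \<in> VF" for V Y' Z'
    unfolding T[OF that(2,3)] by (rule VF_deriv_add) (use that in simp_all)
  have L: "T (lie_bracket (vf_add W W') V) Y' Z' p = T (lie_bracket W V) Y' Z' p + T (lie_bracket W' V) Y' Z' p"
    if "V \<in> VF" "Y' \<in> VF" "Z' \<in> VF" for V Y' Z'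
    using that by (simp add: lie_bracket_add_left pt_linearD(1)[OF T_linear])
  have M: "T V (vf_add W W') Z' p = T V W Z' p + T V W' Z' p"
    if "V \<in> VF" "Z' \<in> VF" for V Z'
    using that by (simp add: pt_linearD(1)[OF T_linear2])
  have W: "vf_deriv (vf_add W W') f p = vf_deriv W f p + vf_deriv W' f p" for f
    by (simp add: vf_deriv_def vf_add_def)
  show "\<beta> (vf_add W W') X Y Z p = \<beta> W X Y Z p + \<beta> W' X Y Z p"
    unfolding ext_deriv3_def by (simp add: D L M W)
next
  note [simp] = X Y Z lie_bracket_VF vf_add_VF vf_scale_VF T_smooth VF_smooth
  fix f W assume [simp]: "f \<in> SF" "W \<in> VF"
  have T: "T (vf_scale f W) Y' Z' = (\<lambda>q. f q * T W Y' Z' q)" if "Y' \<in> VF" "Z' \<in> VF" for Y' Z'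
    using pt_linearD(2)[OF T_linear[OF that]] by auto
  have D: "vf_deriv V (T (vf_scale f W) Y' Z') p = f p * vf_deriv V (T W Y' Z') p + vf_deriv V f p * T W Y' Z' p"
    if "V \<in> VF" "Y' \<in> VF" "Z' \<in> VF" for V Y' Z'
    unfolding T[OF that(2,3)] using that by (subst VF_deriv_mult) simp_all
  have neg: "(\<lambda>q. - vf_deriv V f q) \<in> SF" if "V \<in> VF" for V
    using smooth_funs_diff[OF smooth_funs_const VF_smooth, of V f 0] that by simp
  have L: "T (lie_bracket (vf_scale f W) V) Y' Z' p = f p * T (lie_bracket W V) Y' Z' p - vf_deriv V f p * T W Y' Z' p"
    if "V \<in> VF" "Y' \<in> VF" "Z' \<in> VF" for V Y' Z'
    using that neg by (simp add: lie_bracket_scale_left pt_linearD[OF T_linear])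
  have M: "T V (vf_scale f W) Z' p = f p * T V W Z' p"
    if "V \<in> VF" "Z' \<in> VF" for V Z'
    using that by (simp add: pt_linearD(2)[OF T_linear2])
  have W: "vf_deriv (vf_scale f W) h p = f p * vf_deriv W h p" for h
    by (simp add: vf_deriv_def vf_scale_def)
  show "\<beta> (vf_scale f W) X Y Z p = f p * \<beta> W X Y Z p"
    unfolding ext_deriv3_def by (simp add: D L M W algebra_simps)
qed

lemma ext_deriv3_linear2: "W \<in> VF \<Longrightarrow> Y \<in> VF \<Longrightarrow> Z \<in> VF \<Longrightarrow> pt_linear p
    (\<lambda>X. \<beta> W X Y Z p)"
  by (rule pt_linear_minus[OF ext_deriv3_linear[of W Y Z p]]) (rule ext_deriv3_swap(1) | assumption)+

lemma ext_deriv3_linear3: "W \<in> VF \<Longrightarrow> X \<in> VF \<Longrightarrow> Z \<in> VF \<Longrightarrow> pt_linear p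
    (\<lambda>Y. \<beta> W X Y Z p)"
  by (rule pt_linear_minus[OF ext_deriv3_linear2[of W X Z p]]) (rule ext_deriv3_swap(2) | assumption)+

lemma ext_deriv3_linear4: "W \<in> VF \<Longrightarrow> X \<in> VF \<Longrightarrow> Y \<in> VF \<Longrightarrow> pt_linear p
    (\<lambda>Z. \<beta> W X Y Z p)"
  by (rule pt_linear_minus[OF ext_deriv3_linear3[of W X Y p]]) (rule ext_deriv3_swap(3) | assumption)+

definition T_at :: "'a \<Rightarrow> 'a tvec \<Rightarrow> 'a tvec \<Rightarrow> 'a tvec \<Rightarrow> real" where
  "T_at p u v w = T (vext p u) (vext p v) (vext p w) p"

definition dT_at :: "'a \<Rightarrow> 'a tvec \<Rightarrow> 'a tvec \<Rightarrow> 'a tvec \<Rightarrow> 'a tvec \<Rightarrow> real" where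
  "dT_at p u v w z = \<beta> (vext p u) (vext p v) (vext p w) (vext p z) p"

lemma T_at_eq:
  assumes "X \<in> VF" "Y \<in> VF" "Z \<in> VF"
  shows "T_at p (X p) (Y p) (Z p) = T X Y Z p"
  unfolding T_at_def
  using assms pt_linear_vext[OF T_linear3[of X Y p] assms(3)]
    pt_linear_vext[OF T_linear2[of X "vext p (Z p)" p] assms(2)]
    pt_linear_vext[OF T_linear[of "vext p (Y p)" "vext p (Z p)" p] assms(1)]
  by (simp add: vext VF_tangent)

lemma dT_at_eq:
  assumes "W \<in> VF" "X \<in> VF" "Y \<in> VF" "Z \<in> VF"
  shows "dT_at p (W p) (X p) (Y p) (Z p) = \<beta> W X Y Z p"
  unfolding dT_at_def
  using assms pt_linear_vext[OF ext_deriv3_linear4[of W X Y p] assms(4)]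
    pt_linear_vext[OF ext_deriv3_linear3[of W X "vext p (Z p)" p] assms(3)]
    pt_linear_vext[OF ext_deriv3_linear2[of W "vext p (Y p)" "vext p (Z p)" p] assms(2)]
    pt_linear_vext[OF ext_deriv3_linear[of "vext p (X p)" "vext p (Y p)" "vext p (Z p)" p] assms(1)]
  by (simp add: vext VF_tangent)

definition T_chart :: "'a set \<Rightarrow> ('a \<Rightarrow> real^'n) \<Rightarrow> real^'n \<Rightarrow> real^'n
    \<Rightarrow> real^'n \<Rightarrow> real^'n \<Rightarrow> real" where
  "T_chart U \<phi> x a b c = (let p = inv_into U \<phi> x in
    T_at p (tvec_of U \<phi> p a) (tvec_of U \<phi> p b) (tvec_of U \<phi> p c))"

definition dT_chart :: "'a set \<Rightarrow> ('a \<Rightarrow> real^'n) \<Rightarrow> real^'n \<Rightarrow> real^'n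
    \<Rightarrow> real^'n \<Rightarrow> real^'n \<Rightarrow> real^'n \<Rightarrow> real" where
  "dT_chart U \<phi> x a b c d = (let p = inv_into U \<phi> x in
    dT_at p (tvec_of U \<phi> p a) (tvec_of U \<phi> p b) (tvec_of U \<phi> p c) (tvec_of U \<phi> p d))"

lemma T_chart_props:
  assumes U: "(U, \<phi>) \<in> A" and x: "x \<in> \<phi> ` U"
  shows "linear (\<lambda>a. T_chart U \<phi> x a b c)" "linear (\<lambda>b. T_chart U \<phi> x a b c)" "linear (\<lambda>c.
      T_chart U \<phi> x a b c)"
    "T_chart U \<phi> x b a c = - T_chart U \<phi> x a b c" "T_chart U \<phi> x a c b = - T_chart U \<phi> x a b c"
proof -
  define p where "p = inv_into U \<phi> x"
  have p: "p \<in> U" using x by (simp add: p_def inv_into_into)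
  note V = vext(1)[OF tvec_of_tangent[OF U p]]
  note eq = T_chart_def T_at_def Let_def p_def[symmetric]
  show "linear (\<lambda>a. T_chart U \<phi> x a b c)"
    unfolding eq by (rule pt_linear_tvec_of[OF T_linear[OF V V] U p])
  show "linear (\<lambda>b. T_chart U \<phi> x a b c)"
    unfolding eq by (rule pt_linear_tvec_of[OF T_linear2[OF V V] U p])
  show "linear (\<lambda>c. T_chart U \<phi> x a b c)"
    unfolding eq by (rule pt_linear_tvec_of[OF T_linear3[OF V V] U p])
  show "T_chart U \<phi> x b a c = - T_chart U \<phi> x a b c" "T_chart U \<phi> x a c b = - T_chart U \<phi> x a b c"
    unfolding eq by (intro T_swap12 T_swap23 V)+
qed

lemma dT_chart_props:
  assumes U: "(U, \<phi>) \<in> A" and x: "x \<in> \<phi> ` U"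
  shows "linear (\<lambda>a. dT_chart U \<phi> x a b c d)" "linear (\<lambda>b. dT_chart U \<phi> x a b c d)"
    "linear (\<lambda>c. dT_chart U \<phi> x a b c d)" "linear (\<lambda>d. dT_chart U \<phi> x a b c d)"
    "dT_chart U \<phi> x b a c d = - dT_chart U \<phi> x a b c d" "dT_chart U \<phi> x a c b d = - dT_chart U \<phi> x a b c d"
    "dT_chart U \<phi> x a b d c = - dT_chart U \<phi> x a b c d"
proof -
  define p where "p = inv_into U \<phi> x"
  have p: "p \<in> U" using x by (simp add: p_def inv_into_into)
  note V = vext(1)[OF tvec_of_tangent[OF U p]]
  note eq = dT_chart_def dT_at_def Let_def p_def[symmetric]
  show "linear (\<lambda>a. dT_chart U \<phi> x a b c d)"
    unfolding eq by (rule pt_linear_tvec_of[OF ext_deriv3_linear[OF V V V] U p])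
  show "linear (\<lambda>b. dT_chart U \<phi> x a b c d)"
    unfolding eq by (rule pt_linear_tvec_of[OF ext_deriv3_linear2[OF V V V] U p])
  show "linear (\<lambda>c. dT_chart U \<phi> x a b c d)"
    unfolding eq by (rule pt_linear_tvec_of[OF ext_deriv3_linear3[OF V V V] U p])
  show "linear (\<lambda>d. dT_chart U \<phi> x a b c d)"
    unfolding eq by (rule pt_linear_tvec_of[OF ext_deriv3_linear4[OF V V V] U p])
  show "dT_chart U \<phi> x b a c d = - dT_chart U \<phi> x a b c d" "dT_chart U \<phi> x a c b d = - dT_chart U \<phi> x a b c d"
    "dT_chart U \<phi> x a b d c = - dT_chart U \<phi> x a b c d"
    unfolding eq by (intro ext_deriv3_swap V)+
qed

lemma T_chart_frame:
  assumes U: "(U, \<phi>) \<in> A" and fr: "chart_frame U \<phi> N x E" "q \<in> N"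
  shows "T_chart U \<phi> (\<phi> q) (axis i 1) (axis j 1) (axis k 1) = T (E i) (E j) (E k) q"
    and "dT_chart U \<phi> (\<phi> q) (axis i 1) (axis j 1) (axis k 1) (axis l 1) = \<beta> (E i) (E j) (E k) (E l) q"
proof -
  note fr' = fr(1)[unfolded chart_frame_def]
  have q: "inv_into U \<phi> (\<phi> q) = q" using chart_inv[OF U] fr' fr(2) by blast
  have E: "E i \<in> VF" "tvec_of U \<phi> q (axis i 1) = E i q" for i using fr' fr(2) by auto
  show "T_chart U \<phi> (\<phi> q) (axis i 1) (axis j 1) (axis k 1) = T (E i) (E j) (E k) q"
    by (simp add: T_chart_def Let_def q E T_at_eq)
  show "dT_chart U \<phi> (\<phi> q) (axis i 1) (axis j 1) (axis k 1) (axis l 1) = \<beta> (E i) (E j) (E k) (E l) q"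
    by (simp add: dT_chart_def Let_def q E dT_at_eq)
qed

lemma T_chart_smooth:
  assumes U: "(U, \<phi>) \<in> A"
  shows "smooth_on (\<phi> ` U) (\<lambda>x. T_chart U \<phi> x (axis i 1) (axis j 1) (axis k 1))"
    and "smooth_on (\<phi> ` U) (\<lambda>x. dT_chart U \<phi> x (axis i 1) (axis j 1) (axis k 1) (axis l 1))"
proof -
  have "\<exists>W. open W \<and> y \<in> W \<and> smooth_on W (\<lambda>x. T_chart U \<phi> x (axis i 1) (axis j 1) (axis k 1))
      \<and> smooth_on W (\<lambda>x. dT_chart U \<phi> x (axis i 1) (axis j 1) (axis k 1) (axis l 1))"
    if y: "y \<in> \<phi> ` U" for y
  proof -
    obtain p where p: "p \<in> U" "y = \<phi> p" using y by blast
    obtain N x E where fr: "chart_frame U \<phi> N x E" "p \<in> N" by (rule chart_frame_exists[OF U p(1)])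
    note fr' = fr(1)[unfolded chart_frame_def]
    have E: "E i \<in> VF" for i using fr' by blast
    have N: "open N" "N \<subseteq> U" using fr' by blast+
    have o: "open (\<phi> ` N)" by (rule chart_image_open[OF U N])
    have inv: "inv_into U \<phi> (\<phi> q) = q" if "q \<in> N" for q using chart_inv[OF U] N that by blast
    have sm: "smooth_on (\<phi> ` N) (\<lambda>y. f (inv_into U \<phi> y))" if "f \<in> SF" for f
      using smooth_on_subset[OF smooth_funsD'[OF that U]] N by blast
    have dT: "\<beta> (E i) (E j) (E k) (E l) \<in> SF"
      unfolding ext_deriv3_def
      by (intro smooth_funs_add smooth_funs_diff VF_smooth T_smooth lie_bracket_VF E)
    have "smooth_on (\<phi> ` N) (\<lambda>x. T_chart U \<phi> x (axis i 1) (axis j 1) (axis k 1))"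
      by (rule smooth_on_cong[OF o _ sm[OF T_smooth[OF E E E]]])
        (auto simp: T_chart_frame[OF U fr(1)] inv)
    moreover have "smooth_on (\<phi> ` N) (\<lambda>x. dT_chart U \<phi> x (axis i 1) (axis j 1) (axis k 1) (axis l 1))"
      by (rule smooth_on_cong[OF o _ sm[OF dT]])
        (auto simp: T_chart_frame[OF U fr(1)] inv)
    ultimately show ?thesis using o fr(2) p(2) by blast
  qed
  then show "smooth_on (\<phi> ` U) (\<lambda>x. T_chart U \<phi> x (axis i 1) (axis j 1) (axis k 1))"
    and "smooth_on (\<phi> ` U) (\<lambda>x. dT_chart U \<phi> x (axis i 1) (axis j 1) (axis k 1) (axis l 1))"
    by (meson smooth_on_local)+
qed

lemma dT_chart_eq:
  assumes U: "(U, \<phi>) \<in> A" and y: "y \<in> \<phi> ` U"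
  defines "d \<equiv> \<lambda>l i j k. frechet_derivative (\<lambda>x. T_chart U \<phi> x (axis i 1) (axis j 1) (axis k 1)) (at y) (axis l 1)"
  shows "dT_chart U \<phi> y (axis l 1) (axis i 1) (axis j 1) (axis k 1) = d l i j k - d i l j k + d j l i k - d k l i j"
proof -
  obtain p where p: "y = \<phi> p" "p \<in> U" by (rule imageE[OF y])
  obtain N x E where fr: "chart_frame U \<phi> N x E" "p \<in> N" by (rule chart_frame_exists[OF U p(2)])
  note fr' = fr(1)[unfolded chart_frame_def]
  have E: "E i \<in> VF" and Et: "\<And>q. q \<in> N \<Longrightarrow> E i q = tvec_of U \<phi> q (axis i 1)" for i using fr' by blast+
  have N: "open N" "N \<subseteq> U" using fr' by blast+
  have o: "open (\<phi> ` N)" by (rule chart_image_open[OF U N])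
  have yN: "y \<in> \<phi> ` N" using p fr(2) by blast
  have inv: "inv_into U \<phi> (\<phi> q) = q" if "q \<in> N" for q using chart_inv[OF U] N that by blast
  have Ed: "vf_deriv (E i) f q = frechet_derivative (f \<circ> inv_into U \<phi>) (at (\<phi> q)) (axis i 1)" if "f \<in> SF" "q \<in> N" for f i q
    using Et[OF that(2), of i] that(1) by (simp add: vf_deriv_def tvec_of_def)
  have bracket: "lie_bracket (E i) (E j) p = (\<lambda>f. 0)" for i j
  proof
    fix f
    show "lie_bracket (E i) (E j) p f = 0"
    proof (cases "f \<in> SF")
      case f: True
      let ?F = "f \<circ> inv_into U \<phi>"
      have "vf_deriv (E i) (vf_deriv (E j) f) p = frechet_derivative (\<lambda>x. frechet_derivative ?F (at x) (axis j 1)) (at y) (axis i 1)" for i j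
      proof -
        have "frechet_derivative (vf_deriv (E j) f \<circ> inv_into U \<phi>) (at y)
            = frechet_derivative (\<lambda>x. frechet_derivative ?F (at x) (axis j 1)) (at y)"
          by (rule frechet_derivative_cong[OF o yN]) (auto simp: inv Ed[OF f])
        then show ?thesis
          unfolding Ed[OF VF_smooth[OF E f] fr(2)] p(1)[symmetric] by simp
      qed
      moreover have "frechet_derivative (\<lambda>x. frechet_derivative ?F (at x) (axis j 1)) (at y) (axis i 1)
          = frechet_derivative (\<lambda>x. frechet_derivative ?F (at x) (axis i 1)) (at y) (axis j 1)"
        by (rule smooth_on_mixed_derivatives[OF chart_open(2)[OF U] smooth_funsD[OF f U] y])
      ultimately show ?thesis by (simp add: lie_bracket_eq)
    next
      case False
      then show ?thesis
        using tangentD(3)[OF VF_tangent[OF lie_bracket_VF[OF E E]]] by blast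
    qed
  qed
  have Tb: "T (lie_bracket (E i) (E j)) (E k) (E l) p = 0" for i j k l
  proof -
    have "T (lie_bracket (E i) (E j)) (E k) (E l) p = T (vf_scale (\<lambda>q. 0) (E i)) (E k) (E l) p"
      by (rule pt_linear_cong[OF T_linear[OF E E] lie_bracket_VF[OF E E] vf_scale_VF[OF smooth_funs_const E]])
        (simp add: bracket vf_scale_def)
    also have "\<dots> = 0"
      using pt_linearD(2)[OF T_linear[OF E E, where p = p] smooth_funs_const[of 0] E] by simp
    finally show ?thesis .
  qed
  have d: "vf_deriv (E l) (T (E i) (E j) (E k)) p = d l i j k" for l i j k
  proof -
    have "frechet_derivative (T (E i) (E j) (E k) \<circ> inv_into U \<phi>) (at y)
        = frechet_derivative (\<lambda>x. T_chart U \<phi> x (axis i 1) (axis j 1) (axis k 1)) (at y)"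
      by (rule frechet_derivative_cong[OF o yN]) (auto simp: inv T_chart_frame[OF U fr(1)])
    then show ?thesis
      unfolding Ed[OF T_smooth[OF E E E] fr(2)] d_def p(1)[symmetric] by simp
  qed
  show ?thesis
    unfolding p(1) T_chart_frame[OF U fr] ext_deriv3_def by (simp add: d Tb)
qed

end

subsection \<open>Alternating sums over permutations\<close>

definition asum :: "(('n::finite \<Rightarrow> 'n) \<Rightarrow> real) \<Rightarrow> real" where
  "asum f = (\<Sum>p | p permutes UNIV. of_int (sign p) * f p)"

lemma asum_cong: "(\<And>p. p permutes UNIV \<Longrightarrow> f p = h p) \<Longrightarrow> asum f = asum h"
  unfolding asum_def by (rule sum.cong) auto

lemma sign_compose_UNIV:
  fixes p q :: "'n::finite \<Rightarrow> 'n"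
  assumes "p permutes UNIV" "q permutes UNIV"
  shows "sign (p \<circ> q) = sign p * sign q"
  using assms by (metis sign_compose permutation_permutes finite)

lemma sign_square: "real_of_int (sign p) * real_of_int (sign p) = 1"
  by (simp flip: of_int_mult add: sign_idempotent)

lemma asum_add: "asum (\<lambda>p. f p + h p) = asum f + asum h"
  by (simp add: asum_def sum.distrib algebra_simps)

lemma asum_cmult: "asum (\<lambda>p. c * f p) = c * asum f"
  by (simp add: asum_def sum_distrib_left algebra_simps)

lemma asum_right:
  fixes q :: "'n::finite \<Rightarrow> 'n"
  assumes q: "q permutes UNIV"
  shows "asum (\<lambda>p. f (p \<circ> q)) = of_int (sign q) * asum f"
proof -
  have "asum f = (\<Sum>p | p permutes UNIV. of_int (sign (p \<circ> q)) * f (p \<circ> q))"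
    unfolding asum_def by (rule sum_permutations_compose_right[OF q])
  also have "\<dots> = (\<Sum>p | p permutes UNIV. of_int (sign q) * (of_int (sign p) * f (p \<circ> q)))"
    by (rule sum.cong) (use q in \<open>auto simp: sign_compose_UNIV\<close>)
  also have "\<dots> = of_int (sign q) * asum (\<lambda>p. f (p \<circ> q))"
    by (simp add: asum_def sum_distrib_left)
  finally have "of_int (sign q) * asum f = (of_int (sign q) * of_int (sign q)) * asum (\<lambda>p. f (p \<circ> q))" by simp
  then show ?thesis unfolding sign_square by simp
qed

lemma asum_left:
  fixes q :: "'n::finite \<Rightarrow> 'n"
  assumes q: "q permutes UNIV"
  shows "asum (\<lambda>p. f (q \<circ> p)) = of_int (sign q) * asum f"
proof -
  have "asum f = (\<Sum>p | p permutes UNIV. of_int (sign (q \<circ> p)) * f (q \<circ> p))"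
    unfolding asum_def by (rule setum_permutations_compose_left[OF q])
  also have "\<dots> = (\<Sum>p | p permutes UNIV. of_int (sign q) * (of_int (sign p) * f (q \<circ> p)))"
    by (rule sum.cong) (use q in \<open>auto simp: sign_compose_UNIV\<close>)
  also have "\<dots> = of_int (sign q) * asum (\<lambda>p. f (q \<circ> p))"
    by (simp add: asum_def sum_distrib_left)
  finally have "of_int (sign q) * asum f = (of_int (sign q) * of_int (sign q)) * asum (\<lambda>p. f (q \<circ> p))" by simp
  then show ?thesis unfolding sign_square by simp
qed

definition multilinear :: "(('n \<Rightarrow> 'v::real_vector) \<Rightarrow> real) \<Rightarrow> bool" where
  "multilinear m \<longleftrightarrow> (\<forall>x i. linear (\<lambda>v. m (x(i := v))))"

lemma multilinearD: "multilinear m \<Longrightarrow> linear (\<lambda>v. m (x(i := v)))"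
  unfolding multilinear_def by blast

lemma multilinear_scale:
  fixes m :: "('n::finite \<Rightarrow> 'v::real_vector) \<Rightarrow> real"
  assumes m: "multilinear m"
  shows "m (\<lambda>i. c i *\<^sub>R x i) = (\<Prod>i\<in>UNIV. c i) * m x"
proof -
  have "m (\<lambda>i. if i \<in> K then c i *\<^sub>R x i else x i) = (\<Prod>i\<in>K. c i) * m x" if "finite K" for K
    using that
  proof (induction K rule: finite_induct)
    case (insert k K)
    let ?y = "\<lambda>i. if i \<in> K then c i *\<^sub>R x i else x i"
    have lin: "linear (\<lambda>v. m (?y(k := v)))" by (rule multilinearD[OF m])
    have "(\<lambda>i. if i \<in> insert k K then c i *\<^sub>R x i else x i) = ?y(k := c k *\<^sub>R x k)" "?y(k := x k) = ?y"
      using insert.hyps by auto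
    then show ?case
      using insert linear_scale[OF lin, of "c k" "x k"] by simp
  qed simp
  from this[of UNIV] show ?thesis by simp
qed

lemma asum_equal_rows:
  fixes x :: "'n::finite \<Rightarrow> 'v"
  assumes "a \<noteq> b" "x a = x b"
  shows "asum (\<lambda>p. m (\<lambda>i. x (p i))) = 0"
proof -
  let ?t = "Transposition.transpose a b"
  have t: "x (?t k) = x k" for k
    using assms by (cases "k = a"; cases "k = b") auto
  have "asum (\<lambda>p. m (\<lambda>i. x ((?t \<circ> p) i))) = of_int (sign ?t) * asum (\<lambda>p. m (\<lambda>i. x (p i)))"
    by (rule asum_left[of ?t "\<lambda>p. m (\<lambda>i. x (p i))"]) (simp add: permutes_swap_id)
  then show ?thesis using assms(1) by (simp add: t sign_swap_id)
qed

lemma asum_multilinear_det: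
  fixes m :: "('n::finite \<Rightarrow> real^'n) \<Rightarrow> real"
  assumes "multilinear m"
  shows "asum (\<lambda>p. m (\<lambda>i. A $ p i)) = det A * asum (\<lambda>p. m (\<lambda>i. axis (p i) 1))"
proof -
  have "\<forall>m::('n \<Rightarrow> real^'n) \<Rightarrow> real. multilinear m \<longrightarrow>
    asum (\<lambda>p. m (\<lambda>i. A $ p i)) = det A * asum (\<lambda>p. m (\<lambda>i. axis (p i) 1))" (is "?P A")
  proof (rule induct_matrix_row_operations[where P = ?P])
    fix A :: "real^'n^'n" and k assume k: "row k A = 0"
    have "m (\<lambda>i. A $ p i) = 0" if m: "multilinear m" and p: "p permutes UNIV" for m :: "('n \<Rightarrow> real^'n) \<Rightarrow> real" and p
    proof -
      obtain j where j: "p j = k" using permutes_surj[OF p] by (metis surjD)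
      let ?x = "\<lambda>i. A $ p i"
      have "?x(j := 0) = ?x" using j k by (auto simp: row_def fun_eq_iff vec_eq_iff)
      moreover have "m (?x(j := 0)) = 0"
        by (rule linear_0[OF multilinearD[OF m]])
      ultimately show ?thesis by simp
    qed
    then show "?P A" unfolding asum_def using det_zero_row(2)[OF k] by (auto intro!: sum.neutral)
  next
    fix A :: "real^'n^'n" assume A: "\<And>i j. i \<noteq> j \<Longrightarrow> A $ i $ j = 0"
    have row: "A $ i = A $ i $ i *\<^sub>R axis i 1" for i
      using A by (auto simp: vec_eq_iff axis_def)
    have "m (\<lambda>i. A $ p i) = det A * m (\<lambda>i. axis (p i) 1)" if m: "multilinear m" and p: "p permutes UNIV"
      for m :: "('n \<Rightarrow> real^'n) \<Rightarrow> real" and p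
    proof -
      have "m (\<lambda>i. A $ p i) = m (\<lambda>i. A $ p i $ p i *\<^sub>R axis (p i) 1)"
        by (rule arg_cong[of _ _ m]) (rule ext, rule row)
      also have "\<dots> = (\<Prod>i\<in>UNIV. A $ p i $ p i) * m (\<lambda>i. axis (p i) 1)"
        by (rule multilinear_scale[OF m])
      also have "(\<Prod>i\<in>UNIV. A $ p i $ p i) = (\<Prod>i\<in>UNIV. A $ i $ i)"
        using prod.permute[OF p, of "\<lambda>i. A $ i $ i"] by (simp add: comp_def)
      finally show ?thesis using det_diagonal[of A] A by simp
    qed
    then show "?P A" by (auto simp: asum_cmult[symmetric] intro!: asum_cong)
  next
    fix A :: "real^'n^'n" and a b :: 'n
    let ?t = "Transposition.transpose a b"
    assume P: "?P A" and "a \<noteq> b"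
    let ?A = "\<chi> i j. A $ i $ ?t j"
    let ?L = "\<lambda>v::real^'n. \<chi> j. v $ ?t j"
    have t: "?t permutes UNIV" by (simp add: permutes_swap_id)
    have L: "linear ?L" by (auto intro!: linearI simp: vec_eq_iff)
    have La: "?L (axis k 1) = axis (?t k) 1" for k
    proof -
      have "?t j = k \<longleftrightarrow> j = ?t k" for j by (metis transpose_involutory)
      then show ?thesis by (simp add: vec_eq_iff axis_def)
    qed
    show "?P ?A"
    proof (intro allI impI)
      fix m :: "('n \<Rightarrow> real^'n) \<Rightarrow> real" assume m: "multilinear m"
      let ?m = "\<lambda>x. m (\<lambda>i. ?L (x i))"
      have m': "multilinear ?m"
        unfolding multilinear_def
      proof (intro allI)
        fix x :: "'n \<Rightarrow> real^'n" and k
        have "(\<lambda>i. ?L ((x(k := v)) i)) = (\<lambda>i. ?L (x i))(k := ?L v)" for v by auto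
        moreover have "linear (\<lambda>v. m ((\<lambda>i. ?L (x i))(k := ?L v)))"
          using linear_compose[OF L multilinearD[OF m, of "\<lambda>i. ?L (x i)" k]] by (simp only: comp_def)
        ultimately show "linear (\<lambda>v. ?m (x(k := v)))" by (simp only:)
      qed
      have "asum (\<lambda>p. m (\<lambda>i. ?A $ p i)) = asum (\<lambda>p. ?m (\<lambda>i. A $ p i))"
        by (rule asum_cong, rule arg_cong[of _ _ m]) (simp add: fun_eq_iff vec_eq_iff)
      also have "\<dots> = det A * asum (\<lambda>p. ?m (\<lambda>i. axis (p i) 1))"
        using P m' by blast
      also have "asum (\<lambda>p. ?m (\<lambda>i. axis (p i) 1)) = asum (\<lambda>p. m (\<lambda>i. axis ((?t \<circ> p) i) 1))"
        by (simp add: La)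
      also have "\<dots> = of_int (sign ?t) * asum (\<lambda>p. m (\<lambda>i. axis (p i) 1))"
        by (rule asum_left[OF t, of "\<lambda>p. m (\<lambda>i. axis (p i) 1)"])
      finally show "asum (\<lambda>p. m (\<lambda>i. ?A $ p i)) = det ?A * asum (\<lambda>p. m (\<lambda>i. axis (p i) 1))"
        using det_permute_columns[OF t, of A] by simp
    qed
  next
    fix A :: "real^'n^'n" and a b :: 'n and c
    assume P: "?P A" and ab: "a \<noteq> b"
    let ?A = "\<chi> i. if i = a then row a A + c *\<^sub>R row b A else row i A"
    let ?C = "\<lambda>i. if i = a then A $ b else A $ i"
    show "?P ?A"
    proof (intro allI impI)
      fix m :: "('n \<Rightarrow> real^'n) \<Rightarrow> real" assume m: "multilinear m"
      have "m (\<lambda>i. ?A $ p i) = m (\<lambda>i. A $ p i) + c * m (\<lambda>i. ?C (p i))" if p: "p permutes UNIV" for p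
      proof -
        obtain j where j: "p j = a" using permutes_surj[OF p] by (metis surjD)
        then have pj: "p i = a \<longleftrightarrow> i = j" for i using permutes_inj[OF p] by (auto dest: injD)
        let ?x = "\<lambda>i. A $ p i"
        have lin: "linear (\<lambda>v. m (?x(j := v)))" by (rule multilinearD[OF m])
        have "(\<lambda>i. ?A $ p i) = ?x(j := A $ a + c *\<^sub>R A $ b)" "?x(j := A $ a) = ?x" "?x(j := A $ b) = (\<lambda>i. ?C (p i))"
          using pj by (auto simp: row_def fun_eq_iff vec_eq_iff j)
        then show ?thesis
          using linear_add[OF lin, of "A $ a" "c *\<^sub>R A $ b"] linear_scale[OF lin, of c "A $ b"] by simp
      qed
      then have "asum (\<lambda>p. m (\<lambda>i. ?A $ p i)) = asum (\<lambda>p. m (\<lambda>i. A $ p i) + c * m (\<lambda>i. ?C (p i)))"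
        by (rule asum_cong)
      also have "\<dots> = asum (\<lambda>p. m (\<lambda>i. A $ p i))"
        using asum_equal_rows[OF ab, of ?C m] ab by (simp add: asum_add asum_cmult)
      also have "\<dots> = det A * asum (\<lambda>p. m (\<lambda>i. axis (p i) 1))"
        using P m by blast
      also have "det A = det ?A"
        by (rule det_row_operation[OF ab, of A c, unfolded scalar_mult_eq_scaleR, symmetric])
      finally show "asum (\<lambda>p. m (\<lambda>i. ?A $ p i)) = det ?A * asum (\<lambda>p. m (\<lambda>i. axis (p i) 1))" .
    qed
  qed
  then show ?thesis using assms by blast
qed

subsection \<open>Self-duality of 4-forms in eight dimensions\<close>

definition order_sign :: "nat \<Rightarrow> nat \<Rightarrow> real" where
  "order_sign x y = (if x < y then 1 else - 1)"

lemma order_sign_swap: "x \<noteq> y \<Longrightarrow> order_sign y x = - order_sign x y"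
  by (simp add: order_sign_def)

definition perm_sign :: "nat \<Rightarrow> nat \<Rightarrow> nat \<Rightarrow> nat \<Rightarrow> nat \<Rightarrow> nat
    \<Rightarrow> nat \<Rightarrow> nat \<Rightarrow> real" where
  "perm_sign x0 x1 x2 x3 x4 x5 x6 x7 = order_sign x0 x1 * order_sign x0 x2 * order_sign x0 x3 * order_sign x0 x4 * order_sign
      x0 x5 * order_sign x0 x6 * order_sign x0 x7 * order_sign x1 x2 * order_sign x1 x3 * order_sign x1 x4 * order_sign x1 x5 *
          order_sign x1 x6 * order_sign x1 x7 * order_sign x2 x3 * order_sign x2 x4 * order_sign x2 x5 * order_sign x2 x6 *
            order_sign x2 x7 * order_sign x3 x4 * order_sign x3 x5 * order_sign x3 x6 * order_sign x3 x7 * order_sign x4 x5 *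
            order_sign x4 x6 * order_sign x4 x7 * order_sign x5 x6 * order_sign x5 x7 * order_sign x6 x7"

text \<open>The lexicographic code drops whenever an inversion is removed; it is the measure for the inductions that sort
  the entries.\<close>

definition perm_code :: "nat \<Rightarrow> nat \<Rightarrow> nat \<Rightarrow> nat \<Rightarrow> nat \<Rightarrow> nat
    \<Rightarrow> nat \<Rightarrow> nat \<Rightarrow> nat" where
  "perm_code x0 x1 x2 x3 x4 x5 x6 x7 = x0 * 8 ^ 7+x1 * 8 ^ 6+x2 * 8 ^ 5+x3 * 8 ^ 4+x4 * 8 ^ 3+x5 * 8 ^ 2+x6 * 8 ^ 1+x7 * 8 ^ 0"

lemma perm_sign_square: "perm_sign x0 x1 x2 x3 x4 x5 x6 x7 * perm_sign x0 x1 x2 x3 x4 x5 x6 x7 = 1"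
proof -
  have "perm_sign x0 x1 x2 x3 x4 x5 x6 x7 = 1 \<or> perm_sign x0 x1 x2 x3 x4 x5 x6 x7 = - 1"
  proof -
    have *: "a * order_sign x y = 1 \<or> a * order_sign x y = - 1" if "a = 1 \<or> a = - 1" for a x y
      using that by (auto simp: order_sign_def)
    show ?thesis unfolding perm_sign_def
      by (intro *) (auto simp: order_sign_def)
  qed
  then show ?thesis by auto
qed

lemma perm_sign_swap:
  shows "x0 \<noteq> x1 \<Longrightarrow> perm_sign x1 x0 x2 x3 x4 x5 x6 x7 = - perm_sign x0 x1 x2 x3 x4 x5 x6 x7"
    and "x1 \<noteq> x2 \<Longrightarrow> perm_sign x0 x2 x1 x3 x4 x5 x6 x7 = - perm_sign x0 x1 x2 x3 x4 x5 x6 x7"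
    and "x2 \<noteq> x3 \<Longrightarrow> perm_sign x0 x1 x3 x2 x4 x5 x6 x7 = - perm_sign x0 x1 x2 x3 x4 x5 x6 x7"
    and "x3 \<noteq> x4 \<Longrightarrow> perm_sign x0 x1 x2 x4 x3 x5 x6 x7 = - perm_sign x0 x1 x2 x3 x4 x5 x6 x7"
    and "x4 \<noteq> x5 \<Longrightarrow> perm_sign x0 x1 x2 x3 x5 x4 x6 x7 = - perm_sign x0 x1 x2 x3 x4 x5 x6 x7"
    and "x5 \<noteq> x6 \<Longrightarrow> perm_sign x0 x1 x2 x3 x4 x6 x5 x7 = - perm_sign x0 x1 x2 x3 x4 x5 x6 x7"
    and "x6 \<noteq> x7 \<Longrightarrow> perm_sign x0 x1 x2 x3 x4 x5 x7 x6 = - perm_sign x0 x1 x2 x3 x4 x5 x6 x7"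
proof -
  show "perm_sign x1 x0 x2 x3 x4 x5 x6 x7 = - perm_sign x0 x1 x2 x3 x4 x5 x6 x7" if "x0 \<noteq> x1"
    unfolding perm_sign_def order_sign_swap[OF that] by (simp add: mult_ac)
  show "perm_sign x0 x2 x1 x3 x4 x5 x6 x7 = - perm_sign x0 x1 x2 x3 x4 x5 x6 x7" if "x1 \<noteq> x2"
    unfolding perm_sign_def order_sign_swap[OF that] by (simp add: mult_ac)
  show "perm_sign x0 x1 x3 x2 x4 x5 x6 x7 = - perm_sign x0 x1 x2 x3 x4 x5 x6 x7" if "x2 \<noteq> x3"
    unfolding perm_sign_def order_sign_swap[OF that] by (simp add: mult_ac)
  show "perm_sign x0 x1 x2 x4 x3 x5 x6 x7 = - perm_sign x0 x1 x2 x3 x4 x5 x6 x7" if "x3 \<noteq> x4"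
    unfolding perm_sign_def order_sign_swap[OF that] by (simp add: mult_ac)
  show "perm_sign x0 x1 x2 x3 x5 x4 x6 x7 = - perm_sign x0 x1 x2 x3 x4 x5 x6 x7" if "x4 \<noteq> x5"
    unfolding perm_sign_def order_sign_swap[OF that] by (simp add: mult_ac)
  show "perm_sign x0 x1 x2 x3 x4 x6 x5 x7 = - perm_sign x0 x1 x2 x3 x4 x5 x6 x7" if "x5 \<noteq> x6"
    unfolding perm_sign_def order_sign_swap[OF that] by (simp add: mult_ac)
  show "perm_sign x0 x1 x2 x3 x4 x5 x7 x6 = - perm_sign x0 x1 x2 x3 x4 x5 x6 x7" if "x6 \<noteq> x7"
    unfolding perm_sign_def order_sign_swap[OF that] by (simp add: mult_ac)
qed

lemma perm_sign_block_swap: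
  assumes "distinct [x0, x1, x2, x3, x4, x5, x6, x7]"
  shows "perm_sign x4 x5 x6 x7 x0 x1 x2 x3 = perm_sign x0 x1 x2 x3 x4 x5 x6 x7"
proof -
  have *: "order_sign x4 x0 = - order_sign x0 x4" "order_sign x4 x1 = - order_sign x1 x4" "order_sign x4 x2 = - order_sign x2
      x4" "order_sign x4 x3 = - order_sign x3 x4" "order_sign x5 x0 = - order_sign x0 x5" "order_sign x5 x1 = - order_sign x1
          x5" "order_sign x5 x2 = - order_sign x2 x5" "order_sign x5 x3 = - order_sign x3 x5" "order_sign x6 x0 = - order_sign
            x0 x6" "order_sign x6 x1 = - order_sign x1 x6" "order_sign x6 x2 = - order_sign x2 x6" "order_sign x6 x3 = -
            order_sign x3 x6" "order_sign x7 x0 = - order_sign x0 x7" "order_sign x7 x1 = - order_sign x1 x7" "order_sign x7 x2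
            = - order_sign x2 x7" "order_sign x7 x3 = - order_sign x3 x7"
    using assms by (auto intro: order_sign_swap)
  show ?thesis unfolding perm_sign_def * by (simp add: mult_ac)
qed

lemma perm_sign_pair_swap:
  assumes "distinct [x0, x1, x2, x3, x4, x5, x6, x7]"
  shows "perm_sign x2 x3 x0 x1 x4 x5 x6 x7 = perm_sign x0 x1 x2 x3 x4 x5 x6 x7"
    and "perm_sign x0 x1 x4 x5 x2 x3 x6 x7 = perm_sign x0 x1 x2 x3 x4 x5 x6 x7"
    and "perm_sign x0 x1 x2 x3 x6 x7 x4 x5 = perm_sign x0 x1 x2 x3 x4 x5 x6 x7"
proof -
  have *: "order_sign x2 x0 = - order_sign x0 x2" "order_sign x2 x1 = - order_sign x1 x2" "order_sign x3 x0 = - order_sign x0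
      x3" "order_sign x3 x1 = - order_sign x1 x3"
    using assms by (auto intro: order_sign_swap)
  show "perm_sign x2 x3 x0 x1 x4 x5 x6 x7 = perm_sign x0 x1 x2 x3 x4 x5 x6 x7" unfolding perm_sign_def * by (simp add: mult_ac)
  have *: "order_sign x4 x2 = - order_sign x2 x4" "order_sign x4 x3 = - order_sign x3 x4" "order_sign x5 x2 = - order_sign x2
      x5" "order_sign x5 x3 = - order_sign x3 x5"
    using assms by (auto intro: order_sign_swap)
  show "perm_sign x0 x1 x4 x5 x2 x3 x6 x7 = perm_sign x0 x1 x2 x3 x4 x5 x6 x7" unfolding perm_sign_def * by (simp add: mult_ac)
  have *: "order_sign x6 x4 = - order_sign x4 x6" "order_sign x6 x5 = - order_sign x5 x6" "order_sign x7 x4 = - order_sign x4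
      x7" "order_sign x7 x5 = - order_sign x5 x7"
    using assms by (auto intro: order_sign_swap)
  show "perm_sign x0 x1 x2 x3 x6 x7 x4 x5 = perm_sign x0 x1 x2 x3 x4 x5 x6 x7" unfolding perm_sign_def * by (simp add: mult_ac)
qed

lemma shuffles_3_4:
  assumes "0 < a" "a < b" "b < c" "c < 8" "0 < d" "d < e" "e < f" "f < g" "g < (8::nat)"
    "{a, b, c} \<inter> {d, e, f, g} = {}"
  shows "(a, b, c, d, e, f, g) \<in> set [(1,2,3,4,5,6,7), (1,2,4,3,5,6,7), (1,2,5,3,4,6,7), (1,2,6,3,4,5,7), (1,2,7,3,4,5,6),
      (1,3,4,2,5,6,7), (1,3,5,2,4,6,7), (1,3,6,2,4,5,7), (1,3,7,2,4,5,6), (1,4,5,2,3,6,7), (1,4,6,2,3,5,7), (1,4,7,2,3,5,6),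
          (1,5,6,2,3,4,7), (1,5,7,2,3,4,6), (1,6,7,2,3,4,5), (2,3,4,1,5,6,7), (2,3,5,1,4,6,7), (2,3,6,1,4,5,7),
            (2,3,7,1,4,5,6), (2,4,5,1,3,6,7), (2,4,6,1,3,5,7), (2,4,7,1,3,5,6), (2,5,6,1,3,4,7), (2,5,7,1,3,4,6),
            (2,6,7,1,3,4,5), (3,4,5,1,2,6,7), (3,4,6,1,2,5,7), (3,4,7,1,2,5,6), (3,5,6,1,2,4,7), (3,5,7,1,2,4,6),
            (3,6,7,1,2,4,5), (4,5,6,1,2,3,7), (4,5,7,1,2,3,6), (4,6,7,1,2,3,5), (5,6,7,1,2,3,4)]" (is "_ \<in> set ?L")
proof -
  have *: "list_all (\<lambda>a. list_all (\<lambda>b. list_all (\<lambda>c. list_all (\<lambda>d.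
      if d = a \<or> d = b \<or> d = c then True else list_all (\<lambda>e.
      if e = a \<or> e = b \<or> e = c then True else list_all (\<lambda>f.
      if f = a \<or> f = b \<or> f = c then True else list_all (\<lambda>g.
      if g = a \<or> g = b \<or> g = c then True else (a, b, c, d, e, f, g) \<in> set ?L)
      [Suc f..<8]) [Suc e..<8]) [Suc d..<8]) [1..<8]) [Suc b..<8]) [Suc a..<8]) [1..<8]"
    by code_simp
  define L where "L = set ?L"
  have "(a, b, c, d, e, f, g) \<in> L"
    using * assms unfolding list_all_iff set_upt L_def[symmetric]
    by (simp add: Ball_def Suc_le_eq)
  then show ?thesis by (simp only: L_def)
qed

text \<open>The components of a 4-form in a frame \<open>(e, J\<^sub>1 e, J\<^sub>2 e, J\<^sub>3 e, f, J\<^sub>1 f, J\<^sub>2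
    f, J\<^sub>3 f)\<close>, where \<open>c1\<close>, \<open>c2\<close>
  and \<open>c3\<close> express the vanishing of its contractions with the three Kaehler forms.\<close>

locale contraction_free =
  fixes b :: "nat \<Rightarrow> nat \<Rightarrow> nat \<Rightarrow> nat \<Rightarrow> real"
  assumes s1: "b y x z w = - b x y z w" and s2: "b x z y w = - b x y z w" and s3: "b x y w z = - b x y z w"
    and c1: "b 0 1 x y + b 2 3 x y + b 4 5 x y + b 6 7 x y = 0"
    and c2: "b 0 2 x y - b 1 3 x y + b 4 6 x y - b 5 7 x y = 0"
    and c3: "b 0 3 x y + b 1 2 x y + b 4 7 x y + b 5 6 x y = 0"
begin

lemma sorted_components: "y < x \<Longrightarrow> b x y z w = - b y x z w" "z < y \<Longrightarrow> b x y z w = - b x z y w"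
  "w < z \<Longrightarrow> b x y z w = - b x y w z" "b x x z w = 0" "b x y y w = 0" "b x y z z = 0"
  using s1[of x y z w] s2[of x y z w] s3[of x y z w] s1[of x x z w] s2[of x y y w] s3[of x y z z] by auto

lemma dual_components:
  assumes "(i, j, k, d, e, f, g) \<in> set [(1,2,3,4,5,6,7), (1,2,4,3,5,6,7), (1,2,5,3,4,6,7), (1,2,6,3,4,5,7),
      (1,2,7,3,4,5,6), (1,3,4,2,5,6,7), (1,3,5,2,4,6,7), (1,3,6,2,4,5,7), (1,3,7,2,4,5,6), (1,4,5,2,3,6,7), (1,4,6,2,3,5,7),
          (1,4,7,2,3,5,6), (1,5,6,2,3,4,7), (1,5,7,2,3,4,6), (1,6,7,2,3,4,5), (2,3,4,1,5,6,7), (2,3,5,1,4,6,7),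
            (2,3,6,1,4,5,7), (2,3,7,1,4,5,6), (2,4,5,1,3,6,7), (2,4,6,1,3,5,7), (2,4,7,1,3,5,6), (2,5,6,1,3,4,7),
            (2,5,7,1,3,4,6), (2,6,7,1,3,4,5), (3,4,5,1,2,6,7), (3,4,6,1,2,5,7), (3,4,7,1,2,5,6), (3,5,6,1,2,4,7),
            (3,5,7,1,2,4,6), (3,6,7,1,2,4,5), (4,5,6,1,2,3,7), (4,5,7,1,2,3,6), (4,6,7,1,2,3,5), (5,6,7,1,2,3,4)]"
  shows "perm_sign 0 i j k d e f g * b d e f g = b 0 i j k"
proof -
  note [simp] = perm_sign_def order_sign_def
  have e0: "perm_sign 0 1 2 3 4 5 6 7 * b 4 5 6 7 = b 0 1 2 3"
    using c2[of 0 2, simplified sorted_components] c2[of 1 3, simplified sorted_components] c2[of 4 6, simplified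
        sorted_components] c2[of 5 7, simplified sorted_components] by simp
  have e1: "perm_sign 0 1 2 4 3 5 6 7 * b 3 5 6 7 = b 0 1 2 4"
    using c1[of 3 5, simplified sorted_components] c2[of 0 5, simplified sorted_components] c3[of 0 4, simplified sorted_components] by simp
  have e2: "perm_sign 0 1 2 5 3 4 6 7 * b 3 4 6 7 = b 0 1 2 5"
    using c1[of 2 5, simplified sorted_components] c2[of 2 6, simplified sorted_components] c3[of 3 6, simplified sorted_components] by simp
  have e3: "perm_sign 0 1 2 6 3 4 5 7 * b 3 4 5 7 = b 0 1 2 6"
    using c1[of 3 7, simplified sorted_components] c2[of 0 7, simplified sorted_components] c3[of 0 6, simplified sorted_components] by simp
  have e4: "perm_sign 0 1 2 7 3 4 5 6 * b 3 4 5 6 = b 0 1 2 7"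
    using c1[of 0 5, simplified sorted_components] c2[of 3 5, simplified sorted_components] c3[of 0 7, simplified sorted_components] by simp
  have e5: "perm_sign 0 1 3 4 2 5 6 7 * b 2 5 6 7 = b 0 1 3 4"
    using c1[of 3 4, simplified sorted_components] c2[of 2 6, simplified sorted_components] c3[of 3 6, simplified sorted_components] by simp
  have e6: "perm_sign 0 1 3 5 2 4 6 7 * b 2 4 6 7 = b 0 1 3 5"
    using c1[of 2 4, simplified sorted_components] c2[of 1 4, simplified sorted_components] c3[of 1 5, simplified sorted_components] by simp
  have e7: "perm_sign 0 1 3 6 2 4 5 7 * b 2 4 5 7 = b 0 1 3 6"
    using c1[of 3 6, simplified sorted_components] c2[of 3 5, simplified sorted_components] c3[of 2 5, simplified sorted_components] by simp
  have e8: "perm_sign 0 1 3 7 2 4 5 6 * b 2 4 5 6 = b 0 1 3 7"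
    using c1[of 2 6, simplified sorted_components] c2[of 1 6, simplified sorted_components] c3[of 1 7, simplified sorted_components] by simp
  have e9: "perm_sign 0 1 4 5 2 3 6 7 * b 2 3 6 7 = b 0 1 4 5"
    using c1[of 0 1, simplified sorted_components] c1[of 2 3, simplified sorted_components] c1[of 4 5, simplified
        sorted_components] c1[of 6 7, simplified sorted_components] by simp
  have e10: "perm_sign 0 1 4 6 2 3 5 7 * b 2 3 5 7 = b 0 1 4 6"
    using c1[of 5 7, simplified sorted_components] c2[of 0 1, simplified sorted_components] by simp
  have e11: "perm_sign 0 1 4 7 2 3 5 6 * b 2 3 5 6 = b 0 1 4 7"
    using c1[of 4 7, simplified sorted_components] c3[of 2 3, simplified sorted_components] by simp
  have e12: "perm_sign 0 1 5 6 2 3 4 7 * b 2 3 4 7 = b 0 1 5 6"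
    using c1[of 5 6, simplified sorted_components] c3[of 2 3, simplified sorted_components] by simp
  have e13: "perm_sign 0 1 5 7 2 3 4 6 * b 2 3 4 6 = b 0 1 5 7"
    using c1[of 4 6, simplified sorted_components] c2[of 0 1, simplified sorted_components] by simp
  have e14: "perm_sign 0 1 6 7 2 3 4 5 * b 2 3 4 5 = b 0 1 6 7"
    using c1[of 0 1, simplified sorted_components] c1[of 2 3, simplified sorted_components] c1[of 4 5, simplified
        sorted_components] c1[of 6 7, simplified sorted_components] by simp
  have e15: "perm_sign 0 2 3 4 1 5 6 7 * b 1 5 6 7 = b 0 2 3 4"
    using c1[of 0 4, simplified sorted_components] c2[of 1 6, simplified sorted_components] c3[of 0 6, simplified sorted_components] by simp
  have e16: "perm_sign 0 2 3 5 1 4 6 7 * b 1 4 6 7 = b 0 2 3 5"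
    using c1[of 3 6, simplified sorted_components] c2[of 3 5, simplified sorted_components] c3[of 1 6, simplified sorted_components] by simp
  have e17: "perm_sign 0 2 3 6 1 4 5 7 * b 1 4 5 7 = b 0 2 3 6"
    using c1[of 0 6, simplified sorted_components] c2[of 1 4, simplified sorted_components] c3[of 0 4, simplified sorted_components] by simp
  have e18: "perm_sign 0 2 3 7 1 4 5 6 * b 1 4 5 6 = b 0 2 3 7"
    using c1[of 0 7, simplified sorted_components] c2[of 0 4, simplified sorted_components] c3[of 1 4, simplified sorted_components] by simp
  have e19: "perm_sign 0 2 4 5 1 3 6 7 * b 1 3 6 7 = b 0 2 4 5"
    using c1[of 0 2, simplified sorted_components] c2[of 6 7, simplified sorted_components] by simp
  have e20: "perm_sign 0 2 4 6 1 3 5 7 * b 1 3 5 7 = b 0 2 4 6"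
    using c2[of 0 2, simplified sorted_components] c2[of 1 3, simplified sorted_components] c2[of 4 6, simplified
        sorted_components] c2[of 5 7, simplified sorted_components] by simp
  have e21: "perm_sign 0 2 4 7 1 3 5 6 * b 1 3 5 6 = b 0 2 4 7"
    using c2[of 5 6, simplified sorted_components] c3[of 0 2, simplified sorted_components] by simp
  have e22: "perm_sign 0 2 5 6 1 3 4 7 * b 1 3 4 7 = b 0 2 5 6"
    using c2[of 4 7, simplified sorted_components] c3[of 0 2, simplified sorted_components] by simp
  have e23: "perm_sign 0 2 5 7 1 3 4 6 * b 1 3 4 6 = b 0 2 5 7"
    using c2[of 0 2, simplified sorted_components] c2[of 1 3, simplified sorted_components] c2[of 4 6, simplified
        sorted_components] c2[of 5 7, simplified sorted_components] by simp
  have e24: "perm_sign 0 2 6 7 1 3 4 5 * b 1 3 4 5 = b 0 2 6 7"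
    using c1[of 1 3, simplified sorted_components] c2[of 6 7, simplified sorted_components] by simp
  have e25: "perm_sign 0 3 4 5 1 2 6 7 * b 1 2 6 7 = b 0 3 4 5"
    using c1[of 1 2, simplified sorted_components] c3[of 4 5, simplified sorted_components] by simp
  have e26: "perm_sign 0 3 4 6 1 2 5 7 * b 1 2 5 7 = b 0 3 4 6"
    using c2[of 1 2, simplified sorted_components] c3[of 4 6, simplified sorted_components] by simp
  have e27: "perm_sign 0 3 4 7 1 2 5 6 * b 1 2 5 6 = b 0 3 4 7"
    using c3[of 0 3, simplified sorted_components] c3[of 1 2, simplified sorted_components] c3[of 4 7, simplified
        sorted_components] c3[of 5 6, simplified sorted_components] by simp
  have e28: "perm_sign 0 3 5 6 1 2 4 7 * b 1 2 4 7 = b 0 3 5 6"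
    using c3[of 0 3, simplified sorted_components] c3[of 1 2, simplified sorted_components] c3[of 4 7, simplified
        sorted_components] c3[of 5 6, simplified sorted_components] by simp
  have e29: "perm_sign 0 3 5 7 1 2 4 6 * b 1 2 4 6 = b 0 3 5 7"
    using c2[of 1 2, simplified sorted_components] c3[of 5 7, simplified sorted_components] by simp
  have e30: "perm_sign 0 3 6 7 1 2 4 5 * b 1 2 4 5 = b 0 3 6 7"
    using c1[of 0 3, simplified sorted_components] c3[of 4 5, simplified sorted_components] by simp
  have e31: "perm_sign 0 4 5 6 1 2 3 7 * b 1 2 3 7 = b 0 4 5 6"
    using c1[of 1 7, simplified sorted_components] c2[of 1 4, simplified sorted_components] c3[of 0 4, simplified sorted_components] by simp
  have e32: "perm_sign 0 4 5 7 1 2 3 6 * b 1 2 3 6 = b 0 4 5 7"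
    using c1[of 2 5, simplified sorted_components] c2[of 2 6, simplified sorted_components] c3[of 0 5, simplified sorted_components] by simp
  have e33: "perm_sign 0 4 6 7 1 2 3 5 * b 1 2 3 5 = b 0 4 6 7"
    using c1[of 1 5, simplified sorted_components] c2[of 0 7, simplified sorted_components] c3[of 1 7, simplified sorted_components] by simp
  have e34: "perm_sign 0 5 6 7 1 2 3 4 * b 1 2 3 4 = b 0 5 6 7"
    using c1[of 3 6, simplified sorted_components] c2[of 0 6, simplified sorted_components] c3[of 3 4, simplified sorted_components] by simp
  show ?thesis
    using assms unfolding list.set insert_iff prod.inject empty_iff
    by (elim disjE conjE FalseE; hypsubst) (rule e0 e1 e2 e3 e4 e5 e6 e7 e8 e9 e10 e11 e12 e13 e14 e15 e16 e17 e18 e19 e20 e21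
        e22 e23 e24 e25 e26 e27 e28 e29 e30 e31 e32 e33 e34)+
qed

lemma self_dual:
  assumes "distinct [x0, x1, x2, x3, x4, x5, x6, x7]" "set [x0, x1, x2, x3, x4, x5, x6, x7] \<subseteq> {..<8}"
  shows "perm_sign x0 x1 x2 x3 x4 x5 x6 x7 * b x4 x5 x6 x7 = b x0 x1 x2 x3"
  using assms
proof (induction "perm_code x0 x1 x2 x3 x4 x5 x6 x7" arbitrary: x0 x1 x2 x3 x4 x5 x6 x7 rule: less_induct)
  case less
  note IH = less.hyps and dist = less.prems(1) and range = less.prems(2)
  have c10: ?case if "x1 < x0"
  proof -
    have "perm_sign x1 x0 x2 x3 x4 x5 x6 x7 * b x4 x5 x6 x7 = b x1 x0 x2 x3"
      by (rule IH) (use dist range that in \<open>auto simp: perm_code_def\<close>)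
    moreover have "perm_sign x1 x0 x2 x3 x4 x5 x6 x7 = - perm_sign x0 x1 x2 x3 x4 x5 x6 x7"
      by (rule perm_sign_swap) (use that in simp)
    ultimately show ?thesis by (simp add: s1[of x0 x1 x2 x3])
  qed
  have c11: ?case if "x2 < x1"
  proof -
    have "perm_sign x0 x2 x1 x3 x4 x5 x6 x7 * b x4 x5 x6 x7 = b x0 x2 x1 x3"
      by (rule IH) (use dist range that in \<open>auto simp: perm_code_def\<close>)
    moreover have "perm_sign x0 x2 x1 x3 x4 x5 x6 x7 = - perm_sign x0 x1 x2 x3 x4 x5 x6 x7"
      by (rule perm_sign_swap) (use that in simp)
    ultimately show ?thesis by (simp add: s2[of x0 x1 x2 x3])
  qed
  have c12: ?case if "x3 < x2"
  proof -
    have "perm_sign x0 x1 x3 x2 x4 x5 x6 x7 * b x4 x5 x6 x7 = b x0 x1 x3 x2"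
      by (rule IH) (use dist range that in \<open>auto simp: perm_code_def\<close>)
    moreover have "perm_sign x0 x1 x3 x2 x4 x5 x6 x7 = - perm_sign x0 x1 x2 x3 x4 x5 x6 x7"
      by (rule perm_sign_swap) (use that in simp)
    ultimately show ?thesis by (simp add: s3[of x0 x1 x2 x3])
  qed
  have c14: ?case if "x5 < x4"
  proof -
    have "perm_sign x0 x1 x2 x3 x5 x4 x6 x7 * b x5 x4 x6 x7 = b x0 x1 x2 x3"
      by (rule IH) (use dist range that in \<open>auto simp: perm_code_def\<close>)
    moreover have "perm_sign x0 x1 x2 x3 x5 x4 x6 x7 = - perm_sign x0 x1 x2 x3 x4 x5 x6 x7"
      by (rule perm_sign_swap) (use that in simp)
    ultimately show ?thesis by (simp add: s1[of x4 x5 x6 x7])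
  qed
  have c15: ?case if "x6 < x5"
  proof -
    have "perm_sign x0 x1 x2 x3 x4 x6 x5 x7 * b x4 x6 x5 x7 = b x0 x1 x2 x3"
      by (rule IH) (use dist range that in \<open>auto simp: perm_code_def\<close>)
    moreover have "perm_sign x0 x1 x2 x3 x4 x6 x5 x7 = - perm_sign x0 x1 x2 x3 x4 x5 x6 x7"
      by (rule perm_sign_swap) (use that in simp)
    ultimately show ?thesis by (simp add: s2[of x4 x5 x6 x7])
  qed
  have c16: ?case if "x7 < x6"
  proof -
    have "perm_sign x0 x1 x2 x3 x4 x5 x7 x6 * b x4 x5 x7 x6 = b x0 x1 x2 x3"
      by (rule IH) (use dist range that in \<open>auto simp: perm_code_def\<close>)
    moreover have "perm_sign x0 x1 x2 x3 x4 x5 x7 x6 = - perm_sign x0 x1 x2 x3 x4 x5 x6 x7"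
      by (rule perm_sign_swap) (use that in simp)
    ultimately show ?thesis by (simp add: s3[of x4 x5 x6 x7])
  qed
  have c20: ?case if "x4 < x0"
  proof -
    have "x1 < 8" "x2 < 8" "x3 < 8" "x5 < 8" "x6 < 8" "x7 < 8" using range by auto
    then have "perm_sign x4 x5 x6 x7 x0 x1 x2 x3 * b x0 x1 x2 x3 = b x4 x5 x6 x7"
      by (intro IH) (use dist range that in \<open>auto simp: perm_code_def\<close>)
    then have "perm_sign x0 x1 x2 x3 x4 x5 x6 x7 * b x0 x1 x2 x3 = b x4 x5 x6 x7"
      using perm_sign_block_swap[OF dist] by simp
    then have "perm_sign x0 x1 x2 x3 x4 x5 x6 x7 * b x4 x5 x6 x7 = (perm_sign x0 x1 x2 x3 x4 x5 x6 x7 * perm_sign x0 x1 x2 x3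
        x4 x5 x6 x7) * b x0 x1 x2 x3"
      by (simp add: mult.assoc)
    then show ?thesis unfolding perm_sign_square by simp
  qed
  show ?case
  proof (cases "x1 < x0 \<or> x2 < x1 \<or> x3 < x2 \<or> x5 < x4 \<or> x6 < x5 \<or> x7 < x6 \<or> x4 < x0")
    case True
    then show ?thesis using c10 c11 c12 c14 c15 c16 c20 by blast
  next
    case False
    then have o: "x0 < x1" "x1 < x2" "x2 < x3" "x4 < x5" "x5 < x6" "x6 < x7" "x0 < x4"
      using dist by (simp_all add: not_less le_less)
    have "card (set [x0, x1, x2, x3, x4, x5, x6, x7]) = 8" by (simp only: distinct_card[OF dist] list.size)
    then have "set [x0, x1, x2, x3, x4, x5, x6, x7] = {..<8}"
      using range by (intro card_subset_eq) auto
    then have "0 \<in> set [x0, x1, x2, x3, x4, x5, x6, x7]" by simp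
    then have 0: "x0 = 0" using o by auto
    have "(x1, x2, x3, x4, x5, x6, x7) \<in> set [(1,2,3,4,5,6,7), (1,2,4,3,5,6,7), (1,2,5,3,4,6,7), (1,2,6,3,4,5,7),
        (1,2,7,3,4,5,6), (1,3,4,2,5,6,7), (1,3,5,2,4,6,7), (1,3,6,2,4,5,7), (1,3,7,2,4,5,6), (1,4,5,2,3,6,7), (1,4,6,2,3,5,7),
            (1,4,7,2,3,5,6), (1,5,6,2,3,4,7), (1,5,7,2,3,4,6), (1,6,7,2,3,4,5), (2,3,4,1,5,6,7), (2,3,5,1,4,6,7),
            (2,3,6,1,4,5,7), (2,3,7,1,4,5,6), (2,4,5,1,3,6,7), (2,4,6,1,3,5,7), (2,4,7,1,3,5,6), (2,5,6,1,3,4,7),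
            (2,5,7,1,3,4,6), (2,6,7,1,3,4,5), (3,4,5,1,2,6,7), (3,4,6,1,2,5,7), (3,4,7,1,2,5,6), (3,5,6,1,2,4,7),
            (3,5,7,1,2,4,6), (3,6,7,1,2,4,5), (4,5,6,1,2,3,7), (4,5,7,1,2,3,6), (4,6,7,1,2,3,5), (5,6,7,1,2,3,4)]"
      by (rule shuffles_3_4) (use o dist range 0 in auto)
    then show ?thesis unfolding 0 by (rule dual_components)
  qed
qed

end

lemma pfaffian_terms_nonneg:
  fixes F :: "nat \<Rightarrow> nat \<Rightarrow> real"
  assumes F: "\<And>x y. F y x = - F x y" "\<And>x y. x < y \<Longrightarrow> y < 8 \<Longrightarrow> F x y = (if even x \<and>
      y = Suc x then c else 0)"
    and "distinct [x0, x1, x2, x3, x4, x5, x6, x7]" "set [x0, x1, x2, x3, x4, x5, x6, x7] \<subseteq> {..<8}"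
  shows "perm_sign x0 x1 x2 x3 x4 x5 x6 x7 * (F x0 x1 * F x2 x3 * F x4 x5 * F x6 x7) \<ge> 0"
  using assms(3,4)
proof (induction "perm_code x0 x1 x2 x3 x4 x5 x6 x7" arbitrary: x0 x1 x2 x3 x4 x5 x6 x7 rule: less_induct)
  case less
  note IH = less.hyps and dist = less.prems(1) and range = less.prems(2)
  have r: "x0 < 8" "x1 < 8" "x2 < 8" "x3 < 8" "x4 < 8" "x5 < 8" "x6 < 8" "x7 < 8" using range by auto
  have c10: ?case if "x1 < x0"
  proof -
    have "perm_sign x1 x0 x2 x3 x4 x5 x6 x7 * (F x1 x0 * F x2 x3 * F x4 x5 * F x6 x7) \<ge> 0"
      by (rule IH) (use dist range that in \<open>auto simp: perm_code_def\<close>)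
    moreover have "perm_sign x1 x0 x2 x3 x4 x5 x6 x7 = - perm_sign x0 x1 x2 x3 x4 x5 x6 x7"
      by (rule perm_sign_swap) (use that in simp)
    ultimately show ?thesis using F(1)[of x0 x1] by simp
  qed
  have c12: ?case if "x3 < x2"
  proof -
    have "perm_sign x0 x1 x3 x2 x4 x5 x6 x7 * (F x0 x1 * F x3 x2 * F x4 x5 * F x6 x7) \<ge> 0"
      by (rule IH) (use dist range that in \<open>auto simp: perm_code_def\<close>)
    moreover have "perm_sign x0 x1 x3 x2 x4 x5 x6 x7 = - perm_sign x0 x1 x2 x3 x4 x5 x6 x7"
      by (rule perm_sign_swap) (use that in simp)
    ultimately show ?thesis using F(1)[of x2 x3] by simp
  qed
  have c14: ?case if "x5 < x4"
  proof -
    have "perm_sign x0 x1 x2 x3 x5 x4 x6 x7 * (F x0 x1 * F x2 x3 * F x5 x4 * F x6 x7) \<ge> 0"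
      by (rule IH) (use dist range that in \<open>auto simp: perm_code_def\<close>)
    moreover have "perm_sign x0 x1 x2 x3 x5 x4 x6 x7 = - perm_sign x0 x1 x2 x3 x4 x5 x6 x7"
      by (rule perm_sign_swap) (use that in simp)
    ultimately show ?thesis using F(1)[of x4 x5] by simp
  qed
  have c16: ?case if "x7 < x6"
  proof -
    have "perm_sign x0 x1 x2 x3 x4 x5 x7 x6 * (F x0 x1 * F x2 x3 * F x4 x5 * F x7 x6) \<ge> 0"
      by (rule IH) (use dist range that in \<open>auto simp: perm_code_def\<close>)
    moreover have "perm_sign x0 x1 x2 x3 x4 x5 x7 x6 = - perm_sign x0 x1 x2 x3 x4 x5 x6 x7"
      by (rule perm_sign_swap) (use that in simp)
    ultimately show ?thesis using F(1)[of x6 x7] by simp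
  qed
  have d0: ?case if "x2 < x0"
  proof -
    have "perm_sign x2 x3 x0 x1 x4 x5 x6 x7 * (F x2 x3 * F x0 x1 * F x4 x5 * F x6 x7) \<ge> 0"
      by (rule IH) (use dist range r that in \<open>auto simp: perm_code_def\<close>)
    then show ?thesis using perm_sign_pair_swap(1)[OF dist] by (simp add: mult_ac)
  qed
  have d1: ?case if "x4 < x2"
  proof -
    have "perm_sign x0 x1 x4 x5 x2 x3 x6 x7 * (F x0 x1 * F x4 x5 * F x2 x3 * F x6 x7) \<ge> 0"
      by (rule IH) (use dist range r that in \<open>auto simp: perm_code_def\<close>)
    then show ?thesis using perm_sign_pair_swap(2)[OF dist] by (simp add: mult_ac)
  qed
  have d2: ?case if "x6 < x4"
  proof -
    have "perm_sign x0 x1 x2 x3 x6 x7 x4 x5 * (F x0 x1 * F x2 x3 * F x6 x7 * F x4 x5) \<ge> 0"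
      by (rule IH) (use dist range r that in \<open>auto simp: perm_code_def\<close>)
    then show ?thesis using perm_sign_pair_swap(3)[OF dist] by (simp add: mult_ac)
  qed
  show ?case
  proof (cases "x1 < x0 \<or> x3 < x2 \<or> x5 < x4 \<or> x7 < x6 \<or> x2 < x0 \<or> x4 < x2 \<or> x6 < x4
      \<or> F x0 x1 * F x2 x3 * F x4 x5 * F x6 x7 = 0")
    case True
    then show ?thesis using c10 c12 c14 c16 d0 d1 d2 by fastforce
  next
    case False
    then have o: "x0 < x1" "x2 < x3" "x4 < x5" "x6 < x7" "x0 < x2" "x2 < x4" "x4 < x6"
      and nz: "F x0 x1 \<noteq> 0" "F x2 x3 \<noteq> 0" "F x4 x5 \<noteq> 0" "F x6 x7 \<noteq> 0"
      using dist by (simp_all add: not_less le_less)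
    then have e: "even x0" "even x2" "even x4" "even x6" "x1 = Suc x0" "x3 = Suc x2" "x5 = Suc x4" "x7 = Suc x6"
      using F(2) r by (metis (full_types))+
    then have "x0 = 0" "x2 = 2" "x4 = 4" "x6 = 6"
      using o r unfolding even_iff_mod_2_eq_zero by presburger+
    with e have x: "x0 = 0" "x1 = 1" "x2 = 2" "x3 = 3" "x4 = 4" "x5 = 5" "x6 = 6" "x7 = 7" by auto
    show ?thesis unfolding x using zero_le_square[of "c * c"] by (simp add: perm_sign_def order_sign_def F(2) mult.assoc)
  qed
qed

subsection \<open>Permutations of the index type\<close>

lemma exhaust_8:
  fixes x :: 8
  shows "x = 0 \<or> x = 1 \<or> x = 2 \<or> x = 3 \<or> x = 4 \<or> x = 5 \<or> x = 6 \<or> x = 7"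
proof (induct x)
  case (of_int z)
  then have "0 \<le> z" and "z < 8" by simp_all
  then have "z = 0 \<or> z = 1 \<or> z = 2 \<or> z = 3 \<or> z = 4 \<or> z = 5 \<or> z = 6 \<or> z = 7" by arith
  then show ?case by auto
qed

lemma UNIV_8: "(UNIV :: 8 set) = {0, 1, 2, 3, 4, 5, 6, 7}"
  using exhaust_8 by auto

lemma sum_8: "sum f (UNIV :: 8 set) = f 0 + f 1 + f 2 + f 3 + f 4 + f 5 + f 6 + f 7"
  unfolding UNIV_8 by (simp add: add_ac)

definition nat_of_8 :: "8 \<Rightarrow> nat" where
  "nat_of_8 x = (if x = 0 then 0 else if x = 1 then 1 else if x = 2 then 2 else if x = 3 then 3
    else if x = 4 then 4 else if x = 5 then 5 else if x = 6 then 6 else 7)"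

lemma of_nat_of_8: "of_nat (nat_of_8 x) = x"
  using exhaust_8[of x] by (auto simp: nat_of_8_def)

lemma nat_of_8_less: "nat_of_8 x < 8"
  by (simp add: nat_of_8_def)

lemma nat_of_8_inject: "nat_of_8 x = nat_of_8 y \<longleftrightarrow> x = y"
  by (metis of_nat_of_8)

abbreviation perm_sign_of :: "(8 \<Rightarrow> 8) \<Rightarrow> real" where
  "perm_sign_of p \<equiv> perm_sign (nat_of_8 (p 0)) (nat_of_8 (p 1)) (nat_of_8 (p 2)) (nat_of_8 (p 3))
    (nat_of_8 (p 4)) (nat_of_8 (p 5)) (nat_of_8 (p 6)) (nat_of_8 (p 7))"

lemma perm_8_distinct:
  assumes "p permutes (UNIV :: 8 set)"
  shows "distinct [nat_of_8 (p 0), nat_of_8 (p 1), nat_of_8 (p 2), nat_of_8 (p 3),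
    nat_of_8 (p 4), nat_of_8 (p 5), nat_of_8 (p 6), nat_of_8 (p 7)]"
  using permutes_inj[OF assms] by (simp add: nat_of_8_inject inj_eq)

lemma sign_eq_perm_sign:
  assumes "p permutes (UNIV :: 8 set)"
  shows "real_of_int (sign p) = perm_sign_of p"
  using assms
proof (induction "perm_code (nat_of_8 (p 0)) (nat_of_8 (p 1)) (nat_of_8 (p 2)) (nat_of_8 (p 3))
    (nat_of_8 (p 4)) (nat_of_8 (p 5)) (nat_of_8 (p 6)) (nat_of_8 (p 7))" arbitrary: p rule: less_induct)
  case less
  note IH = less.hyps and p = less.prems
  note dist = perm_8_distinct[OF p]
  have c0: ?case if lt: "nat_of_8 (p 1) < nat_of_8 (p 0)"
  proof -
    let ?t = "Transposition.transpose (0::8) 1"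
    have t: "?t permutes UNIV" by (simp add: permutes_swap_id)
    have "real_of_int (sign (p \<circ> ?t)) = perm_sign_of (p \<circ> ?t)"
      by (rule IH) (use lt permutes_compose[OF t p] in \<open>simp_all add: perm_code_def\<close>)
    moreover have "sign (p \<circ> ?t) = - sign p"
      using sign_compose_UNIV[OF p t] by (simp add: sign_swap_id)
    moreover have "perm_sign_of (p \<circ> ?t) = - perm_sign_of p"
    proof -
      have "perm_sign (nat_of_8 (p 1)) (nat_of_8 (p 0)) (nat_of_8 (p 2)) (nat_of_8 (p 3)) (nat_of_8 (p 4)) (nat_of_8 (p 5))
          (nat_of_8 (p 6)) (nat_of_8 (p 7)) = - perm_sign_of p"
        by (rule perm_sign_swap) (use lt in simp)
      then show ?thesis by simp
    qed
    ultimately show ?thesis by simp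
  qed
  have c1: ?case if lt: "nat_of_8 (p 2) < nat_of_8 (p 1)"
  proof -
    let ?t = "Transposition.transpose (1::8) 2"
    have t: "?t permutes UNIV" by (simp add: permutes_swap_id)
    have "real_of_int (sign (p \<circ> ?t)) = perm_sign_of (p \<circ> ?t)"
      by (rule IH) (use lt permutes_compose[OF t p] in \<open>simp_all add: perm_code_def\<close>)
    moreover have "sign (p \<circ> ?t) = - sign p"
      using sign_compose_UNIV[OF p t] by (simp add: sign_swap_id)
    moreover have "perm_sign_of (p \<circ> ?t) = - perm_sign_of p"
    proof -
      have "perm_sign (nat_of_8 (p 0)) (nat_of_8 (p 2)) (nat_of_8 (p 1)) (nat_of_8 (p 3)) (nat_of_8 (p 4)) (nat_of_8 (p 5))
          (nat_of_8 (p 6)) (nat_of_8 (p 7)) = - perm_sign_of p"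
        by (rule perm_sign_swap) (use lt in simp)
      then show ?thesis by simp
    qed
    ultimately show ?thesis by simp
  qed
  have c2: ?case if lt: "nat_of_8 (p 3) < nat_of_8 (p 2)"
  proof -
    let ?t = "Transposition.transpose (2::8) 3"
    have t: "?t permutes UNIV" by (simp add: permutes_swap_id)
    have "real_of_int (sign (p \<circ> ?t)) = perm_sign_of (p \<circ> ?t)"
      by (rule IH) (use lt permutes_compose[OF t p] in \<open>simp_all add: perm_code_def\<close>)
    moreover have "sign (p \<circ> ?t) = - sign p"
      using sign_compose_UNIV[OF p t] by (simp add: sign_swap_id)
    moreover have "perm_sign_of (p \<circ> ?t) = - perm_sign_of p"
    proof -
      have "perm_sign (nat_of_8 (p 0)) (nat_of_8 (p 1)) (nat_of_8 (p 3)) (nat_of_8 (p 2)) (nat_of_8 (p 4)) (nat_of_8 (p 5))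
          (nat_of_8 (p 6)) (nat_of_8 (p 7)) = - perm_sign_of p"
        by (rule perm_sign_swap) (use lt in simp)
      then show ?thesis by simp
    qed
    ultimately show ?thesis by simp
  qed
  have c3: ?case if lt: "nat_of_8 (p 4) < nat_of_8 (p 3)"
  proof -
    let ?t = "Transposition.transpose (3::8) 4"
    have t: "?t permutes UNIV" by (simp add: permutes_swap_id)
    have "real_of_int (sign (p \<circ> ?t)) = perm_sign_of (p \<circ> ?t)"
      by (rule IH) (use lt permutes_compose[OF t p] in \<open>simp_all add: perm_code_def\<close>)
    moreover have "sign (p \<circ> ?t) = - sign p"
      using sign_compose_UNIV[OF p t] by (simp add: sign_swap_id)
    moreover have "perm_sign_of (p \<circ> ?t) = - perm_sign_of p"
    proof -
      have "perm_sign (nat_of_8 (p 0)) (nat_of_8 (p 1)) (nat_of_8 (p 2)) (nat_of_8 (p 4)) (nat_of_8 (p 3)) (nat_of_8 (p 5))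
          (nat_of_8 (p 6)) (nat_of_8 (p 7)) = - perm_sign_of p"
        by (rule perm_sign_swap) (use lt in simp)
      then show ?thesis by simp
    qed
    ultimately show ?thesis by simp
  qed
  have c4: ?case if lt: "nat_of_8 (p 5) < nat_of_8 (p 4)"
  proof -
    let ?t = "Transposition.transpose (4::8) 5"
    have t: "?t permutes UNIV" by (simp add: permutes_swap_id)
    have "real_of_int (sign (p \<circ> ?t)) = perm_sign_of (p \<circ> ?t)"
      by (rule IH) (use lt permutes_compose[OF t p] in \<open>simp_all add: perm_code_def\<close>)
    moreover have "sign (p \<circ> ?t) = - sign p"
      using sign_compose_UNIV[OF p t] by (simp add: sign_swap_id)
    moreover have "perm_sign_of (p \<circ> ?t) = - perm_sign_of p"
    proof -
      have "perm_sign (nat_of_8 (p 0)) (nat_of_8 (p 1)) (nat_of_8 (p 2)) (nat_of_8 (p 3)) (nat_of_8 (p 5)) (nat_of_8 (p 4))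
          (nat_of_8 (p 6)) (nat_of_8 (p 7)) = - perm_sign_of p"
        by (rule perm_sign_swap) (use lt in simp)
      then show ?thesis by simp
    qed
    ultimately show ?thesis by simp
  qed
  have c5: ?case if lt: "nat_of_8 (p 6) < nat_of_8 (p 5)"
  proof -
    let ?t = "Transposition.transpose (5::8) 6"
    have t: "?t permutes UNIV" by (simp add: permutes_swap_id)
    have "real_of_int (sign (p \<circ> ?t)) = perm_sign_of (p \<circ> ?t)"
      by (rule IH) (use lt permutes_compose[OF t p] in \<open>simp_all add: perm_code_def\<close>)
    moreover have "sign (p \<circ> ?t) = - sign p"
      using sign_compose_UNIV[OF p t] by (simp add: sign_swap_id)
    moreover have "perm_sign_of (p \<circ> ?t) = - perm_sign_of p"
    proof -
      have "perm_sign (nat_of_8 (p 0)) (nat_of_8 (p 1)) (nat_of_8 (p 2)) (nat_of_8 (p 3)) (nat_of_8 (p 4)) (nat_of_8 (p 6))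
          (nat_of_8 (p 5)) (nat_of_8 (p 7)) = - perm_sign_of p"
        by (rule perm_sign_swap) (use lt in simp)
      then show ?thesis by simp
    qed
    ultimately show ?thesis by simp
  qed
  have c6: ?case if lt: "nat_of_8 (p 7) < nat_of_8 (p 6)"
  proof -
    let ?t = "Transposition.transpose (6::8) 7"
    have t: "?t permutes UNIV" by (simp add: permutes_swap_id)
    have "real_of_int (sign (p \<circ> ?t)) = perm_sign_of (p \<circ> ?t)"
      by (rule IH) (use lt permutes_compose[OF t p] in \<open>simp_all add: perm_code_def\<close>)
    moreover have "sign (p \<circ> ?t) = - sign p"
      using sign_compose_UNIV[OF p t] by (simp add: sign_swap_id)
    moreover have "perm_sign_of (p \<circ> ?t) = - perm_sign_of p"
    proof -
      have "perm_sign (nat_of_8 (p 0)) (nat_of_8 (p 1)) (nat_of_8 (p 2)) (nat_of_8 (p 3)) (nat_of_8 (p 4)) (nat_of_8 (p 5))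
          (nat_of_8 (p 7)) (nat_of_8 (p 6)) = - perm_sign_of p"
        by (rule perm_sign_swap) (use lt in simp)
      then show ?thesis by simp
    qed
    ultimately show ?thesis by simp
  qed
  show ?case
  proof (cases "nat_of_8 (p 1) < nat_of_8 (p 0) \<or> nat_of_8 (p 2) < nat_of_8 (p 1) \<or> nat_of_8 (p 3) < nat_of_8 (p 2)
      \<or> nat_of_8 (p 4) < nat_of_8 (p 3) \<or> nat_of_8 (p 5) < nat_of_8 (p 4) \<or> nat_of_8 (p 6) < nat_of_8 (p 5) \<or>
          nat_of_8 (p 7) < nat_of_8 (p 6)")
    case True
    then show ?thesis using c0 c1 c2 c3 c4 c5 c6 by blast
  next
    case False
    then have o: "nat_of_8 (p 0) < nat_of_8 (p 1)" "nat_of_8 (p 1) < nat_of_8 (p 2)" "nat_of_8 (p 2) < nat_of_8 (p 3)"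
        "nat_of_8 (p 3) < nat_of_8 (p 4)" "nat_of_8 (p 4) < nat_of_8 (p 5)" "nat_of_8 (p 5) < nat_of_8 (p 6)" "nat_of_8 (p 6) < nat_of_8 (p 7)"
      using dist by (simp_all add: not_less le_less)
    have less: "nat_of_8 (p i) < 8" for i by (rule nat_of_8_less)
    have v: "nat_of_8 (p 0) = 0" "nat_of_8 (p 1) = 1" "nat_of_8 (p 2) = 2" "nat_of_8 (p 3) = 3" "nat_of_8 (p 4) = 4" "nat_of_8
        (p 5) = 5" "nat_of_8 (p 6) = 6" "nat_of_8 (p 7) = 7"
      using o less[of 0] less[of 1] less[of 2] less[of 3] less[of 4] less[of 5] less[of 6] less[of 7] by linarith+
    have "p i = of_nat (nat_of_8 (p i))" for i by (simp add: of_nat_of_8)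
    then have "p i = i" for i
      using exhaust_8[of i] v by (metis of_nat_0 of_nat_1 of_nat_numeral)
    then have "p = id" by auto
    then show ?thesis unfolding v by (simp add: sign_id perm_sign_def order_sign_def)
  qed
qed

subsection \<open>Hyperhermitian linear algebra\<close>

definition linear3 :: "('v::real_vector \<Rightarrow> 'v \<Rightarrow> 'v \<Rightarrow> real) \<Rightarrow> bool" where
  "linear3 t \<longleftrightarrow> (\<forall>b c. linear (\<lambda>a. t a b c)) \<and> (\<forall>a c. linear (\<lambda>b. t a b
      c)) \<and> (\<forall>a b. linear (\<lambda>c. t a b c))"

definition linear4 :: "('v::real_vector \<Rightarrow> 'v \<Rightarrow> 'v \<Rightarrow> 'v \<Rightarrow> real) \<Rightarrow> bool" where
  "linear4 t \<longleftrightarrow> (\<forall>b c d. linear (\<lambda>a. t a b c d)) \<and> (\<forall>a c d. linear (\<lambda>b. t a b c d)) \<and>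
    (\<forall>a b d. linear (\<lambda>c. t a b c d)) \<and> (\<forall>a b c. linear (\<lambda>d. t a b c d))"

definition alternating4 :: "('v \<Rightarrow> 'v \<Rightarrow> 'v \<Rightarrow> 'v \<Rightarrow> real) \<Rightarrow> bool" where
  "alternating4 t \<longleftrightarrow> (\<forall>a b c d. t b a c d = - t a b c d \<and> t a c b d = - t a b c d \<and> t a b d c = - t a b c d)"

text \<open>Evaluations on an 8-frame \<open>Q\<close> of the top-degree forms \<open>\<beta> \<and> \<beta>\<close>,
    \<open>F\<^sup>4\<close> and \<open>h \<and> t \<and> \<beta>\<close>, up to constant factors.\<close>

definition wedge44 :: "('v \<Rightarrow> 'v \<Rightarrow> 'v \<Rightarrow> 'v \<Rightarrow> real) \<Rightarrow> (8
    \<Rightarrow> 'v) \<Rightarrow> real" where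
  "wedge44 \<beta> Q = asum (\<lambda>p. \<beta> (Q (p 0)) (Q (p 1)) (Q (p 2)) (Q (p 3)) * \<beta> (Q (p 4)) (Q (p 5)) (Q (p 6)) (Q (p 7)))"

definition wedge2222 :: "('v \<Rightarrow> 'v \<Rightarrow> real) \<Rightarrow> (8 \<Rightarrow> 'v) \<Rightarrow> real" where
  "wedge2222 F Q = asum (\<lambda>p. F (Q (p 0)) (Q (p 1)) * F (Q (p 2)) (Q (p 3)) * F (Q (p 4)) (Q (p 5)) * F (Q (p 6)) (Q (p 7)))"

definition wedge134 :: "('v \<Rightarrow> real) \<Rightarrow> ('v \<Rightarrow> 'v \<Rightarrow> 'v \<Rightarrow> real)
    \<Rightarrow> ('v \<Rightarrow> 'v \<Rightarrow> 'v \<Rightarrow> 'v \<Rightarrow> real) \<Rightarrow> (8 \<Rightarrow> 'v)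
        \<Rightarrow> real" where
  "wedge134 h t \<beta> Q = asum (\<lambda>p. h (Q (p 0)) * t (Q (p 1)) (Q (p 2)) (Q (p 3)) * \<beta> (Q (p 4)) (Q (p 5)) (Q (p 6)) (Q (p 7)))"

lemma linear_mult_const: "linear f \<Longrightarrow> linear (\<lambda>v. f v * (c::real))" "linear f \<Longrightarrow> linear
    (\<lambda>v. c * f v :: real)"
  by (auto intro!: linearI simp: linear_add linear_scale algebra_simps)

lemma wedge44_det:
  fixes A :: "real^8^8"
  assumes "linear4 \<beta>"
  shows "wedge44 \<beta> (\<lambda>i. A $ i) = det A * wedge44 \<beta> (\<lambda>i. axis i 1)"
proof -
  have "multilinear (\<lambda>x :: 8 \<Rightarrow> real^8. \<beta> (x 0) (x 1) (x 2) (x 3) * \<beta> (x 4) (x 5) (x 6) (x 7))"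
    unfolding multilinear_def
  proof (intro allI)
    fix x :: "8 \<Rightarrow> real^8" and i :: 8
    show "linear (\<lambda>v. \<beta> ((x(i := v)) 0) ((x(i := v)) 1) ((x(i := v)) 2) ((x(i := v)) 3)
      * \<beta> ((x(i := v)) 4) ((x(i := v)) 5) ((x(i := v)) 6) ((x(i := v)) 7))"
      using exhaust_8[of i] assms
      by (elim disjE) (simp_all add: linear4_def linear_mult_const)
  qed
  from asum_multilinear_det[OF this, of A] show ?thesis by (simp add: wedge44_def)
qed

lemma wedge134_det:
  fixes A :: "real^8^8"
  assumes "linear h" "linear3 t" "linear4 \<beta>"
  shows "wedge134 h t \<beta> (\<lambda>i. A $ i) = det A * wedge134 h t \<beta> (\<lambda>i. axis i 1)"
proof -
  have "multilinear (\<lambda>x :: 8 \<Rightarrow> real^8. h (x 0) * t (x 1) (x 2) (x 3) * \<beta> (x 4) (x 5) (x 6) (x 7))"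
    unfolding multilinear_def
  proof (intro allI)
    fix x :: "8 \<Rightarrow> real^8" and i :: 8
    show "linear (\<lambda>v. h ((x(i := v)) 0) * t ((x(i := v)) 1) ((x(i := v)) 2) ((x(i := v)) 3)
      * \<beta> ((x(i := v)) 4) ((x(i := v)) 5) ((x(i := v)) 6) ((x(i := v)) 7))"
      using exhaust_8[of i] assms
      by (elim disjE) (simp_all add: linear3_def linear4_def linear_mult_const)
  qed
  from asum_multilinear_det[OF this, of A] show ?thesis by (simp add: wedge134_def)
qed

lemma wedge2222_det:
  fixes A :: "real^8^8"
  assumes "\<And>v. linear (\<lambda>u. F u v)" "\<And>u. linear (\<lambda>v. F u v)"
  shows "wedge2222 F (\<lambda>i. A $ i) = det A * wedge2222 F (\<lambda>i. axis i 1)"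
proof -
  have "multilinear (\<lambda>x :: 8 \<Rightarrow> real^8. F (x 0) (x 1) * F (x 2) (x 3) * F (x 4) (x 5) * F (x 6) (x 7))"
    unfolding multilinear_def
  proof (intro allI)
    fix x :: "8 \<Rightarrow> real^8" and i :: 8
    show "linear (\<lambda>v. F ((x(i := v)) 0) ((x(i := v)) 1) * F ((x(i := v)) 2) ((x(i := v)) 3)
      * F ((x(i := v)) 4) ((x(i := v)) 5) * F ((x(i := v)) 6) ((x(i := v)) 7))"
      using exhaust_8[of i] 
      by (elim disjE) (simp_all add: assms linear_mult_const)
  qed
  from asum_multilinear_det[OF this, of A] show ?thesis by (simp add: wedge2222_def)
qed

lemma permutation_8_extends:
  fixes i j k l :: 8
  assumes "distinct [i, j, k, l]"
  obtains p where "p permutes UNIV" "p 0 = i" "p 1 = j" "p 2 = k" "p 3 = l"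
proof -
  have step: "\<exists>q'. q' permutes UNIV \<and> q' m = j \<and> (\<forall>n. n \<noteq> m \<and> q n \<noteq> j \<longrightarrow> q' n = q n)"
    if q: "q permutes UNIV" for q :: "8 \<Rightarrow> 8" and m j
  proof (intro exI conjI)
    show "Transposition.transpose (q m) j \<circ> q permutes UNIV"
      by (intro permutes_compose[OF q] permutes_swap_id) auto
  qed (use permutes_inj[OF q] in \<open>auto simp: inj_eq\<close>)
  obtain p0 :: "8 \<Rightarrow> 8" where p0: "p0 permutes UNIV" "p0 0 = i"
    using step[OF permutes_id, of 0 i] by auto
  obtain p1 where p1: "p1 permutes UNIV" "p1 1 = j" "\<And>n. n \<noteq> 1 \<Longrightarrow> p0 n \<noteq> j \<Longrightarrow> p1 n = p0 n"
    using step[OF p0(1), of 1 j] by auto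
  obtain p2 where p2: "p2 permutes UNIV" "p2 2 = k" "\<And>n. n \<noteq> 2 \<Longrightarrow> p1 n \<noteq> k \<Longrightarrow> p2 n = p1 n"
    using step[OF p1(1), of 2 k] by auto
  obtain p3 where p3: "p3 permutes UNIV" "p3 3 = l" "\<And>n. n \<noteq> 3 \<Longrightarrow> p2 n \<noteq> l \<Longrightarrow> p3 n = p2 n"
    using step[OF p2(1), of 3 l] by auto
  have "p1 0 = i" using p1(3)[of 0] p0 assms by simp
  moreover then have "p2 0 = i" "p2 1 = j" using p2(3)[of 0] p2(3)[of 1] p1 assms by simp_all
  ultimately have "p3 0 = i" "p3 1 = j" "p3 2 = k"
    using p3(3)[of 0] p3(3)[of 1] p3(3)[of 2] p2 assms by simp_all
  then show ?thesis using p3 by (intro that)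
qed

locale hyperhermitian =
  fixes G :: "real^8 \<Rightarrow> real^8 \<Rightarrow> real" and J1 J2 J3 :: "real^8 \<Rightarrow> real^8"
  assumes G_linear: "linear (\<lambda>u. G u v)" and G_sym: "G u v = G v u" and G_pos: "u \<noteq> 0 \<Longrightarrow> G u u > 0"
    and J_linear: "linear J1" "linear J2" "linear J3"
    and J_square: "J1 (J1 u) = - u" "J2 (J2 u) = - u" "J3 (J3 u) = - u"
    and J12: "J1 (J2 u) = J3 u" and J21: "J2 (J1 u) = - J3 u"
    and G_J: "G (J1 u) (J1 v) = G u v" "G (J2 u) (J2 v) = G u v" "G (J3 u) (J3 v) = G u v"
begin

lemma G_linear2: "linear (\<lambda>v. G u v)"
  using G_linear[of u] by (simp add: G_sym[of _ u])

lemma G_add: "G (u + v) w = G u w + G v w" "G u (v + w) = G u v + G u w"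
  and G_scale: "G (r *\<^sub>R u) w = r * G u w" "G u (r *\<^sub>R w) = r * G u w"
  and G_minus: "G (- u) w = - G u w" "G u (- w) = - G u w"
  and G_diff: "G (u - v) w = G u w - G v w" "G u (v - w) = G u v - G u w"
  and G_zero: "G 0 w = 0" "G u 0 = 0"
  using linear_add[OF G_linear] linear_add[OF G_linear2] linear_scale[OF G_linear] linear_scale[OF G_linear2]
    linear_neg[OF G_linear] linear_neg[OF G_linear2] linear_diff[OF G_linear] linear_diff[OF G_linear2]
    linear_0[OF G_linear] linear_0[OF G_linear2]
  by simp_all

lemma G_sum: "G (\<Sum>i\<in>I. f i) w = (\<Sum>i\<in>I. G (f i) w)" "G w (\<Sum>i\<in>I. f i) = (\<Sum>i\<in>I. G w (f i))"
  using linear_sum[OF G_linear] linear_sum[OF G_linear2] by simp_all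

lemma J_minus: "J1 (- u) = - J1 u" "J2 (- u) = - J2 u" "J3 (- u) = - J3 u"
  by (rule linear_neg[OF J_linear(1)], rule linear_neg[OF J_linear(2)], rule linear_neg[OF J_linear(3)])

lemma J_products:
  "J1 (J3 u) = - J2 u" "J3 (J1 u) = J2 u" "J2 (J3 u) = J1 u" "J3 (J2 u) = - J1 u"
proof -
  show a: "J1 (J3 u) = - J2 u" by (simp only: J12[symmetric] J_square)
  have "J3 (J1 u) = J1 (J2 (J1 u))" by (simp only: J12)
  also have "\<dots> = J2 u" by (simp only: J21 J_minus a minus_minus)
  finally show "J3 (J1 u) = J2 u" .
  show b: "J3 (J2 u) = - J1 u" by (simp only: J12[symmetric] J_square J_minus)
  have "J2 (J3 u) = J2 (J1 (J2 u))" by (simp only: J12)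
  also have "\<dots> = J1 u" by (simp only: J21 b minus_minus)
  finally show "J2 (J3 u) = J1 u" .
qed

lemma G_J_left: "G (J1 u) v = - G u (J1 v)" "G (J2 u) v = - G u (J2 v)" "G (J3 u) v = - G u (J3 v)"
  using G_J(1)[of "J1 u" v] G_J(2)[of "J2 u" v] G_J(3)[of "J3 u" v] by (simp_all add: J_square G_minus)

lemma G_self_J: "G u (J1 u) = 0" "G u (J2 u) = 0" "G u (J3 u) = 0"
  using G_J_left(1)[of u u] G_J_left(2)[of u u] G_J_left(3)[of u u] G_sym[of u "J1 u"] G_sym[of u "J2 u"] G_sym[of u "J3 u"]
  by auto

definition quaternionic_frame :: "real^8 \<Rightarrow> real^8 \<Rightarrow> 8 \<Rightarrow> real^8" where
  "quaternionic_frame e f i = (if i = 0 then e else if i = 1 then J1 e else if i = 2 then J2 e else if i = 3 then J3 e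
    else if i = 4 then f else if i = 5 then J1 f else if i = 6 then J2 f else J3 f)"

definition orthonormal :: "(8 \<Rightarrow> real^8) \<Rightarrow> bool" where
  "orthonormal E \<longleftrightarrow> (\<forall>i j. G (E i) (E j) = (if i = j then 1 else 0))"

lemma quaternionic_frame_orthonormal:
  assumes "G e e = 1" "G f f = 1" "G e f = 0" "G e (J1 f) = 0" "G e (J2 f) = 0" "G e (J3 f) = 0"
  shows "orthonormal (quaternionic_frame e f)"
proof -
  have f: "G f e = 0" "G f (J1 e) = 0" "G f (J2 e) = 0" "G f (J3 e) = 0"
    using assms G_J_left[of e f] G_sym[of f e] G_sym[of f "J1 e"] G_sym[of f "J2 e"] G_sym[of f "J3 e"] by simp_all
  have "G (quaternionic_frame e f i) (quaternionic_frame e f j) = (if i = j then 1 else 0)" for i j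
    using exhaust_8[of i] exhaust_8[of j]
    by (elim disjE; hypsubst)
      (simp_all add: quaternionic_frame_def G_J_left G_minus J_square J12 J21 J_products J_minus G_self_J f assms)
  then show ?thesis by (simp add: orthonormal_def)
qed

lemma normalize: "u \<noteq> 0 \<Longrightarrow> G (inverse (sqrt (G u u)) *\<^sub>R u) (inverse (sqrt (G u u)) *\<^sub>R u) = 1"
  using G_pos[of u] by (simp add: G_scale field_simps)

lemma quaternionic_projection:
  assumes e: "G e e = 1"
  defines "z \<equiv> \<lambda>y. y - (G y e *\<^sub>R e + G y (J1 e) *\<^sub>R J1 e + G y (J2 e) *\<^sub>R J2 e + G y (J3 e) *\<^sub>R J3 e)"
  shows "G e (z y) = 0" "G e (J1 (z y)) = 0" "G e (J2 (z y)) = 0" "G e (J3 (z y)) = 0"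
proof -
  note rules = G_J_left G_minus J_square J12 J21 J_products J_minus G_self_J G_add G_scale G_diff e
  have z: "G (z y) e = 0" "G (z y) (J1 e) = 0" "G (z y) (J2 e) = 0" "G (z y) (J3 e) = 0"
    by (simp_all add: z_def rules)
  show "G e (z y) = 0" "G e (J1 (z y)) = 0" "G e (J2 (z y)) = 0" "G e (J3 (z y)) = 0"
    using z G_J_left[of e "z y"] G_sym[of "z y" e] G_sym[of "z y" "J1 e"] G_sym[of "z y" "J2 e"] G_sym[of "z y" "J3 e"] by simp_all
qed

lemma quaternionic_frame_exists:
  obtains e f where "G e e = 1" "G f f = 1" "G e f = 0" "G e (J1 f) = 0" "G e (J2 f) = 0" "G e (J3 f) = 0"
proof -
  define e where "e = inverse (sqrt (G (axis 0 1) (axis 0 1))) *\<^sub>R (axis 0 1 :: real^8)"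
  have e: "G e e = 1" unfolding e_def by (rule normalize) (simp add: axis_eq_0_iff)
  let ?S = "{e, J1 e, J2 e, J3 e}"
  have "dim ?S \<le> card ?S" by (rule dim_le_card') simp
  also have "\<dots> \<le> 4" by (simp add: card_insert_if)
  finally have d: "dim (span ?S) \<le> 4" by (simp only: dim_span)
  have "span ?S \<noteq> UNIV"
  proof
    assume eq: "span ?S = UNIV"
    show False using d unfolding eq by (simp add: dim_UNIV)
  qed
  then obtain y where y: "y \<notin> span ?S" by auto
  define z where "z = y - (G y e *\<^sub>R e + G y (J1 e) *\<^sub>R J1 e + G y (J2 e) *\<^sub>R J2 e + G y (J3 e) *\<^sub>R J3 e)"
  have "G y e *\<^sub>R e + G y (J1 e) *\<^sub>R J1 e + G y (J2 e) *\<^sub>R J2 e + G y (J3 e) *\<^sub>R J3 e \<in> span ?S"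
    by (intro span_add span_scale span_base) auto
  then have z0: "z \<noteq> 0" using y by (auto simp: z_def)
  have ez: "G e z = 0" "G e (J1 z) = 0" "G e (J2 z) = 0" "G e (J3 z) = 0"
    unfolding z_def by (rule quaternionic_projection[OF e])+
  let ?f = "inverse (sqrt (G z z)) *\<^sub>R z"
  show ?thesis
  proof (rule that[OF e normalize[OF z0]])
  qed (simp_all add: linear_scale[OF J_linear(1)] linear_scale[OF J_linear(2)] linear_scale[OF J_linear(3)] G_scale ez)
qed

lemma orthonormal_expand:
  assumes "orthonormal E"
  shows "x = (\<Sum>i\<in>UNIV. G x (E i) *\<^sub>R E i)"
proof (rule ccontr)
  define y where "y = x - (\<Sum>i\<in>UNIV. G x (E i) *\<^sub>R E i)"
  assume "x \<noteq> (\<Sum>i\<in>UNIV. G x (E i) *\<^sub>R E i)"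
  then have "y \<noteq> 0" by (simp add: y_def)
  have E: "G (E i) (E j) = (if i = j then 1 else 0)" for i j using assms by (simp add: orthonormal_def)
  have y: "G y (E j) = 0" for j
  proof -
    have "G y (E j) = G x (E j) - (\<Sum>i\<in>UNIV. G x (E i) * (if i = j then 1 else 0))"
      by (simp add: y_def G_diff G_sum G_scale E)
    also have "(\<Sum>i\<in>UNIV. G x (E i) * (if i = j then 1 else 0)) = (\<Sum>i\<in>UNIV. if i = j then G x (E i) else 0)"
      by (intro sum.cong) auto
    finally show ?thesis by simp
  qed
  have "inj E"
  proof (rule injI)
    fix i j assume "E i = E j"
    then have "G (E i) (E j) = 1" using E[of j j] by simp
    then show "i = j" using E[of i j] by (auto split: if_splits)
  qed
  then have card: "card (range E) = 8" by (simp add: card_image)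
  have yE: "y \<notin> range E" using y G_pos[OF \<open>y \<noteq> 0\<close>] by (metis less_irrefl rangeE)
  let ?S = "insert y (range E)"
  have orth: "G u v = 0" if "u \<in> ?S" "v \<in> ?S" "u \<noteq> v" for u v
    using that y E G_sym[of "E _" y] by auto
  have nz: "G u u \<noteq> 0" if "u \<in> ?S" for u
    using that G_pos[OF \<open>y \<noteq> 0\<close>] E by auto
  have "independent ?S"
  proof
    assume "dependent ?S"
    then obtain c w where w: "w \<in> ?S" "c w \<noteq> 0" "(\<Sum>v\<in>?S. c v *\<^sub>R v) = 0"
      using dependent_finite[of ?S] by auto
    have "0 = G (\<Sum>v\<in>?S. c v *\<^sub>R v) w" by (simp add: w G_zero)
    also have "\<dots> = (\<Sum>v\<in>?S. c v * G v w)" by (simp only: G_sum G_scale)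
    also have "\<dots> = (\<Sum>v\<in>?S. if v = w then c w * G w w else 0)"
      using orth w(1) by (intro sum.cong) auto
    also have "\<dots> = c w * G w w" using w(1) by (subst sum.delta) auto
    finally show False using w nz by auto
  qed
  then have "card ?S \<le> 8" using independent_bound[of ?S] by simp
  then show False using card yE by simp
qed

lemma bilinear_trace:
  assumes E: "orthonormal E" and B: "orthonormal B"
    and h: "\<And>v. linear (\<lambda>u. h u v)" "\<And>u. linear (\<lambda>v. h u v :: real)"
  shows "(\<Sum>i\<in>UNIV. h (E i) (E i)) = (\<Sum>k\<in>UNIV. h (B k) (B k))"
proof -
  have gram: "(\<Sum>i\<in>UNIV. G (E i) (B k) * G (E i) (B l)) = (if k = l then 1 else 0)" for k l
  proof -
    have "(if k = l then 1 else 0) = G (B k) (B l)" using B by (simp add: orthonormal_def)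
    also have "\<dots> = G (\<Sum>i\<in>UNIV. G (B k) (E i) *\<^sub>R E i) (B l)" using orthonormal_expand[OF E, of "B k"] by simp
    also have "\<dots> = (\<Sum>i\<in>UNIV. G (E i) (B k) * G (E i) (B l))" by (simp add: G_sum G_scale G_sym[of "B k"])
    finally show ?thesis by simp
  qed
  have "h (E i) (E i) = (\<Sum>k\<in>UNIV. \<Sum>l\<in>UNIV. G (E i) (B k) * G (E i) (B l) * h (B k) (B l))" for i
  proof -
    have "h (E i) (E i) = h (\<Sum>k\<in>UNIV. G (E i) (B k) *\<^sub>R B k) (\<Sum>l\<in>UNIV. G (E i) (B l) *\<^sub>R B l)"
      using orthonormal_expand[OF B, of "E i"] by simp
    also have "\<dots> = (\<Sum>k\<in>UNIV. G (E i) (B k) * h (B k) (\<Sum>l\<in>UNIV. G (E i) (B l) *\<^sub>R B l))"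
      by (simp add: linear_sum[OF h(1)] linear_scale[OF h(1)])
    also have "\<dots> = (\<Sum>k\<in>UNIV. G (E i) (B k) * (\<Sum>l\<in>UNIV. G (E i) (B l) * h (B k) (B l)))"
      by (simp add: linear_sum[OF h(2)] linear_scale[OF h(2)])
    finally show ?thesis by (simp add: sum_distrib_left mult.assoc)
  qed
  then have "(\<Sum>i\<in>UNIV. h (E i) (E i)) = (\<Sum>i\<in>UNIV. \<Sum>k\<in>UNIV. \<Sum>l\<in>UNIV. G (E i) (B k) * G (E i)
      (B l) * h (B k) (B l))"
    by simp
  also have "\<dots> = (\<Sum>k\<in>UNIV. \<Sum>i\<in>UNIV. \<Sum>l\<in>UNIV. G (E i) (B k) * G (E i) (B l) * h (B k) (B l))"
    by (rule sum.swap)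
  also have "\<dots> = (\<Sum>k\<in>UNIV. \<Sum>l\<in>UNIV. \<Sum>i\<in>UNIV. G (E i) (B k) * G (E i) (B l) * h (B k) (B l))"
    by (intro sum.cong refl sum.swap)
  also have "\<dots> = (\<Sum>k\<in>UNIV. \<Sum>l\<in>UNIV. (if k = l then 1 else 0) * h (B k) (B l))"
    by (simp only: sum_distrib_right[symmetric] gram)
  also have "\<dots> = (\<Sum>k\<in>UNIV. \<Sum>l\<in>UNIV. if k = l then h (B k) (B l) else 0)"
    by (intro sum.cong refl) auto
  finally show ?thesis by simp
qed

lemma contraction_eq:
  assumes E: "orthonormal E" and B: "orthonormal B" and J: "linear J" "\<And>u v. G (J u) v = - G u (J v)"
    and h: "\<And>v. linear (\<lambda>u. h u v)" "\<And>u. linear (\<lambda>v. h u v :: real)"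
  shows "(\<Sum>i\<in>UNIV. \<Sum>j\<in>UNIV. G (E i) (J (E j)) * h (E i) (E j)) = - (\<Sum>k\<in>UNIV. h (B k) (J (B k)))"
proof -
  have "(\<Sum>j\<in>UNIV. G (E i) (J (E j)) * h (E i) (E j)) = - h (E i) (J (E i))" for i
  proof -
    have "h (E i) (J (E i)) = h (E i) (\<Sum>j\<in>UNIV. G (J (E i)) (E j) *\<^sub>R E j)"
      using orthonormal_expand[OF E, of "J (E i)"] by simp
    also have "\<dots> = (\<Sum>j\<in>UNIV. G (J (E i)) (E j) * h (E i) (E j))"
      by (simp add: linear_sum[OF h(2)] linear_scale[OF h(2)])
    finally show ?thesis by (simp add: J(2) sum_negf)
  qed
  then have "(\<Sum>i\<in>UNIV. \<Sum>j\<in>UNIV. G (E i) (J (E j)) * h (E i) (E j)) = - (\<Sum>i\<in>UNIV. h (E i) (J (E i)))"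
    by (simp add: sum_negf)
  also have "(\<Sum>i\<in>UNIV. h (E i) (J (E i))) = (\<Sum>k\<in>UNIV. h (B k) (J (B k)))"
  proof (rule bilinear_trace[OF E B, where h = "\<lambda>u v. h u (J v)"])
    show "linear (\<lambda>u. h u (J v))" for v by (rule h(1))
    show "linear (\<lambda>v. h u (J v))" for u
      using linear_compose[OF J(1) h(2)[of u]] by (simp add: comp_def)
  qed
  finally show ?thesis .
qed

lemma orthonormal_vanish:
  assumes "orthonormal B" "linear f" "\<And>i. f (B i) = (0::real)"
  shows "f x = 0"
proof -
  have "f x = f (\<Sum>i\<in>UNIV. G x (B i) *\<^sub>R B i)" using orthonormal_expand[OF assms(1), of x] by simp
  then show ?thesis by (simp add: linear_sum[OF assms(2)] linear_scale[OF assms(2)] assms(3))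
qed

abbreviation "kaehler1 u v \<equiv> G u (J1 v)"

lemma kaehler1_linear: "linear (\<lambda>u. kaehler1 u v)" "linear (\<lambda>v. kaehler1 u v)"
  using G_linear linear_compose[OF J_linear(1) G_linear2[of u]] by (simp_all add: comp_def)

lemma wedge2222_frame_pos:
  assumes "orthonormal (quaternionic_frame e f)"
  shows "wedge2222 kaehler1 (quaternionic_frame e f) > 0"
proof -
  let ?B = "quaternionic_frame e f"
  define F where "F x y = kaehler1 (?B (of_nat x)) (?B (of_nat y))" for x y
  have skew: "F y x = - F x y" for x y
    unfolding F_def using G_J_left(1) G_sym by metis
  have B: "G (?B i) (?B j) = (if i = j then 1 else 0)" for i j using assms by (simp add: orthonormal_def)
  have J: "J1 (?B i) = (if i = 0 then ?B 1 else if i = 1 then - ?B 0 else if i = 2 then ?B 3 else if i = 3 then - ?B 2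
      else if i = 4 then ?B 5 else if i = 5 then - ?B 4 else if i = 6 then ?B 7 else - ?B 6)" for i
    using exhaust_8[of i] by (elim disjE; hypsubst) (simp_all add: quaternionic_frame_def J_square J12 J_products)
  have val: "F x y = (if even x \<and> y = Suc x then - 1 else 0)" if "x < y" "y < 8" for x y
  proof -
    have "x \<in> {0,1,2,3,4,5,6,7}" "y \<in> {0,1,2,3,4,5,6,7}" using that by auto
    then show ?thesis using that(1)
      by (elim insertE emptyE; hypsubst) (simp_all add: F_def J G_minus B)
  qed
  have pos: "perm_sign_of p * (F (nat_of_8 (p 0)) (nat_of_8 (p 1)) * F (nat_of_8 (p 2)) (nat_of_8 (p 3))
      * F (nat_of_8 (p 4)) (nat_of_8 (p 5)) * F (nat_of_8 (p 6)) (nat_of_8 (p 7))) \<ge> 0" if "p permutes UNIV" for p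
    by (rule pfaffian_terms_nonneg[OF skew val perm_8_distinct[OF that]]) (auto simp: nat_of_8_less)
  have eq: "wedge2222 kaehler1 ?B = (\<Sum>p | p permutes UNIV. real_of_int (sign p) * (kaehler1 (?B (p 0)) (?B (p 1))
      * kaehler1 (?B (p 2)) (?B (p 3)) * kaehler1 (?B (p 4)) (?B (p 5)) * kaehler1 (?B (p 6)) (?B (p 7))))"
    by (simp add: wedge2222_def asum_def)
  show ?thesis unfolding eq
  proof (rule sum_pos2[of _ id])
    show "id \<in> {p :: 8 \<Rightarrow> 8. p permutes UNIV}" by (simp add: permutes_id)
    show "0 < real_of_int (sign id) * (kaehler1 (?B (id 0)) (?B (id 1))
      * kaehler1 (?B (id 2)) (?B (id 3)) * kaehler1 (?B (id 4)) (?B (id 5)) * kaehler1 (?B (id 6)) (?B (id 7)))"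
      by (simp add: J G_minus B sign_id)
    show "0 \<le> real_of_int (sign p) * (kaehler1 (?B (p 0)) (?B (p 1))
      * kaehler1 (?B (p 2)) (?B (p 3)) * kaehler1 (?B (p 4)) (?B (p 5)) * kaehler1 (?B (p 6)) (?B (p 7)))"
      if "p \<in> {p. p permutes UNIV}" for p
      using pos[of p] that sign_eq_perm_sign[of p] by (simp add: F_def of_nat_of_8)
  qed simp
qed

lemma frame_matrix:
  obtains e f A where "orthonormal (quaternionic_frame e f)" "\<And>i. A $ i = quaternionic_frame e f i"
proof -
  obtain e f where *: "G e e = 1" "G f f = 1" "G e f = 0" "G e (J1 f) = 0" "G e (J2 f) = 0" "G e (J3 f) = 0"
    by (rule quaternionic_frame_exists)
  show ?thesis
    by (rule that[OF quaternionic_frame_orthonormal[OF *], of "\<chi> i. quaternionic_frame e f i"]) simp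
qed

lemma wedge2222_kaehler1_nonzero: "wedge2222 kaehler1 (\<lambda>i. axis i 1) \<noteq> 0"
proof (rule frame_matrix)
  fix e f and A :: "real^8^8"
  assume o: "orthonormal (quaternionic_frame e f)" and A: "\<And>i. A $ i = quaternionic_frame e f i"
  have "wedge2222 kaehler1 (quaternionic_frame e f) = det A * wedge2222 kaehler1 (\<lambda>i. axis i 1)"
    using wedge2222_det[OF kaehler1_linear, of A] A by simp
  then show ?thesis using wedge2222_frame_pos[OF o] by auto
qed

lemma contraction_free_self_dual:
  assumes lin: "linear4 \<beta>" and alt: "alternating4 \<beta>" and E: "orthonormal E"
    and contr: "\<And>X Y. (\<Sum>i\<in>UNIV. \<Sum>j\<in>UNIV. G (E i) (J1 (E j)) * \<beta> (E i) (E j) X Y) = 0"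
      "\<And>X Y. (\<Sum>i\<in>UNIV. \<Sum>j\<in>UNIV. G (E i) (J2 (E j)) * \<beta> (E i) (E j) X Y) = 0"
      "\<And>X Y. (\<Sum>i\<in>UNIV. \<Sum>j\<in>UNIV. G (E i) (J3 (E j)) * \<beta> (E i) (E j) X Y) = 0"
  shows "wedge44 \<beta> (\<lambda>i. axis i 1) * wedge2222 kaehler1 (\<lambda>i. axis i 1) \<ge> 0"
    and "wedge44 \<beta> (\<lambda>i. axis i 1) = 0 \<Longrightarrow> \<beta> X Y Z W = 0"
proof -
  obtain e f and A :: "real^8^8" where o: "orthonormal (quaternionic_frame e f)" and A: "\<And>i. A $ i = quaternionic_frame e f i"
    by (rule frame_matrix) blast
  let ?B = "quaternionic_frame e f"
  have bl: "linear (\<lambda>u. \<beta> u v X Y)" "linear (\<lambda>v. \<beta> u v X Y)" for u v X Y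
    using lin by (simp_all add: linear4_def)
  have sw: "\<beta> b a c d = - \<beta> a b c d" "\<beta> a c b d = - \<beta> a b c d" "\<beta> a b d c = - \<beta> a b c d" for a b c d
    using alt unfolding alternating4_def by blast+
  have trace: "(\<Sum>k\<in>UNIV. \<beta> (?B k) (J1 (?B k)) X Y) = 0" "(\<Sum>k\<in>UNIV. \<beta> (?B k) (J2 (?B k)) X Y) = 0"
    "(\<Sum>k\<in>UNIV. \<beta> (?B k) (J3 (?B k)) X Y) = 0" for X Y
    using contr[of X Y] contraction_eq[OF E o J_linear(1) G_J_left(1), of "\<lambda>u v. \<beta> u v X Y", OF bl]
      contraction_eq[OF E o J_linear(2) G_J_left(2), of "\<lambda>u v. \<beta> u v X Y", OF bl]
      contraction_eq[OF E o J_linear(3) G_J_left(3), of "\<lambda>u v. \<beta> u v X Y", OF bl] by simp_all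
  have neg: "\<beta> u (- v) X Y = - \<beta> u v X Y" for u v X Y
    by (rule linear_neg[OF bl(2)])
  define b where "b x y z w = \<beta> (?B (of_nat x)) (?B (of_nat y)) (?B (of_nat z)) (?B (of_nat w))" for x y z w
  interpret contraction_free b
  proof
    show "b y x z w = - b x y z w" "b x z y w = - b x y z w" "b x y w z = - b x y z w" for x y z w
      unfolding b_def by (rule sw)+
    show "b 0 1 x y + b 2 3 x y + b 4 5 x y + b 6 7 x y = 0" for x y
      using trace(1)[of "?B (of_nat x)" "?B (of_nat y)"]
        sw(1)[of "J1 e" e] sw(1)[of "J3 e" "J2 e"] sw(1)[of "J1 f" f] sw(1)[of "J3 f" "J2 f"]
      by (simp add: sum_8 b_def quaternionic_frame_def J_square J12 J_products neg)
    show "b 0 2 x y - b 1 3 x y + b 4 6 x y - b 5 7 x y = 0" for x y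
      using trace(2)[of "?B (of_nat x)" "?B (of_nat y)"]
        sw(1)[of "J2 e" e] sw(1)[of "J3 e" "J1 e"] sw(1)[of "J2 f" f] sw(1)[of "J3 f" "J1 f"]
      by (simp add: sum_8 b_def quaternionic_frame_def J_square J21 J_products neg)
    show "b 0 3 x y + b 1 2 x y + b 4 7 x y + b 5 6 x y = 0" for x y
      using trace(3)[of "?B (of_nat x)" "?B (of_nat y)"]
        sw(1)[of "J3 e" e] sw(1)[of "J2 e" "J1 e"] sw(1)[of "J3 f" f] sw(1)[of "J2 f" "J1 f"]
      by (simp add: sum_8 b_def quaternionic_frame_def J_square J_products neg)
  qed
  let ?t = "\<lambda>p. \<beta> (?B (p 0)) (?B (p 1)) (?B (p 2)) (?B (p 3))"
  have dual: "real_of_int (sign p) * (?t p * \<beta> (?B (p 4)) (?B (p 5)) (?B (p 6)) (?B (p 7))) = (?t p)\<^sup>2"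
    if p: "p permutes UNIV" for p
  proof -
    have "perm_sign_of p * b (nat_of_8 (p 4)) (nat_of_8 (p 5)) (nat_of_8 (p 6)) (nat_of_8 (p 7))
        = b (nat_of_8 (p 0)) (nat_of_8 (p 1)) (nat_of_8 (p 2)) (nat_of_8 (p 3))"
      by (rule self_dual[OF perm_8_distinct[OF p]]) (auto simp: nat_of_8_less)
    then have "real_of_int (sign p) * \<beta> (?B (p 4)) (?B (p 5)) (?B (p 6)) (?B (p 7)) = ?t p"
      by (simp add: b_def of_nat_of_8 sign_eq_perm_sign[OF p])
    then show ?thesis by (simp add: power2_eq_square mult.left_commute)
  qed
  have wB: "wedge44 \<beta> ?B = (\<Sum>p | p permutes UNIV. (?t p)\<^sup>2)"
    unfolding wedge44_def asum_def by (rule sum.cong) (simp_all add: dual)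
  have d44: "wedge44 \<beta> ?B = det A * wedge44 \<beta> (\<lambda>i. axis i 1)"
    using wedge44_det[OF lin, of A] A by simp
  have d2: "wedge2222 kaehler1 ?B = det A * wedge2222 kaehler1 (\<lambda>i. axis i 1)"
    using wedge2222_det[OF kaehler1_linear, of A] A by simp
  have "wedge44 \<beta> ?B * wedge2222 kaehler1 ?B \<ge> 0"
    unfolding wB using wedge2222_frame_pos[OF o] by (intro mult_nonneg_nonneg sum_nonneg) auto
  then have "(det A)\<^sup>2 * (wedge44 \<beta> (\<lambda>i. axis i 1) * wedge2222 kaehler1 (\<lambda>i. axis i 1)) \<ge> 0"
    by (simp add: d44 d2 power2_eq_square mult_ac)
  moreover have "det A \<noteq> 0" using wedge2222_frame_pos[OF o] d2 by auto
  ultimately show "wedge44 \<beta> (\<lambda>i. axis i 1) * wedge2222 kaehler1 (\<lambda>i. axis i 1) \<ge> 0"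
    by (simp add: zero_le_mult_iff)
  assume 0: "wedge44 \<beta> (\<lambda>i. axis i 1) = 0"
  have t0: "?t p = 0" if "p permutes UNIV" for p
  proof -
    have "(\<Sum>p | p permutes UNIV. (?t p)\<^sup>2) = 0" using 0 d44 wB by simp
    then show ?thesis using that by (subst (asm) sum_nonneg_eq_0_iff) auto
  qed
  have comp: "\<beta> (?B i) (?B j) (?B k) (?B l) = 0" for i j k l
  proof (cases "distinct [i, j, k, l]")
    case True
    then obtain p where "p permutes UNIV" "p 0 = i" "p 1 = j" "p 2 = k" "p 3 = l"
      by (rule permutation_8_extends)
    then show ?thesis using t0[of p] by simp
  next
    case False
    have z: "\<beta> a a c d = 0" "\<beta> a c c d = 0" "\<beta> a c d d = 0" for a c d
      using sw(1)[of a a c d] sw(2)[of a c c d] sw(3)[of a c d d] by simp_all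
    have "\<beta> a c a d = 0" "\<beta> a c d a = 0" "\<beta> c a d a = 0" for a c d
      using sw(2)[of a a c d] sw(3)[of a c a d] sw(2)[of c a a d] sw(2)[of a c a d] sw(3)[of c a a d] z by simp_all
    then show ?thesis using False z by auto
  qed
  show "\<beta> X Y Z W = 0"
  proof -
    have 1: "\<beta> X (?B j) (?B k) (?B l) = 0" for X j k l
      by (rule orthonormal_vanish[OF o, of "\<lambda>X. \<beta> X (?B j) (?B k) (?B l)"]) (use lin comp in \<open>simp_all add: linear4_def\<close>)
    have 2: "\<beta> X Y (?B k) (?B l) = 0" for X Y k l
      by (rule orthonormal_vanish[OF o, of "\<lambda>Y. \<beta> X Y (?B k) (?B l)"]) (use lin 1 in \<open>simp_all add: linear4_def\<close>)
    have 3: "\<beta> X Y Z (?B l) = 0" for X Y Z l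
      by (rule orthonormal_vanish[OF o, of "\<lambda>Z. \<beta> X Y Z (?B l)"]) (use lin 2 in \<open>simp_all add: linear4_def\<close>)
    show ?thesis
      by (rule orthonormal_vanish[OF o, of "\<lambda>W. \<beta> X Y Z W"]) (use lin 3 in \<open>simp_all add: linear4_def\<close>)
  qed
qed

end

subsection \<open>Integration on compact manifolds\<close>

lemma absolutely_integrable_compact_support:
  fixes f :: "'a::euclidean_space \<Rightarrow> 'b::euclidean_space"
  assumes "continuous_on UNIV f" "compact K" "\<And>x. x \<notin> K \<Longrightarrow> f x = 0"
  shows "f absolutely_integrable_on UNIV"
proof -
  obtain a where a: "K \<subseteq> cbox (- a) a"
    using bounded_subset_cbox_symmetric[OF compact_imp_bounded[OF assms(2)]] by blast
  have "f absolutely_integrable_on cbox (- a) a"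
    by (intro absolutely_integrable_continuous continuous_on_subset[OF assms(1)]) simp
  moreover have "(\<lambda>x. if x \<in> cbox (- a) a then f x else 0) = f"
    by (rule ext) (use a assms(3) in auto)
  ultimately show ?thesis
    using absolutely_integrable_restrict_UNIV[of "cbox (- a) a" f] by simp
qed

lemma integral_change_of_variables_compact_support:
  fixes \<tau> :: "real^'m::{finite,wellorder} \<Rightarrow> real^'m::_" and f :: "real^'m::_ \<Rightarrow> real"
  assumes S: "open S" and der: "\<And>x. x \<in> S \<Longrightarrow> (\<tau> has_derivative \<tau>' x) (at x)" and inj: "inj_on \<tau> S"
    and f: "continuous_on UNIV f" "compact K" "\<And>y. y \<notin> K \<Longrightarrow> f y = 0" "K \<subseteq> \<tau> ` S"
    and h: "\<And>x. x \<in> S \<Longrightarrow> h x = \<bar>det (matrix (\<tau>' x))\<bar> * f (\<tau> x)" "\<And>x. x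
        \<notin> S \<Longrightarrow> h x = 0"
  shows "integral UNIV h = integral UNIV f"
proof -
  define F :: "real^'m::_ \<Rightarrow> real^1" where "F y = vec (f y)" for y
  have cF: "continuous_on UNIV F"
    unfolding F_def by (rule continuous_on_compose2[OF linear_continuous_on[OF linear_conv_bounded_linear[THEN iffD1, OF linear_vec]] f(1)]) auto
  have F0: "F y = 0" if "y \<notin> K" for y using f(3)[OF that] by (simp add: F_def)
  have "F absolutely_integrable_on UNIV"
    by (rule absolutely_integrable_compact_support[OF cF f(2) F0])
  moreover have eqF: "(\<lambda>y. if y \<in> \<tau> ` S then F y else 0) = F"
    by (rule ext) (use F0 f(4) in auto)
  ultimately have 1: "F absolutely_integrable_on (\<tau> ` S)"
    using absolutely_integrable_restrict_UNIV[of "\<tau> ` S" F] by simp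
  have "S \<in> sets lebesgue" using S by simp
  moreover have "(\<tau> has_derivative \<tau>' x) (at x within S)" if "x \<in> S" for x
    using der[OF that] by (rule has_derivative_at_withinI)
  ultimately have 2: "integral S (\<lambda>x. \<bar>det (matrix (\<tau>' x))\<bar> *\<^sub>R F (\<tau> x)) = integral (\<tau> ` S) F"
    and 3: "(\<lambda>x. \<bar>det (matrix (\<tau>' x))\<bar> *\<^sub>R F (\<tau> x)) absolutely_integrable_on S"
    using has_absolute_integral_change_of_variables[of S \<tau> \<tau>' F "integral (\<tau> ` S) F"] inj 1 by blast+
  let ?H = "\<lambda>x. vec (h x) :: real^1"
  have eqH: "?H = (\<lambda>x. if x \<in> S then \<bar>det (matrix (\<tau>' x))\<bar> *\<^sub>R F (\<tau> x) else 0)"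
    using h by (auto simp: F_def vec_eq_iff)
  have "integral UNIV ?H = integral S (\<lambda>x. \<bar>det (matrix (\<tau>' x))\<bar> *\<^sub>R F (\<tau> x))"
    unfolding eqH by (rule integral_restrict_UNIV)
  also have "\<dots> = integral UNIV F"
    unfolding 2 using integral_restrict_UNIV[of "\<tau> ` S" F] by (simp only: eqF)
  finally have eq: "integral UNIV ?H = integral UNIV F" .
  have bl: "bounded_linear (\<lambda>v::real^1. v $ 1)" by (rule bounded_linear_vec_nth)
  have "?H integrable_on UNIV"
    unfolding eqH integrable_restrict_UNIV using 3 by (rule set_lebesgue_integral_eq_integral(1))
  from integral_linear[OF this bl] have "integral UNIV h = integral UNIV ?H $ 1" by (simp add: o_def)
  moreover have "F integrable_on UNIV"
    using absolutely_integrable_compact_support[OF cF f(2) F0] by (rule set_lebesgue_integral_eq_integral(1))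
  from integral_linear[OF this bl] have "integral UNIV f = integral UNIV F $ 1" by (simp add: o_def F_def)
  ultimately show ?thesis using eq by simp
qed

definition ext0 :: "'v set \<Rightarrow> ('v \<Rightarrow> real) \<Rightarrow> 'v \<Rightarrow> real" where
  "ext0 S w = (\<lambda>x. if x \<in> S then w x else 0)"

context manifold
begin

lemma chart_image_compact:
  assumes "(U, \<phi>) \<in> A" "compact K" "K \<subseteq> U"
  shows "compact (\<phi> ` K)"
  using assms(2) continuous_on_subset[OF chart_continuous(1)[OF assms(1)] assms(3)]
  by (intro compact_continuous_image)

lemma ext0_local:
  assumes U: "(U, \<phi>) \<in> A" and K: "compact K" "K \<subseteq> U"
    and w: "\<And>q. q \<in> U \<Longrightarrow> q \<notin> K \<Longrightarrow> w (\<phi> q) = 0"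
  shows "x \<notin> \<phi> ` K \<Longrightarrow> ext0 (\<phi> ` U) w x = 0"
  using w by (auto simp: ext0_def)

lemma ext0_continuous:
  assumes U: "(U, \<phi>) \<in> A" and K: "compact K" "K \<subseteq> U"
    and w: "continuous_on (\<phi> ` U) w" "\<And>q. q \<in> U \<Longrightarrow> q \<notin> K \<Longrightarrow> w (\<phi> q) = 0"
  shows "continuous_on UNIV (ext0 (\<phi> ` U) w)"
proof -
  have c: "closed (\<phi> ` K)" by (rule compact_imp_closed[OF chart_image_compact[OF U K]])
  have "continuous_on (\<phi> ` U) (ext0 (\<phi> ` U) w)"
    using w(1) by (rule continuous_on_cong[THEN iffD1, rotated -1]) (simp_all add: ext0_def)
  moreover have "continuous_on (- \<phi> ` K) (ext0 (\<phi> ` U) w)"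
    by (rule continuous_on_cong[THEN iffD1, OF refl _ continuous_on_const[of _ 0]])
      (use ext0_local[where w = w, OF U K w(2)] in auto)
  moreover have "\<phi> ` U \<union> - \<phi> ` K = UNIV" using K(2) by auto
  ultimately show ?thesis
    using continuous_on_open_Un[OF chart_open(2)[OF U], of "- \<phi> ` K"] c by auto
qed

lemma ext0_smooth:
  assumes U: "(U, \<phi>) \<in> A" and K: "compact K" "K \<subseteq> U"
    and w: "smooth_on (\<phi> ` U) w" "\<And>q. q \<in> U \<Longrightarrow> q \<notin> K \<Longrightarrow> w (\<phi> q) = 0"
  shows "smooth_on UNIV (ext0 (\<phi> ` U) w)"
proof (rule smooth_on_local)
  fix x
  have c: "open (- \<phi> ` K)" using compact_imp_closed[OF chart_image_compact[OF U K]] by auto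
  show "\<exists>T. open T \<and> x \<in> T \<and> smooth_on T (ext0 (\<phi> ` U) w)"
  proof (cases "x \<in> \<phi> ` U")
    case True
    have "smooth_on (\<phi> ` U) (ext0 (\<phi> ` U) w)"
      by (rule smooth_on_cong[OF chart_open(2)[OF U] _ w(1)]) (simp add: ext0_def)
    then show ?thesis using True chart_open(2)[OF U] by blast
  next
    case False
    have "smooth_on (- \<phi> ` K) (ext0 (\<phi> ` U) w)"
      by (rule smooth_on_cong[OF c _ smooth_on_const[OF c, of 0]])
        (use ext0_local[where w = w, OF U K w(2)] in auto)
    then show ?thesis using False c K(2) by blast
  qed
qed

lemma partition_of_unity:
  assumes "compact (UNIV :: 'a set)"
  obtains I :: "'a set" and \<rho> c K where "finite I" "\<And>i. i \<in> I \<Longrightarrow> c i \<in> A" "\<And>i. i \<in> I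
      \<Longrightarrow> \<rho> i \<in> SF"
    "\<And>i p. i \<in> I \<Longrightarrow> 0 \<le> \<rho> i p" "\<And>i. i \<in> I \<Longrightarrow> compact (K i)" "\<And>i.
        i \<in> I \<Longrightarrow> K i \<subseteq> fst (c i)"
    "\<And>i p. i \<in> I \<Longrightarrow> p \<notin> K i \<Longrightarrow> \<rho> i p = 0" "\<And>p. (\<Sum>i\<in>I. \<rho> i p) = 1"
proof -
  have "\<exists>c b K N. c \<in> A \<and> b \<in> SF \<and> (\<forall>q. 0 \<le> b q) \<and> compact K \<and> K \<subseteq>
      fst c \<and> (\<forall>q. q \<notin> K \<longrightarrow> b q = 0)
      \<and> open N \<and> p \<in> N \<and> (\<forall>q\<in>N. b q = 1)" for p
  proof -
    obtain U \<phi> where U: "(U, \<phi>) \<in> A" "p \<in> U" by (rule chart_exists)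
    obtain \<beta> :: "real^'n \<Rightarrow> real" and K N where *: "smooth_on UNIV \<beta>" "\<And>x. 0 \<le> \<beta> x"
        "compact K" "K \<subseteq> U \<inter> UNIV" "open N" "p \<in> N" "N \<subseteq> K"
      "\<And>q. q \<in> N \<Longrightarrow> \<beta> (\<phi> q) = 1" "\<And>q. q \<in> U \<Longrightarrow> q \<notin> K
          \<Longrightarrow> \<beta> (\<phi> q) = 0"
      by (rule chart_bump[OF U UNIV_I open_UNIV]) blast
    let ?b = "\<lambda>q. if q \<in> U then \<beta> (\<phi> q) else 0"
    have "?b \<in> SF"
      by (rule smooth_funs_extend_by_zero[OF U(1) smooth_on_subset[OF *(1)] *(3)]) (use * in auto)
    moreover have "\<forall>q\<in>N. ?b q = 1" using * by auto
    moreover have "\<forall>q. 0 \<le> ?b q" "\<forall>q. q \<notin> K \<longrightarrow> ?b q = 0" using * by auto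
    moreover have "K \<subseteq> fst (U, \<phi>)" using * by auto
    ultimately show ?thesis using U(1) *(3,5,6) by blast
  qed
  then obtain c b K N where *: "\<And>p. c p \<in> A" "\<And>p. b p \<in> SF" "\<And>p q. 0 \<le> b p q" "\<And>p. compact (K p)"
    "\<And>p. K p \<subseteq> fst (c p)" "\<And>p q. q \<notin> K p \<Longrightarrow> b p q = 0" "\<And>p. open (N p)"
        "\<And>p. p \<in> N p" "\<And>p q. q \<in> N p \<Longrightarrow> b p q = 1"
    by metis
  have "UNIV \<subseteq> (\<Union>p. N p)" using *(8) by auto
  then obtain I where I: "finite I" "UNIV \<subseteq> (\<Union>p\<in>I. N p)"
    using compactE_image[OF assms, of UNIV N] *(7) by metis
  let ?s = "\<lambda>q. \<Sum>i\<in>I. b i q"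
  have pos: "?s q > 0" for q
  proof -
    obtain p where "p \<in> I" "q \<in> N p" using I(2) by blast
    then show ?thesis using *(3,9) by (intro sum_pos2[OF I(1), of p]) auto
  qed
  have inv: "(\<lambda>q. inverse (?s q)) \<in> SF"
    by (intro smooth_funs_inverse smooth_funs_sum *(2)) (metis pos less_irrefl)
  show ?thesis
  proof (rule that[of I c "\<lambda>i q. b i q * inverse (?s q)" K])
    show "(\<lambda>q. b i q * inverse (?s q)) \<in> SF" for i by (intro smooth_funs_mult inv *(2))
    show "(\<Sum>i\<in>I. b i q * inverse (?s q)) = 1" for q
      using pos[of q] by (simp flip: sum_distrib_right)
    show "0 \<le> b i q * inverse (?s q)" for i q
      using pos[of q] *(3) by (simp add: less_imp_le)
  qed (use * I in auto)
qed

end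

locale manifold8 = manifold A for A :: "('a::{t2_space, second_countable_topology}, 8) atlas"
begin

text \<open>Stokes' theorem in the form needed here: \<open>\<delta>\<close> stands for a signed density \<open>dh \<and>
    \<eta>\<close> and \<open>\<kappa>\<close> for
  a non-negative density \<open>d\<eta>\<close>, where \<open>\<eta>\<close> is a fixed 7-form.\<close>

lemma nonneg_exact_density_vanishes:
  fixes \<delta> :: "'a set \<Rightarrow> ('a \<Rightarrow> real^8) \<Rightarrow> ('a \<Rightarrow> real) \<Rightarrow> real^8
      \<Rightarrow> real" and \<kappa> :: "'a set \<Rightarrow> ('a \<Rightarrow> real^8) \<Rightarrow> real^8 \<Rightarrow> real"
  assumes comp: "compact (UNIV :: 'a set)"
    and \<delta>_cont: "\<And>U \<phi> h. (U, \<phi>) \<in> A \<Longrightarrow> h \<in> SF \<Longrightarrow> continuous_on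
        (\<phi> ` U) (\<delta> U \<phi> h)"
    and \<kappa>_cont: "\<And>U \<phi>. (U, \<phi>) \<in> A \<Longrightarrow> continuous_on (\<phi> ` U) (\<kappa> U \<phi>)"
    and \<kappa>_nonneg: "\<And>U \<phi> x. (U, \<phi>) \<in> A \<Longrightarrow> x \<in> \<phi> ` U \<Longrightarrow> 0 \<le> \<kappa> U \<phi> x"
    and \<delta>_sum: "\<And>U \<phi> h x (I :: 'a set). (U, \<phi>) \<in> A \<Longrightarrow> x \<in> \<phi> ` U
        \<Longrightarrow> finite I \<Longrightarrow> (\<And>i. i \<in> I \<Longrightarrow> h i \<in> SF) \<Longrightarrow>
      \<delta> U \<phi> (\<lambda>p. \<Sum>i\<in>I. h i p) x = (\<Sum>i\<in>I. \<delta> U \<phi> (h i) x)"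
    and \<delta>_const: "\<And>U \<phi> x c. (U, \<phi>) \<in> A \<Longrightarrow> x \<in> \<phi> ` U \<Longrightarrow>
        \<delta> U \<phi> (\<lambda>p. c) x = 0"
    and \<delta>_local: "\<And>U \<phi> h W q. (U, \<phi>) \<in> A \<Longrightarrow> h \<in> SF \<Longrightarrow> open W
        \<Longrightarrow> q \<in> W \<Longrightarrow> W \<subseteq> U \<Longrightarrow>
      (\<And>r. r \<in> W \<Longrightarrow> h r = 0) \<Longrightarrow> \<delta> U \<phi> h (\<phi> q) = 0"
    and \<delta>_trans: "\<And>U \<phi> V \<psi> h q. (U, \<phi>) \<in> A \<Longrightarrow> (V, \<psi>) \<in> A
        \<Longrightarrow> q \<in> U \<Longrightarrow> q \<in> V \<Longrightarrow> h \<in> SF \<Longrightarrow>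
      \<delta> U \<phi> h (\<phi> q) = \<bar>det (matrix (frechet_derivative (\<psi> \<circ> inv_into U \<phi>) (at (\<phi>
          q))))\<bar> * \<delta> V \<psi> h (\<psi> q)"
    and parts: "\<And>U \<phi> h K. (U, \<phi>) \<in> A \<Longrightarrow> h \<in> SF \<Longrightarrow> compact K
        \<Longrightarrow> K \<subseteq> U \<Longrightarrow> (\<And>q. q \<notin> K \<Longrightarrow> h q = 0) \<Longrightarrow>
      integral UNIV (ext0 (\<phi> ` U) (\<lambda>x. \<delta> U \<phi> h x + h (inv_into U \<phi> x) * \<kappa> U \<phi> x)) = 0"
  obtains U \<phi> where "(U, \<phi>) \<in> A" "p \<in> U" "\<kappa> U \<phi> (\<phi> p) = 0"
proof -
  obtain I :: "'a set" and \<rho> c K where I: "finite I" and c: "\<And>i. i \<in> I \<Longrightarrow> c i \<in> A" and \<rho>: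
      "\<And>i. i \<in> I \<Longrightarrow> \<rho> i \<in> SF"
    "\<And>i p. i \<in> I \<Longrightarrow> 0 \<le> \<rho> i p" and K: "\<And>i. i \<in> I \<Longrightarrow> compact (K i)"
        "\<And>i. i \<in> I \<Longrightarrow> K i \<subseteq> fst (c i)"
    "\<And>i p. i \<in> I \<Longrightarrow> p \<notin> K i \<Longrightarrow> \<rho> i p = 0" and one: "\<And>p. (\<Sum>i\<in>I. \<rho> i p) = 1"
    by (rule partition_of_unity[OF comp]) blast
  define U where "U i = fst (c i)" for i
  define \<phi> where "\<phi> i = snd (c i)" for i
  have cA: "(U i, \<phi> i) \<in> A" if "i \<in> I" for i using c[OF that] by (simp add: U_def \<phi>_def)
  have KU: "K i \<subseteq> U i" if "i \<in> I" for i using K(2)[OF that] by (simp add: U_def)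
  define d where "d i j k = ext0 (\<phi> i ` U i) (\<lambda>x. \<rho> j (inv_into (U i) (\<phi> i) x) * \<delta> (U i) (\<phi>
      i) (\<rho> k) x)" for i j k
  define \<Delta> where "\<Delta> i = ext0 (\<phi> i ` U i) (\<delta> (U i) (\<phi> i) (\<rho> i))" for i
  define M where "M i = ext0 (\<phi> i ` U i) (\<lambda>x. \<rho> i (inv_into (U i) (\<phi> i) x) * \<kappa> (U i) (\<phi> i) x)" for i
  have \<rho>_cont: "continuous_on (\<phi> i ` U i) (\<lambda>x. \<rho> j (inv_into (U i) (\<phi> i) x))" if "i \<in> I" "j \<in> I" for i j
    by (rule smooth_on_continuous[OF smooth_funsD'[OF \<rho>(1)[OF that(2)] cA[OF that(1)]]])
  have loc: "\<delta> (U i) (\<phi> i) (\<rho> k) (\<phi> i q) = 0" if "i \<in> I" "k \<in> I" "q \<in> U i" "q \<notin> K k" for i k q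
    by (rule \<delta>_local[OF cA[OF that(1)] \<rho>(1)[OF that(2)], of "U i - K k"])
      (use that K chart_open(1)[OF cA[OF that(1)]] compact_imp_closed[OF K(1)[OF that(2)]] in auto)
  have int: "ext0 (\<phi> i ` U i) w integrable_on UNIV"
    if "i \<in> I" "compact L" "L \<subseteq> U i" "continuous_on (\<phi> i ` U i) w" "\<And>q. q \<in> U i \<Longrightarrow> q
        \<notin> L \<Longrightarrow> w (\<phi> i q) = 0" for i L w
    by (rule set_lebesgue_integral_eq_integral(1)[OF absolutely_integrable_compact_support[OF
          ext0_continuous[OF cA[OF that(1)] that(2,3,4,5)] chart_image_compact[OF cA[OF that(1)] that(2,3)]
          ext0_local[where w = w, OF cA[OF that(1)] that(2,3,5)]]])
  have \<delta>c: "continuous_on (\<phi> i ` U i) (\<delta> (U i) (\<phi> i) (\<rho> k))" if "i \<in> I" "k \<in> I" for i k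
    by (rule \<delta>_cont[OF cA[OF that(1)] \<rho>(1)[OF that(2)]])
  have \<Delta>_int: "\<Delta> i integrable_on UNIV" if "i \<in> I" for i
    unfolding \<Delta>_def by (rule int[OF that K(1)[OF that] KU[OF that] \<delta>c[OF that that] loc[OF that that]])
  have M_int: "M i integrable_on UNIV" if "i \<in> I" for i
    unfolding M_def
    by (rule int[OF that K(1)[OF that] KU[OF that] continuous_on_mult[OF \<rho>_cont[OF that that] \<kappa>_cont[OF cA[OF that]]]])
      (use K(3)[OF that] chart_inv[OF cA[OF that]] in auto)
  have d_int1: "d i j k integrable_on UNIV" if "i \<in> I" "j \<in> I" "k \<in> I" "i = j \<or> i = k" for i j k
    unfolding d_def
    by (rule int[OF that(1) K(1)[OF that(1)] KU[OF that(1)] continuous_on_mult[OF \<rho>_cont[OF that(1,2)] \<delta>c[OF that(1,3)]]])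
      (use that K(3) chart_inv[OF cA[OF that(1)]] loc in auto)
  have swap: "integral UNIV (d i j i) = integral UNIV (d j j i)" if i: "i \<in> I" and j: "j \<in> I" for i j
  proof -
    let ?\<tau> = "\<phi> j \<circ> inv_into (U i) (\<phi> i)"
    let ?S = "\<phi> i ` (U i \<inter> U j)"
    let ?L = "K i \<inter> K j"
    have L: "compact ?L" "?L \<subseteq> U j" using K(1)[OF i] K(1)[OF j] KU[OF j] by (auto intro: compact_Int)
    have inv: "inv_into (U i) (\<phi> i) (\<phi> i q) = q" if "q \<in> U i" for q using chart_inv[OF cA[OF i] that] .
    have inv': "inv_into (U j) (\<phi> j) (\<phi> j q) = q" if "q \<in> U j" for q using chart_inv[OF cA[OF j] that] .
    have w0: "\<rho> j (inv_into (U j) (\<phi> j) (\<phi> j q)) * \<delta> (U j) (\<phi> j) (\<rho> i) (\<phi> j q) = 0" if "q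
        \<in> U j" "q \<notin> ?L" for q
      using that K(3)[OF j] loc[OF j i] inv' by auto
    show ?thesis
    proof (rule integral_change_of_variables_compact_support[where \<tau> = ?\<tau> and S = ?S
          and \<tau>' = "\<lambda>x. frechet_derivative ?\<tau> (at x)" and K = "\<phi> j ` ?L"])
      show "open ?S"
        by (rule chart_image_open[OF cA[OF i]]) (use chart_open(1)[OF cA[OF i]] chart_open(1)[OF cA[OF j]] in auto)
      show "(?\<tau> has_derivative frechet_derivative ?\<tau> (at x)) (at x)" if "x \<in> ?S" for x
        by (rule smooth_on_has_derivative[OF chart_transition[OF cA[OF i] cA[OF j]] that])
      show "inj_on ?\<tau> ?S"
      proof (rule inj_onI)
        fix x y assume xy: "x \<in> ?S" "y \<in> ?S" "?\<tau> x = ?\<tau> y"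
        then obtain q r where "q \<in> U i" "q \<in> U j" "r \<in> U i" "r \<in> U j" "x = \<phi> i q" "y = \<phi> i r" by blast
        then show "x = y" using xy(3) inv inv' by (metis comp_apply)
      qed
      show "continuous_on UNIV (d j j i)"
        unfolding d_def
        by (rule ext0_continuous[OF cA[OF j] L continuous_on_mult[OF \<rho>_cont[OF j j] \<delta>c[OF j i]] w0])
      show "compact (\<phi> j ` ?L)" by (rule chart_image_compact[OF cA[OF j] L])
      show "d j j i y = 0" if "y \<notin> \<phi> j ` ?L" for y
        unfolding d_def by (rule ext0_local[OF cA[OF j] L _ that]) (rule w0)
      show "\<phi> j ` ?L \<subseteq> ?\<tau> ` ?S"
      proof
        fix y assume "y \<in> \<phi> j ` ?L"
        then obtain q where q: "q \<in> K i" "q \<in> K j" "y = \<phi> j q" by blast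
        then have "q \<in> U i" "q \<in> U j" using KU i j by blast+
        then have "y = ?\<tau> (\<phi> i q)" "\<phi> i q \<in> ?S" using q inv by auto
        then show "y \<in> ?\<tau> ` ?S" by blast
      qed
      show "d i j i x = \<bar>det (matrix (frechet_derivative ?\<tau> (at x)))\<bar> * d j j i (?\<tau> x)" if x: "x \<in> ?S" for x
      proof -
        obtain q where q: "q \<in> U i" "q \<in> U j" "x = \<phi> i q" using x by blast
        then show ?thesis
          using \<delta>_trans[OF cA[OF i] cA[OF j] q(1,2) \<rho>(1)[OF i]]
          by (simp add: d_def ext0_def inv inv')
      qed
      show "d i j i x = 0" if "x \<notin> ?S" for x
      proof (cases "x \<in> \<phi> i ` U i")
        case True
        then obtain q where q: "q \<in> U i" "x = \<phi> i q" by blast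
        then have "q \<notin> K j" using that KU[OF j] by blast
        then show ?thesis using q K(3)[OF j] by (simp add: d_def ext0_def inv)
      qed (simp add: d_def ext0_def)
    qed
  qed
  have split: "\<Delta> i = (\<lambda>x. \<Sum>j\<in>I. d i j i x)" for i
    by (rule ext) (simp add: \<Delta>_def d_def ext0_def one flip: sum_distrib_right)
  have zero: "(\<Sum>i\<in>I. d j j i x) = 0" if j: "j \<in> I" for j x
  proof (cases "x \<in> \<phi> j ` U j")
    case True
    have "(\<Sum>i\<in>I. \<delta> (U j) (\<phi> j) (\<rho> i) x) = \<delta> (U j) (\<phi> j) (\<lambda>p. \<Sum>i\<in>I. \<rho> i p) x"
      by (rule \<delta>_sum[OF cA[OF j] True I \<rho>(1), symmetric])
    also have "\<dots> = 0" using \<delta>_const[OF cA[OF j] True, of 1] by (simp add: one)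
    finally show ?thesis by (simp add: d_def ext0_def True flip: sum_distrib_left)
  qed (simp add: d_def ext0_def)
  have "(\<Sum>i\<in>I. integral UNIV (\<Delta> i)) = (\<Sum>i\<in>I. \<Sum>j\<in>I. integral UNIV (d i j i))"
    unfolding split by (intro sum.cong refl integral_sum I d_int1) auto
  also have "\<dots> = (\<Sum>i\<in>I. \<Sum>j\<in>I. integral UNIV (d j j i))"
    by (intro sum.cong refl swap)
  also have "\<dots> = (\<Sum>j\<in>I. \<Sum>i\<in>I. integral UNIV (d j j i))"
    by (rule sum.swap)
  also have "\<dots> = (\<Sum>j\<in>I. integral UNIV (\<lambda>x. \<Sum>i\<in>I. d j j i x))"
    by (intro sum.cong refl integral_sum[symmetric] I d_int1) auto
  also have "\<dots> = 0" by (intro sum.neutral ballI) (simp add: zero)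
  finally have sum\<Delta>: "(\<Sum>i\<in>I. integral UNIV (\<Delta> i)) = 0" .
  have "integral UNIV (M i) = - integral UNIV (\<Delta> i)" if i: "i \<in> I" for i
  proof -
    have "integral UNIV (\<lambda>x. \<Delta> i x + M i x) = 0"
      using parts[OF cA[OF i] \<rho>(1)[OF i] K(1)[OF i] KU[OF i] K(3)[OF i]]
      by (simp add: \<Delta>_def M_def ext0_def if_distrib cong: if_cong)
    then show ?thesis
      using integral_add[OF \<Delta>_int[OF i] M_int[OF i]] by simp
  qed
  then have sumM: "(\<Sum>i\<in>I. integral UNIV (M i)) = 0"
    using sum\<Delta> by (simp add: sum_negf)
  have M_nonneg: "0 \<le> M i x" if "i \<in> I" for i x
    using \<rho>(2)[OF that] \<kappa>_nonneg[OF cA[OF that]] by (simp add: M_def ext0_def)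
  have M0: "integral UNIV (M i) = 0" if "i \<in> I" for i
    using sumM that by (subst (asm) sum_nonneg_eq_0_iff[OF I]) (auto intro: integral_nonneg M_int M_nonneg)
  obtain i where i: "i \<in> I" "\<rho> i p \<noteq> 0"
    using one[of p] by (metis sum.neutral zero_neq_one)
  have p: "p \<in> U i" using i K(3) KU by blast
  have "M i (\<phi> i p) = 0"
  proof -
    have Mc: "continuous_on UNIV (M i)"
      unfolding M_def
      by (rule ext0_continuous[OF cA[OF i(1)] K(1)[OF i(1)] KU[OF i(1)] continuous_on_mult[OF \<rho>_cont[OF i(1) i(1)]
          \<kappa>_cont[OF cA[OF i(1)]]]])
        (use K(3)[OF i(1)] chart_inv[OF cA[OF i(1)]] in auto)
    have Ms: "M i x = 0" if "x \<notin> \<phi> i ` K i" for x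
      unfolding M_def by (rule ext0_local[OF cA[OF i(1)] K(1)[OF i(1)] KU[OF i(1)] _ that])
        (use K(3)[OF i(1)] chart_inv[OF cA[OF i(1)]] in auto)
    have "bounded (insert 0 (insert (One) (insert (\<phi> i p) (\<phi> i ` K i))))"
      using compact_imp_bounded[OF chart_image_compact[OF cA[OF i(1)] K(1)[OF i(1)] KU[OF i(1)]]] by simp
    then obtain a where a: "insert 0 (insert One (insert (\<phi> i p) (\<phi> i ` K i))) \<subseteq> box (- a) a"
      using bounded_subset_box_symmetric by blast
    have sub: "box (- a) a \<subseteq> cbox (- a) a" by (rule box_subset_cbox)
    have "(M i has_integral 0) UNIV"
      using M_int[OF i(1)] M0[OF i(1)] by (metis integrable_integral)
    moreover have "(\<lambda>x. if x \<in> cbox (- a) a then M i x else 0) = M i"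
      using Ms a sub by (intro ext) (auto simp: subset_iff)
    ultimately have "(M i has_integral 0) (cbox (- a) a)"
      using has_integral_restrict_UNIV[of "cbox (- a) a" "M i" 0] by simp
    then show ?thesis
      by (rule has_integral_0_cbox_imp_0[rotated 2])
        (use a sub Mc M_nonneg[OF i(1)] in \<open>auto intro: continuous_on_subset\<close>)
  qed
  then have "\<kappa> (U i) (\<phi> i) (\<phi> i p) = 0"
    using i p chart_inv[OF cA[OF i(1)] p] by (simp add: M_def ext0_def)
  then show ?thesis using that cA[OF i(1)] p by blast
qed

end

subsection \<open>Exactness identities for alternating sums\<close>

lemma asum_transpose:
  fixes a b :: "'n::finite"
  assumes "a \<noteq> b"
  shows "asum (\<lambda>p. f (p \<circ> Transposition.transpose a b)) = - asum f"
  using asum_right[of "Transposition.transpose a b" f] assms by (simp add: permutes_swap_id sign_swap_id)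

lemma asum_exterior_derivative:
  fixes d X :: "8 \<Rightarrow> 8 \<Rightarrow> 8 \<Rightarrow> 8 \<Rightarrow> real"
  shows "asum (\<lambda>p. (d (p 0) (p 1) (p 2) (p 3) - d (p 1) (p 0) (p 2) (p 3) + d (p 2) (p 0) (p 1) (p 3) - d (p 3) (p 0) (p 1) (p 2))
      * X (p 4) (p 5) (p 6) (p 7)) = 4 * asum (\<lambda>p. d (p 0) (p 1) (p 2) (p 3) * X (p 4) (p 5) (p 6) (p 7))"
proof -
  let ?X = "\<lambda>p. X (p 4) (p 5) (p 6) (p 7)"
  have 1: "asum (\<lambda>p. d (p 1) (p 0) (p 2) (p 3) * ?X p) = - asum (\<lambda>p. d (p 0) (p 1) (p 2) (p 3) * ?X p)"
    using asum_transpose[of "0::8" 1 "\<lambda>p. d (p 0) (p 1) (p 2) (p 3) * ?X p"] by simp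
  have 2: "asum (\<lambda>p. d (p 2) (p 0) (p 1) (p 3) * ?X p) = - asum (\<lambda>p. d (p 1) (p 0) (p 2) (p 3) * ?X p)"
    using asum_transpose[of "1::8" 2 "\<lambda>p. d (p 1) (p 0) (p 2) (p 3) * ?X p"] by simp
  have 3: "asum (\<lambda>p. d (p 3) (p 0) (p 1) (p 2) * ?X p) = - asum (\<lambda>p. d (p 2) (p 0) (p 1) (p 3) * ?X p)"
    using asum_transpose[of "2::8" 3 "\<lambda>p. d (p 2) (p 0) (p 1) (p 3) * ?X p"] by simp
  have "asum (\<lambda>p. (d (p 0) (p 1) (p 2) (p 3) - d (p 1) (p 0) (p 2) (p 3) + d (p 2) (p 0) (p 1) (p 3) - d (p 3) (p 0) (p 1) (p 2)) * ?X p)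
      = asum (\<lambda>p. d (p 0) (p 1) (p 2) (p 3) * ?X p + (- 1) * (d (p 1) (p 0) (p 2) (p 3) * ?X p)
        + d (p 2) (p 0) (p 1) (p 3) * ?X p + (- 1) * (d (p 3) (p 0) (p 1) (p 2) * ?X p))"
    by (rule asum_cong) (simp add: algebra_simps)
  then show ?thesis unfolding asum_add asum_cmult 3 2 1 by simp
qed

text \<open>The identity \<open>ddT = 0\<close>, in the form in which it enters the divergence.\<close>

lemma asum_second_exterior_derivative:
  fixes dd :: "8 \<Rightarrow> 8 \<Rightarrow> 8 \<Rightarrow> 8 \<Rightarrow> 8 \<Rightarrow> real" and t :: "8 \<Rightarrow>
      8 \<Rightarrow> 8 \<Rightarrow> real"
  assumes sym: "\<And>l m i j k. dd l m i j k = dd m l i j k"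
  shows "asum (\<lambda>p. t (p 1) (p 2) (p 3) * (dd (p 0) (p 4) (p 5) (p 6) (p 7) - dd (p 0) (p 5) (p 4) (p 6) (p 7)
      + dd (p 0) (p 6) (p 4) (p 5) (p 7) - dd (p 0) (p 7) (p 4) (p 5) (p 6))) = 0"
proof -
  let ?t = "\<lambda>p. t (p 1) (p 2) (p 3)"
  have 1: "asum (\<lambda>p. ?t p * dd (p 0) (p 4) (p 5) (p 6) (p 7)) = 0"
    using asum_transpose[of "0::8" 4 "\<lambda>p. ?t p * dd (p 0) (p 4) (p 5) (p 6) (p 7)"] sym by simp
  have 2: "asum (\<lambda>p. ?t p * dd (p 0) (p 5) (p 4) (p 6) (p 7)) = 0"
    using asum_transpose[of "0::8" 5 "\<lambda>p. ?t p * dd (p 0) (p 5) (p 4) (p 6) (p 7)"] sym by simp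
  have 3: "asum (\<lambda>p. ?t p * dd (p 0) (p 6) (p 4) (p 5) (p 7)) = 0"
    using asum_transpose[of "0::8" 6 "\<lambda>p. ?t p * dd (p 0) (p 6) (p 4) (p 5) (p 7)"] sym by simp
  have 4: "asum (\<lambda>p. ?t p * dd (p 0) (p 7) (p 4) (p 5) (p 6)) = 0"
    using asum_transpose[of "0::8" 7 "\<lambda>p. ?t p * dd (p 0) (p 7) (p 4) (p 5) (p 6)"] sym by simp
  have "asum (\<lambda>p. ?t p * (dd (p 0) (p 4) (p 5) (p 6) (p 7) - dd (p 0) (p 5) (p 4) (p 6) (p 7)
      + dd (p 0) (p 6) (p 4) (p 5) (p 7) - dd (p 0) (p 7) (p 4) (p 5) (p 6)))
      = asum (\<lambda>p. ?t p * dd (p 0) (p 4) (p 5) (p 6) (p 7) + (- 1) * (?t p * dd (p 0) (p 5) (p 4) (p 6) (p 7))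
        + ?t p * dd (p 0) (p 6) (p 4) (p 5) (p 7) + (- 1) * (?t p * dd (p 0) (p 7) (p 4) (p 5) (p 6)))"
    by (rule asum_cong) (simp add: algebra_simps)
  then show ?thesis unfolding asum_add asum_cmult 1 2 3 4 by simp
qed

lemma asum_zero: "asum (\<lambda>p. 0) = 0"
  by (simp add: asum_def)

lemma wedge134_sum:
  "finite I \<Longrightarrow> wedge134 (\<lambda>v. \<Sum>i\<in>I. h i v) t \<beta> Q = (\<Sum>i\<in>I. wedge134 (h i) t \<beta> Q)"
  by (induction I rule: finite_induct) (simp_all add: wedge134_def asum_zero asum_add distrib_right)

lemma asum_continuous_on:
  "(\<And>p. continuous_on S (\<lambda>x. f x p)) \<Longrightarrow> continuous_on S (\<lambda>x. asum (f x))"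
  unfolding asum_def by (intro continuous_intros)

lemma sgn_locally_constant:
  fixes w :: "'a::real_normed_vector \<Rightarrow> real"
  assumes S: "open S" and w: "continuous_on S w" "\<And>x. x \<in> S \<Longrightarrow> w x \<noteq> 0" and x: "x \<in> S"
  obtains N where "open N" "x \<in> N" "N \<subseteq> S" "\<And>y. y \<in> N \<Longrightarrow> sgn (w y) = sgn (w x)"
proof -
  let ?N = "{y \<in> S. w y * w x > 0}"
  have "?N = (\<lambda>y. w y * w x) -` {0<..} \<inter> S" by auto
  moreover have "continuous_on S (\<lambda>y. w y * w x)" by (intro continuous_intros w(1))
  ultimately have "open ?N" using continuous_on_open_vimage[OF S] by (metis open_greaterThan)
  moreover have "x \<in> ?N" using w(2)[OF x] x by (auto simp: zero_less_mult_iff linorder_neq_iff)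
  moreover have "sgn (w y) = sgn (w x)" if "y \<in> ?N" for y
    using that by (auto simp: zero_less_mult_iff)
  ultimately show ?thesis using that by blast
qed

subsection \<open>Torsion of an AHKT connection\<close>

locale ahkt_manifold = manifold8 A for A :: "('a::{t2_space, second_countable_topology}, 8) atlas" +
  fixes g :: "'a bilinear_field" and J :: "nat \<Rightarrow> 'a endo_field" and D :: "'a connection"
  assumes ahh: "almost_hyperhermitian A g J" and ahkt: "AHKT_connection A g J D"
begin

lemma g_sym: "u \<in> tangent_space A p \<Longrightarrow> v \<in> tangent_space A p \<Longrightarrow> g p u v = g p v u"
  and g_lincomb: "u \<in> tangent_space A p \<Longrightarrow> v \<in> tangent_space A p \<Longrightarrow> w \<in> tangent_space A p \<Longrightarrow>
    g p (tv_lincomb a u b v) w = a * g p u w + b * g p v w"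
  and g_pos: "u \<in> tangent_space A p \<Longrightarrow> u \<noteq> (\<lambda>f. 0) \<Longrightarrow> g p u u > 0"
  and g_smooth: "X \<in> VF \<Longrightarrow> Y \<in> VF \<Longrightarrow> vf_inner g X Y \<in> SF"
  using ahh unfolding almost_hyperhermitian_def riemannian_metric_def by blast+

lemma J_tangent: "k \<in> {1, 2, 3} \<Longrightarrow> u \<in> tangent_space A p \<Longrightarrow> J k p u \<in> tangent_space A p"
  and J_lincomb: "k \<in> {1, 2, 3} \<Longrightarrow> u \<in> tangent_space A p \<Longrightarrow> v \<in> tangent_space A p \<Longrightarrow>
    J k p (tv_lincomb a u b v) = tv_lincomb a (J k p u) b (J k p v)"
  and J_VF: "k \<in> {1, 2, 3} \<Longrightarrow> X \<in> VF \<Longrightarrow> vf_apply (J k) X \<in> VF"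
  and J_sq: "k \<in> {1, 2, 3} \<Longrightarrow> u \<in> tangent_space A p \<Longrightarrow> J k p (J k p u) = (\<lambda>f. - u f)"
  using ahh unfolding almost_hyperhermitian_def almost_complex_structure_def endomorphism_field_def by blast+

lemma J_mult: "u \<in> tangent_space A p \<Longrightarrow> J 1 p (J 2 p u) = J 3 p u"
    "u \<in> tangent_space A p \<Longrightarrow> J 2 p (J 1 p u) = (\<lambda>f. - J 3 p u f)"
  and J_isometry: "k \<in> {1, 2, 3} \<Longrightarrow> u \<in> tangent_space A p \<Longrightarrow> v \<in> tangent_space A p
      \<Longrightarrow> g p (J k p u) (J k p v) = g p u v"
  using ahh unfolding almost_hyperhermitian_def by blast+

lemma connection: "linear_connection A D"
  and torsion_skew: "totally_skew A (torsion g D)"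
  using ahkt unfolding AHKT_connection_def by blast+

lemma D_VF: "X \<in> VF \<Longrightarrow> Y \<in> VF \<Longrightarrow> D X Y \<in> VF"
  and D_add: "X \<in> VF \<Longrightarrow> Y \<in> VF \<Longrightarrow> Z \<in> VF \<Longrightarrow> D (vf_add X Y) Z = vf_add (D X Z) (D Y Z)"
    "X \<in> VF \<Longrightarrow> Y \<in> VF \<Longrightarrow> Z \<in> VF \<Longrightarrow> D X (vf_add Y Z) = vf_add (D X Y) (D X Z)"
  and D_scale: "X \<in> VF \<Longrightarrow> Y \<in> VF \<Longrightarrow> f \<in> SF \<Longrightarrow> D (vf_scale f X) Y = vf_scale f (D X Y)"
    "X \<in> VF \<Longrightarrow> Y \<in> VF \<Longrightarrow> f \<in> SF \<Longrightarrow> D X (vf_scale f Y) = vf_add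
        (vf_scale (vf_deriv X f) Y) (vf_scale f (D X Y))"
  using connection unfolding linear_connection_def by blast+

definition torsion_field :: "'a vfield \<Rightarrow> 'a vfield \<Rightarrow> 'a vfield" where
  "torsion_field X Y = vf_diff (vf_diff (D X Y) (D Y X)) (lie_bracket X Y)"

lemma torsion_field_VF: "X \<in> VF \<Longrightarrow> Y \<in> VF \<Longrightarrow> torsion_field X Y \<in> VF"
  unfolding torsion_field_def by (intro vf_diff_VF D_VF lie_bracket_VF)

lemma torsion_eq: "torsion g D X Y Z p = g p (torsion_field X Y p) (Z p)"
  by (simp add: torsion_def vf_inner_def torsion_field_def)

sublocale three_form A "torsion g D"
proof
  show "torsion g D X Y Z \<in> SF" if "X \<in> VF" "Y \<in> VF" "Z \<in> VF" for X Y Z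
    unfolding torsion_def torsion_field_def[symmetric] by (intro g_smooth torsion_field_VF that)
  show "pt_linear p (\<lambda>X. torsion g D X Y Z p)" if Y: "Y \<in> VF" and Z: "Z \<in> VF" for Y Z p
    unfolding pt_linear_def
  proof (intro conjI ballI)
    fix X X' assume X: "X \<in> VF" "X' \<in> VF"
    have "torsion_field (vf_add X X') Y p = tv_lincomb 1 (torsion_field X Y p) 1 (torsion_field X' Y p)"
      using D_add(1)[OF X Y] D_add(2)[OF Y X] lie_bracket_add_left[OF X Y]
      by (simp add: torsion_field_def vf_diff_def vf_add_def tv_lincomb_def fun_eq_iff)
    then show "torsion g D (vf_add X X') Y Z p = torsion g D X Y Z p + torsion g D X' Y Z p"
      using g_lincomb[OF VF_tangent[OF torsion_field_VF[OF X(1) Y]] VF_tangent[OF torsion_field_VF[OF X(2) Y]] VF_tangent[OF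
          Z], where a = 1 and b = 1]
      by (simp add: torsion_eq)
  next
    fix f X assume f: "f \<in> SF" and X: "X \<in> VF"
    have "torsion_field (vf_scale f X) Y p = tv_lincomb (f p) (torsion_field X Y p) 0 (torsion_field X Y p)"
      using D_scale(1)[OF X Y f] D_scale(2)[OF Y X f] lie_bracket_scale_left[OF X f Y]
      by (simp add: torsion_field_def vf_diff_def vf_add_def vf_scale_def tv_lincomb_def fun_eq_iff algebra_simps)
    then show "torsion g D (vf_scale f X) Y Z p = f p * torsion g D X Y Z p"
      using g_lincomb[OF VF_tangent[OF torsion_field_VF[OF X Y]] VF_tangent[OF torsion_field_VF[OF X Y]] VF_tangent[OF Z], where a = "f p" and b = 0]
      by (simp add: torsion_eq)
  qed
  show "torsion g D Y X Z p = - torsion g D X Y Z p" "torsion g D X Z Y p = - torsion g D X Y Z p"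
    if "X \<in> VF" "Y \<in> VF" "Z \<in> VF" for X Y Z p
    using torsion_skew that unfolding totally_skew_def by blast+
qed

definition g_chart :: "'a set \<Rightarrow> ('a \<Rightarrow> real^8) \<Rightarrow> 'a \<Rightarrow> real^8 \<Rightarrow>
    real^8 \<Rightarrow> real" where
  "g_chart U \<phi> p a b = g p (tvec_of U \<phi> p a) (tvec_of U \<phi> p b)"

definition J_chart :: "nat \<Rightarrow> 'a set \<Rightarrow> ('a \<Rightarrow> real^8) \<Rightarrow> 'a \<Rightarrow> real^8
    \<Rightarrow> real^8" where
  "J_chart k U \<phi> p a = (SOME c. J k p (tvec_of U \<phi> p a) = tvec_of U \<phi> p c)"

definition F_chart :: "'a set \<Rightarrow> ('a \<Rightarrow> real^8) \<Rightarrow> 'a \<Rightarrow> real^8 \<Rightarrow>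
    real^8 \<Rightarrow> real" where
  "F_chart U \<phi> p a b = g p (tvec_of U \<phi> p a) (J 1 p (tvec_of U \<phi> p b))"

context
  fixes U \<phi> p
  assumes U: "(U, \<phi>) \<in> A" and p: "p \<in> U"
begin

abbreviation (input) "tv \<equiv> tvec_of U \<phi> p"

lemma tv_tangent: "tv c \<in> tangent_space A p"
  by (rule tvec_of_tangent[OF U p])

lemma tv_add: "tv (c + d) = tv_lincomb 1 (tv c) 1 (tv d)"
  using tvec_of_lincomb[OF U p, of 1 c 1 d] by simp

lemma tv_scale: "tv (r *\<^sub>R c) = tv_lincomb r (tv c) 0 (tv c)"
  using tvec_of_lincomb[OF U p, of r c 0 c] by simp

lemma tv_minus: "tv (- c) = (\<lambda>f. - tv c f)"
  using tvec_of_lincomb[OF U p, of "-1" c 0 c] by (simp add: tv_lincomb_def)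

lemma tv_diff: "tv (c - d) = (\<lambda>f. tv c f - tv d f)"
  using tvec_of_lincomb[OF U p, of 1 c "-1" d] by (simp add: tv_lincomb_def)

lemma tv_inject: "tv c = tv d \<longleftrightarrow> c = d"
  using tvec_of_inj[OF U p] by blast

lemma tv_zero: "tv 0 = (\<lambda>f. 0)"
  using tvec_of_lincomb[OF U p, of 0 0 0 0] by (simp add: tv_lincomb_def)

lemma J_chart: "k \<in> {1, 2, 3} \<Longrightarrow> J k p (tv a) = tv (J_chart k U \<phi> p a)"
  unfolding J_chart_def using tvec_of_surj[OF U p J_tangent[OF _ tv_tangent]] by (metis (mono_tags, lifting) someI_ex)

lemma F_chart_eq: "F_chart U \<phi> p a b = g_chart U \<phi> p a (J_chart 1 U \<phi> p b)"
  by (simp add: F_chart_def g_chart_def J_chart)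

lemma hyperhermitian_chart:
  "hyperhermitian (g_chart U \<phi> p) (J_chart 1 U \<phi> p) (J_chart 2 U \<phi> p) (J_chart 3 U \<phi> p)"
proof (rule hyperhermitian.intro)
  note t = tv_tangent
  show "linear (\<lambda>u. g_chart U \<phi> p u v)" for v
    by (rule linearI) (simp_all add: g_chart_def tv_add tv_scale g_lincomb[OF t t t])
  show "g_chart U \<phi> p u v = g_chart U \<phi> p v u" for u v
    unfolding g_chart_def by (rule g_sym[OF t t])
  show "g_chart U \<phi> p u u > 0" if "u \<noteq> 0" for u
    unfolding g_chart_def by (rule g_pos[OF t]) (use that tv_inject[of u 0] in \<open>simp add: tv_zero\<close>)
  have lin: "linear (J_chart k U \<phi> p)" if k: "k \<in> {1, 2, 3}" for k
  proof (rule linearI)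
    show "J_chart k U \<phi> p (a + b) = J_chart k U \<phi> p a + J_chart k U \<phi> p b" for a b
      by (subst tv_inject[symmetric]) (simp only: J_chart[OF k, symmetric] tv_add J_lincomb[OF k t t])
    show "J_chart k U \<phi> p (r *\<^sub>R a) = r *\<^sub>R J_chart k U \<phi> p a" for r a
      by (subst tv_inject[symmetric]) (simp only: J_chart[OF k, symmetric] tv_scale J_lincomb[OF k t t])
  qed
  show "linear (J_chart 1 U \<phi> p)" "linear (J_chart 2 U \<phi> p)" "linear (J_chart 3 U \<phi> p)"
    by (rule lin; simp)+
  have sq: "J_chart k U \<phi> p (J_chart k U \<phi> p u) = - u" if k: "k \<in> {1, 2, 3}" for k u
    by (subst tv_inject[symmetric]) (simp only: J_chart[OF k, symmetric] tv_minus J_sq[OF k t])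
  show "J_chart 1 U \<phi> p (J_chart 1 U \<phi> p u) = - u" "J_chart 2 U \<phi> p (J_chart 2 U \<phi> p u) = - u"
    "J_chart 3 U \<phi> p (J_chart 3 U \<phi> p u) = - u" for u
    by (rule sq; simp)+
  have k: "(1::nat) \<in> {1, 2, 3}" "(2::nat) \<in> {1, 2, 3}" "(3::nat) \<in> {1, 2, 3}" by auto
  note Jc = J_chart[OF k(1), symmetric] J_chart[OF k(2), symmetric] J_chart[OF k(3), symmetric]
  show "J_chart 1 U \<phi> p (J_chart 2 U \<phi> p u) = J_chart 3 U \<phi> p u" for u
    by (subst tv_inject[symmetric]) (simp only: Jc J_mult(1)[OF t])
  show "J_chart 2 U \<phi> p (J_chart 1 U \<phi> p u) = - J_chart 3 U \<phi> p u" for u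
    by (subst tv_inject[symmetric]) (simp only: Jc tv_minus J_mult(2)[OF t])
  have iso: "g_chart U \<phi> p (J_chart k U \<phi> p u) (J_chart k U \<phi> p v) = g_chart U \<phi> p u v" if k: "k \<in> {1, 2, 3}" for k u v
    unfolding g_chart_def J_chart[OF k, symmetric] by (rule J_isometry[OF k t t])
  show "g_chart U \<phi> p (J_chart 1 U \<phi> p u) (J_chart 1 U \<phi> p v) = g_chart U \<phi> p u v"
    "g_chart U \<phi> p (J_chart 2 U \<phi> p u) (J_chart 2 U \<phi> p v) = g_chart U \<phi> p u v"
    "g_chart U \<phi> p (J_chart 3 U \<phi> p u) (J_chart 3 U \<phi> p v) = g_chart U \<phi> p u v" for u v
    by (rule iso; simp)+
qed

end

lemma normalizing_factor:
  assumes X: "X \<in> VF" and pos: "vf_inner g X X p > 0"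
  obtains k N where "k \<in> SF" "open N" "p \<in> N" "\<And>q. q \<in> N \<Longrightarrow> k q = inverse (sqrt (vf_inner g X X q))"
    "\<And>q. q \<in> N \<Longrightarrow> vf_inner g X X q > 0"
proof -
  let ?n = "vf_inner g X X"
  obtain U \<phi> where U: "(U, \<phi>) \<in> A" "p \<in> U" by (rule chart_exists)
  let ?W = "{q \<in> U. ?n q > 0}"
  have "?W = U \<inter> ?n -` {0<..}" by auto
  then have W: "open ?W" "p \<in> ?W" "?W \<subseteq> U"
    using open_Int[OF chart_open(1)[OF U(1)] open_vimage[OF open_greaterThan smooth_funs_continuous[OF g_smooth[OF X X]]]] U pos by auto
  have o: "open (\<phi> ` ?W)" by (rule chart_image_open[OF U(1) W(1,3)])
  have "smooth_on (\<phi> ` ?W) (\<lambda>x. inverse (sqrt (?n (inv_into U \<phi> x))))"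
    by (rule smooth_on_inverse_sqrt[OF o smooth_on_subset[OF smooth_funsD'[OF g_smooth[OF X X] U(1)]]])
      (use chart_inv[OF U(1)] in auto)
  then obtain k N where "k \<in> SF" "open N" "p \<in> N" "N \<subseteq> ?W" "\<And>q. q \<in> N \<Longrightarrow> k q =
      inverse (sqrt (?n (inv_into U \<phi> (\<phi> q))))"
    by (rule smooth_extension[OF U(1) W(2,1,3)]) blast
  then show ?thesis
    using chart_inv[OF U(1)] W(3) by (intro that[of k N]) (auto simp: subset_iff)
qed

lemma g_scale_scale: "u \<in> tangent_space A p \<Longrightarrow> g p (\<lambda>f. r * u f) (\<lambda>f. r * u f) = r * r * g p u u"
proof -
  assume u: "u \<in> tangent_space A p"
  have e: "(\<lambda>f. r * u f) = tv_lincomb r u 0 u" by (simp add: tv_lincomb_def)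
  have t: "tv_lincomb r u 0 u \<in> tangent_space A p" by (rule tangent_lincomb[OF u u])
  show ?thesis
    unfolding e using g_lincomb[OF u u t, of r 0] g_sym[OF u t] g_lincomb[OF u u u, of r 0] by simp
qed

lemma orthonormal_frame_exists: "\<exists>E W. p \<in> W \<and> orthonormal_frame_on A g W E"
proof -
  obtain U \<phi> where U: "(U, \<phi>) \<in> A" "p \<in> U" by (rule chart_exists)
  interpret H: hyperhermitian "g_chart U \<phi> p" "J_chart 1 U \<phi> p" "J_chart 2 U \<phi> p" "J_chart 3 U \<phi> p"
    by (rule hyperhermitian_chart[OF U])
  obtain e f where ef: "g_chart U \<phi> p e e = 1" "g_chart U \<phi> p f f = 1" "g_chart U \<phi> p e f = 0"
    "g_chart U \<phi> p e (J_chart 1 U \<phi> p f) = 0" "g_chart U \<phi> p e (J_chart 2 U \<phi> p f) = 0" "g_chart U \<phi> p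
        e (J_chart 3 U \<phi> p f) = 0"
    by (rule H.quaternionic_frame_exists)
  have t: "tvec_of U \<phi> p c \<in> tangent_space A p" for c by (rule tvec_of_tangent[OF U])
  define X where "X = vext p (tvec_of U \<phi> p e)"
  define Y where "Y = vext p (tvec_of U \<phi> p f)"
  have X: "X \<in> VF" "X p = tvec_of U \<phi> p e" and Y: "Y \<in> VF" "Y p = tvec_of U \<phi> p f"
    by (simp_all add: X_def Y_def vext[OF t])
  have "vf_inner g X X p > 0" using ef(1) by (simp add: vf_inner_def X g_chart_def)
  then obtain k N where k: "k \<in> SF" "open N" "p \<in> N" "\<And>q. q \<in> N \<Longrightarrow> k q = inverse (sqrt (vf_inner g X X q))"
    "\<And>q. q \<in> N \<Longrightarrow> vf_inner g X X q > 0"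
    by (rule normalizing_factor[OF X(1)]) blast
  define E0 where "E0 = vf_scale k X"
  have E0: "E0 \<in> VF" unfolding E0_def by (rule vf_scale_VF[OF k(1) X(1)])
  have JE: "vf_apply (J 1) E0 \<in> VF" "vf_apply (J 2) E0 \<in> VF" "vf_apply (J 3) E0 \<in> VF"
    by (rule J_VF[OF _ E0]; simp)+
  have E0p: "E0 p = tvec_of U \<phi> p e"
  proof -
    have "k p = 1" using k(4)[OF k(3)] ef(1) by (simp add: vf_inner_def X g_chart_def)
    then show ?thesis by (simp add: E0_def vf_scale_def X)
  qed
  have unit: "g q (E0 q) (E0 q) = 1" if "q \<in> N" for q
  proof -
    have "g q (E0 q) (E0 q) = k q * k q * vf_inner g X X q"
      using g_scale_scale[OF VF_tangent[OF X(1)], of q "k q"] by (simp add: E0_def vf_scale_def vf_inner_def)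
    then show ?thesis using k(5)[OF that] by (simp add: k(4)[OF that] field_simps)
  qed
  let ?P = "\<lambda>E. vf_scale (vf_inner g Y E) E"
  define Z where "Z = vf_diff Y (vf_add (vf_add (vf_add (?P E0) (?P (vf_apply (J 1) E0))) (?P (vf_apply (J 2) E0))) (?P (vf_apply (J 3) E0)))"
  have Z: "Z \<in> VF"
    unfolding Z_def by (intro vf_diff_VF vf_add_VF vf_scale_VF g_smooth Y E0 JE)
  have J123: "J k q (E0 q) = vf_apply (J k) E0 q" for k q by (simp add: vf_apply_def)
  have Zq: "Z q f = Y q f - (g q (Y q) (E0 q) * E0 q f + g q (Y q) (J 1 q (E0 q)) * J 1 q (E0 q) f
      + g q (Y q) (J 2 q (E0 q)) * J 2 q (E0 q) f + g q (Y q) (J 3 q (E0 q)) * J 3 q (E0 q) f)" for q f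
    by (simp add: Z_def vf_diff_def vf_add_def vf_scale_def vf_inner_def vf_apply_def)
  have k123: "(1::nat) \<in> {1, 2, 3}" "(2::nat) \<in> {1, 2, 3}" "(3::nat) \<in> {1, 2, 3}" by auto
  have "Z p = tvec_of U \<phi> p f"
  proof -
    have "g p (Y p) (E0 p) = 0" using ef(3) H.G_sym[of f e] by (simp add: Y E0p g_chart_def)
    moreover have "g p (Y p) (J 1 p (E0 p)) = 0" "g p (Y p) (J 2 p (E0 p)) = 0" "g p (Y p) (J 3 p (E0 p)) = 0"
      unfolding Y E0p J_chart[OF U k123(1)] J_chart[OF U k123(2)] J_chart[OF U k123(3)] g_chart_def[symmetric]
      using ef(4-6) H.G_J_left[of e f] H.G_sym[of f "J_chart 1 U \<phi> p e"] H.G_sym[of f "J_chart 2 U \<phi> p e"] H.G_sym[of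
          f "J_chart 3 U \<phi> p e"]
      by simp_all
    ultimately show ?thesis by (intro ext) (simp add: Zq Y)
  qed
  then have "vf_inner g Z Z p > 0" using ef(2) by (simp add: vf_inner_def g_chart_def)
  then obtain l M where l: "l \<in> SF" "open M" "p \<in> M" "\<And>q. q \<in> M \<Longrightarrow> l q = inverse (sqrt (vf_inner g Z Z q))"
    "\<And>q. q \<in> M \<Longrightarrow> vf_inner g Z Z q > 0"
    by (rule normalizing_factor[OF Z]) blast
  define E4 where "E4 = vf_scale l Z"
  have E4: "E4 \<in> VF" unfolding E4_def by (rule vf_scale_VF[OF l(1) Z])
  have JE4: "vf_apply (J 1) E4 \<in> VF" "vf_apply (J 2) E4 \<in> VF" "vf_apply (J 3) E4 \<in> VF"
    by (rule J_VF[OF _ E4]; simp)+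
  have unit4: "g q (E4 q) (E4 q) = 1" if "q \<in> M" for q
  proof -
    have "g q (E4 q) (E4 q) = l q * l q * vf_inner g Z Z q"
      using g_scale_scale[OF VF_tangent[OF Z], of q "l q"] by (simp add: E4_def vf_scale_def vf_inner_def)
    then show ?thesis using l(5)[OF that] by (simp add: l(4)[OF that] field_simps)
  qed
  define E :: "8 \<Rightarrow> 'a vfield" where "E i = (if i = 0 then E0 else if i = 1 then vf_apply (J 1) E0 else if i = 2 then vf_apply (J 2) E0
    else if i = 3 then vf_apply (J 3) E0 else if i = 4 then E4 else if i = 5 then vf_apply (J 1) E4
    else if i = 6 then vf_apply (J 2) E4 else vf_apply (J 3) E4)" for i
  have "vf_inner g (E i) (E j) q = (if i = j then 1 else 0)" if q: "q \<in> N \<inter> M" for i j q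
  proof -
    obtain V \<psi> where V: "(V, \<psi>) \<in> A" "q \<in> V" by (rule chart_exists)
    interpret K: hyperhermitian "g_chart V \<psi> q" "J_chart 1 V \<psi> q" "J_chart 2 V \<psi> q" "J_chart 3 V \<psi> q"
      by (rule hyperhermitian_chart[OF V])
    note Jc = J_chart[OF V k123(1)] J_chart[OF V k123(2)] J_chart[OF V k123(3)]
    obtain a where a: "E0 q = tvec_of V \<psi> q a" by (rule tvec_of_surj[OF V VF_tangent[OF E0]])
    obtain y where y: "Y q = tvec_of V \<psi> q y" by (rule tvec_of_surj[OF V VF_tangent[OF Y(1)]])
    let ?G = "g_chart V \<psi> q"
    let ?z = "y - (?G y a *\<^sub>R a + ?G y (J_chart 1 V \<psi> q a) *\<^sub>R J_chart 1 V \<psi> q a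
      + ?G y (J_chart 2 V \<psi> q a) *\<^sub>R J_chart 2 V \<psi> q a + ?G y (J_chart 3 V \<psi> q a) *\<^sub>R J_chart 3 V \<psi> q a)"
    have z: "Z q = tvec_of V \<psi> q ?z"
      by (rule ext) (simp add: Zq a y Jc g_chart_def[symmetric] tv_add[OF V] tv_scale[OF V] tv_diff[OF V] tv_lincomb_def del: One_nat_def)
    let ?b = "l q *\<^sub>R ?z"
    have b: "E4 q = tvec_of V \<psi> q ?b"
      unfolding tv_scale[OF V] by (simp add: E4_def vf_scale_def z tv_lincomb_def)
    have aa: "?G a a = 1" using unit[of q] q by (simp add: a g_chart_def)
    have bb: "?G ?b ?b = 1" using unit4[of q] q unfolding b g_chart_def by simp
    note proj = K.quaternionic_projection[OF aa, of y]
    have orth: "?G a ?b = 0" "?G a (J_chart 1 V \<psi> q ?b) = 0" "?G a (J_chart 2 V \<psi> q ?b) = 0" "?G a (J_chart 3 V \<psi> q ?b) = 0"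
      unfolding linear_scale[OF K.J_linear(1)] linear_scale[OF K.J_linear(2)] linear_scale[OF K.J_linear(3)] K.G_scale proj
      by simp_all
    have on: "K.orthonormal (K.quaternionic_frame a ?b)"
      by (rule K.quaternionic_frame_orthonormal[OF aa bb orth])
    have "E i q = tvec_of V \<psi> q (K.quaternionic_frame a ?b i)" for i
      using exhaust_8[of i]
      by (elim disjE; hypsubst) (simp_all add: E_def K.quaternionic_frame_def vf_apply_def a b Jc del: One_nat_def)
    then have "vf_inner g (E i) (E j) q = ?G (K.quaternionic_frame a ?b i) (K.quaternionic_frame a ?b j)"
      by (simp only: vf_inner_def g_chart_def)
    then show ?thesis using on by (simp add: K.orthonormal_def)
  qed
  then have "orthonormal_frame_on A g (N \<inter> M) E"
    using k(2) l(2) E0 JE E4 JE4 by (auto simp: orthonormal_frame_on_def E_def)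
  then show ?thesis using k(3) l(3) by blast
qed

lemma interior_mult_frame:
  obtains E :: "8 \<Rightarrow> 'a vfield" where "\<And>i. E i \<in> VF" "\<And>i j. vf_inner g (E i) (E j) p = (if i = j then 1 else 0)"
    "\<And>F b X Y. interior_mult A g F b X Y p = 1 / 2 * (\<Sum>i\<in>UNIV. \<Sum>j\<in>UNIV. F (E i) (E j) p * b (E i) (E j) X Y p)"
proof -
  define E where "E = (SOME E. \<exists>W. p \<in> W \<and> orthonormal_frame_on A g W E)"
  have "\<exists>W. p \<in> W \<and> orthonormal_frame_on A g W E"
    unfolding E_def by (rule someI_ex[OF orthonormal_frame_exists])
  then obtain W where W: "p \<in> W" "orthonormal_frame_on A g W E" by blast
  show ?thesis
  proof (rule that)
    show "E i \<in> VF" for i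
      using W(2) unfolding orthonormal_frame_on_def by blast
    show "vf_inner g (E i) (E j) p = (if i = j then 1 else 0)" for i j
      using W unfolding orthonormal_frame_on_def by blast
    show "interior_mult A g F b X Y p = 1 / 2 * (\<Sum>i\<in>UNIV. \<Sum>j\<in>UNIV. F (E i) (E j) p * b (E i) (E j) X Y p)" for F b X Y
      by (simp only: interior_mult_def Let_def E_def)
  qed
qed

end

context ahkt_manifold
begin

abbreviation "T_comp U \<phi> i j k x \<equiv> T_chart U \<phi> x (axis i 1) (axis j 1) (axis k 1)"
abbreviation "dT_comp U \<phi> i j k l x \<equiv> dT_chart U \<phi> x (axis i 1) (axis j 1) (axis k 1) (axis l 1)"

definition dh_chart :: "'a set \<Rightarrow> ('a \<Rightarrow> real^8) \<Rightarrow> ('a \<Rightarrow> real) \<Rightarrow>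
    real^8 \<Rightarrow> real^8 \<Rightarrow> real" where
  "dh_chart U \<phi> h x v = tvec_of U \<phi> (inv_into U \<phi> x) v h"

text \<open>The sign of \<open>(F\<^sup>1)\<^sup>4\<close> orients the charts.\<close>

definition orientation :: "'a set \<Rightarrow> ('a \<Rightarrow> real^8) \<Rightarrow> real^8 \<Rightarrow> real" where
  "orientation U \<phi> x = sgn (wedge2222 (F_chart U \<phi> (inv_into U \<phi> x)) (\<lambda>i. axis i 1))"

definition flux :: "'a set \<Rightarrow> ('a \<Rightarrow> real^8) \<Rightarrow> ('a \<Rightarrow> real) \<Rightarrow> real^8
    \<Rightarrow> real" where
  "flux U \<phi> h x = orientation U \<phi> x * wedge134 (dh_chart U \<phi> h x) (T_chart U \<phi> x) (dT_chart U \<phi> x) (\<lambda>i. axis i 1)"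

definition source :: "'a set \<Rightarrow> ('a \<Rightarrow> real^8) \<Rightarrow> real^8 \<Rightarrow> real" where
  "source U \<phi> x = orientation U \<phi> x * wedge44 (dT_chart U \<phi> x) (\<lambda>i. axis i 1) / 4"

lemma linear3_T_chart: "(U, \<phi>) \<in> A \<Longrightarrow> x \<in> \<phi> ` U \<Longrightarrow> linear3 (T_chart U \<phi> x)"
  unfolding linear3_def by (intro conjI allI T_chart_props)

lemma linear4_dT_chart: "(U, \<phi>) \<in> A \<Longrightarrow> x \<in> \<phi> ` U \<Longrightarrow> linear4 (dT_chart U \<phi> x)"
  unfolding linear4_def by (intro conjI allI dT_chart_props)

lemma alternating4_dT_chart: "(U, \<phi>) \<in> A \<Longrightarrow> x \<in> \<phi> ` U \<Longrightarrow> alternating4 (dT_chart U \<phi> x)"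
  unfolding alternating4_def by (intro conjI allI dT_chart_props)

lemma linear_dh_chart:
  assumes U: "(U, \<phi>) \<in> A" and x: "x \<in> \<phi> ` U"
  shows "linear (dh_chart U \<phi> h x)"
proof -
  have q: "inv_into U \<phi> x \<in> U" using x by (rule inv_into_into)
  show ?thesis
    by (rule linearI) (simp_all add: dh_chart_def tv_add[OF U q] tv_scale[OF U q] tv_lincomb_def)
qed

lemma F_chart_continuous:
  assumes U: "(U, \<phi>) \<in> A"
  shows "continuous_on (\<phi> ` U) (\<lambda>x. F_chart U \<phi> (inv_into U \<phi> x) (axis i 1) (axis j 1))"
proof (rule smooth_on_continuous, rule smooth_on_local)
  fix y assume "y \<in> \<phi> ` U"
  then obtain p where p: "y = \<phi> p" "p \<in> U" by (rule imageE)
  obtain N x E where fr: "chart_frame U \<phi> N x E" "p \<in> N" by (rule chart_frame_exists[OF U p(2)])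
  note fr' = fr(1)[unfolded chart_frame_def]
  have E: "E i \<in> VF" and Et: "\<And>q. q \<in> N \<Longrightarrow> E i q = tvec_of U \<phi> q (axis i 1)" for i using fr' by blast+
  have N: "open N" "N \<subseteq> U" using fr' by blast+
  have o: "open (\<phi> ` N)" by (rule chart_image_open[OF U N])
  have inv: "inv_into U \<phi> (\<phi> q) = q" if "q \<in> N" for q using chart_inv[OF U] N that by blast
  have sf: "vf_inner g (E i) (vf_apply (J 1) (E j)) \<in> SF"
    by (rule g_smooth[OF E J_VF[OF _ E]]) simp
  have "smooth_on (\<phi> ` N) (\<lambda>x. vf_inner g (E i) (vf_apply (J 1) (E j)) (inv_into U \<phi> x))"
    by (rule smooth_on_subset[OF smooth_funsD'[OF sf U]]) (use N in blast)
  then have "smooth_on (\<phi> ` N) (\<lambda>x. F_chart U \<phi> (inv_into U \<phi> x) (axis i 1) (axis j 1))"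
    by (rule smooth_on_cong[OF o, rotated]) (auto simp: inv F_chart_def vf_inner_def vf_apply_def Et)
  then show "\<exists>T. open T \<and> y \<in> T \<and> smooth_on T (\<lambda>x. F_chart U \<phi> (inv_into U \<phi> x) (axis i 1) (axis j 1))"
    using o p fr(2) by blast
qed

lemma F_chart_nonzero:
  assumes U: "(U, \<phi>) \<in> A" and q: "q \<in> U"
  shows "wedge2222 (F_chart U \<phi> q) (\<lambda>i. axis i 1) \<noteq> 0"
proof -
  interpret hyperhermitian "g_chart U \<phi> q" "J_chart 1 U \<phi> q" "J_chart 2 U \<phi> q" "J_chart 3 U \<phi> q"
    by (rule hyperhermitian_chart[OF U q])
  have "F_chart U \<phi> q = (\<lambda>u v. kaehler1 u v)" by (intro ext) (rule F_chart_eq[OF U q])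
  then show ?thesis using wedge2222_kaehler1_nonzero by simp
qed

lemma orientation_locally_constant:
  assumes U: "(U, \<phi>) \<in> A" and x: "x \<in> \<phi> ` U"
  obtains N where "open N" "x \<in> N" "N \<subseteq> \<phi> ` U" "\<And>y. y \<in> N \<Longrightarrow> orientation U \<phi> y
      = orientation U \<phi> x"
proof -
  let ?w = "\<lambda>x. wedge2222 (F_chart U \<phi> (inv_into U \<phi> x)) (\<lambda>i. axis i 1)"
  have c: "continuous_on (\<phi> ` U) ?w"
    unfolding wedge2222_def by (intro asum_continuous_on continuous_on_mult F_chart_continuous[OF U])
  have nz: "?w x \<noteq> 0" if "x \<in> \<phi> ` U" for x
    by (rule F_chart_nonzero[OF U]) (use that in \<open>simp add: inv_into_into\<close>)
  obtain N where N: "open N" "x \<in> N" "N \<subseteq> \<phi> ` U" "\<And>y. y \<in> N \<Longrightarrow> sgn (?w y) = sgn (?w x)"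
    using sgn_locally_constant[OF chart_open(2)[OF U] c nz x] by blast
  show ?thesis
    by (rule that[OF N(1-3)]) (unfold orientation_def, rule N(4))
qed

lemma orientation_smooth:
  assumes U: "(U, \<phi>) \<in> A"
  shows "smooth_on (\<phi> ` U) (orientation U \<phi>)"
proof (rule smooth_on_local)
  fix x assume x: "x \<in> \<phi> ` U"
  obtain N where N: "open N" "x \<in> N" "N \<subseteq> \<phi> ` U" "\<And>y. y \<in> N \<Longrightarrow> orientation U \<phi>
      y = orientation U \<phi> x"
    by (rule orientation_locally_constant[OF U x]) blast
  have "smooth_on N (orientation U \<phi>)"
    by (rule smooth_on_cong[OF N(1) _ smooth_on_const[OF N(1), of "orientation U \<phi> x"]]) (simp add: N(4))
  then show "\<exists>T. open T \<and> x \<in> T \<and> smooth_on T (orientation U \<phi>)" using N by blast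
qed

lemma dh_chart_eq:
  assumes "(U, \<phi>) \<in> A" "x \<in> \<phi> ` U" "h \<in> SF"
  shows "dh_chart U \<phi> h x v = frechet_derivative (\<lambda>x. h (inv_into U \<phi> x)) (at x) v"
  using assms by (auto simp: dh_chart_def tvec_of_def chart_inv comp_def)

lemma flux_continuous:
  assumes U: "(U, \<phi>) \<in> A" and h: "h \<in> SF"
  shows "continuous_on (\<phi> ` U) (flux U \<phi> h)"
proof -
  have "smooth_on (\<phi> ` U) (\<lambda>x. dh_chart U \<phi> h x (axis i 1))" for i
    by (rule smooth_on_cong[OF chart_open(2)[OF U] _ smooth_on_frechet_derivative[OF smooth_funsD'[OF h U]]])
      (simp add: dh_chart_eq[OF U _ h])
  then show ?thesis
    unfolding flux_def wedge134_def
    by (intro continuous_on_mult asum_continuous_on smooth_on_continuous orientation_smooth T_chart_smooth U)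
qed

lemma source_continuous:
  assumes U: "(U, \<phi>) \<in> A"
  shows "continuous_on (\<phi> ` U) (source U \<phi>)"
  unfolding source_def wedge44_def
  by (intro continuous_on_mult continuous_on_divide continuous_on_const asum_continuous_on
      smooth_on_continuous orientation_smooth T_chart_smooth U) simp

lemma chart_change:
  assumes U: "(U, \<phi>) \<in> A" and V: "(V, \<psi>) \<in> A" and q: "q \<in> U" "q \<in> V"
  defines "L \<equiv> frechet_derivative (\<psi> \<circ> inv_into U \<phi>) (at (\<phi> q))"
  shows "T_chart U \<phi> (\<phi> q) a b c = T_chart V \<psi> (\<psi> q) (L a) (L b) (L c)"
    and "dT_chart U \<phi> (\<phi> q) a b c d = dT_chart V \<psi> (\<psi> q) (L a) (L b) (L c) (L d)"
    and "F_chart U \<phi> q a b = F_chart V \<psi> q (L a) (L b)"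
    and "dh_chart U \<phi> h (\<phi> q) a = dh_chart V \<psi> h (\<psi> q) (L a)"
  using tvec_of_transition[OF U V q] chart_inv[OF U q(1)] chart_inv[OF V q(2)]
  by (simp_all add: T_chart_def dT_chart_def F_chart_def dh_chart_def Let_def L_def)

lemma flux_transition:
  assumes U: "(U, \<phi>) \<in> A" and V: "(V, \<psi>) \<in> A" and q: "q \<in> U" "q \<in> V"
  defines "L \<equiv> frechet_derivative (\<psi> \<circ> inv_into U \<phi>) (at (\<phi> q))"
  shows "flux U \<phi> h (\<phi> q) = \<bar>det (matrix L)\<bar> * flux V \<psi> h (\<psi> q)"
proof -
  let ?A = "\<chi> i. L (axis i 1)"
  have "matrix L = transpose ?A" by (simp add: matrix_def transpose_def)
  then have det: "det (matrix L) = det ?A" by (simp add: det_transpose)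
  have y: "\<psi> q \<in> \<psi> ` V" using q by simp
  note ch = chart_change[OF U V q, folded L_def]
  interpret K: hyperhermitian "g_chart V \<psi> q" "J_chart 1 V \<psi> q" "J_chart 2 V \<psi> q" "J_chart 3 V \<psi> q"
    by (rule hyperhermitian_chart[OF V q(2)])
  have F: "F_chart V \<psi> q = (\<lambda>u v. K.kaehler1 u v)" by (intro ext) (rule F_chart_eq[OF V q(2)])
  have "wedge2222 (F_chart U \<phi> q) (\<lambda>i. axis i 1) = wedge2222 (F_chart V \<psi> q) (\<lambda>i. ?A $ i)"
    by (simp add: wedge2222_def ch)
  also have "\<dots> = det ?A * wedge2222 (F_chart V \<psi> q) (\<lambda>i. axis i 1)"
    unfolding F by (rule wedge2222_det[OF K.kaehler1_linear])
  finally have o: "orientation U \<phi> (\<phi> q) = sgn (det ?A) * orientation V \<psi> (\<psi> q)"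
    using chart_inv[OF U q(1)] chart_inv[OF V q(2)] by (simp add: orientation_def sgn_mult)
  have "wedge134 (dh_chart U \<phi> h (\<phi> q)) (T_chart U \<phi> (\<phi> q)) (dT_chart U \<phi> (\<phi> q)) (\<lambda>i. axis i 1)
      = wedge134 (dh_chart V \<psi> h (\<psi> q)) (T_chart V \<psi> (\<psi> q)) (dT_chart V \<psi> (\<psi> q)) (\<lambda>i. ?A $ i)"
    by (simp add: wedge134_def ch)
  also have "\<dots> = det ?A * wedge134 (dh_chart V \<psi> h (\<psi> q)) (T_chart V \<psi> (\<psi> q)) (dT_chart V \<psi>
      (\<psi> q)) (\<lambda>i. axis i 1)"
    by (rule wedge134_det[OF linear_dh_chart[OF V y] linear3_T_chart[OF V y] linear4_dT_chart[OF V y]])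
  finally show ?thesis
    unfolding flux_def o det by (simp add: abs_sgn mult_ac)
qed

lemma flux_sum:
  assumes U: "(U, \<phi>) \<in> A" and x: "x \<in> \<phi> ` U" and I: "finite I" "\<And>i. i \<in> I \<Longrightarrow> h i \<in> SF"
  shows "flux U \<phi> (\<lambda>p. \<Sum>i\<in>I. h i p) x = (\<Sum>i\<in>I. flux U \<phi> (h i) x)"
proof -
  have "dh_chart U \<phi> (\<lambda>p. \<Sum>i\<in>I. h i p) x v = (\<Sum>i\<in>I. dh_chart U \<phi> (h i) x v)" for v
    unfolding dh_chart_def by (rule tangent_sum[OF tvec_of_tangent[OF U] I(2)]) (use x in \<open>simp_all add: inv_into_into\<close>)
  then have "dh_chart U \<phi> (\<lambda>p. \<Sum>i\<in>I. h i p) x = (\<lambda>v. \<Sum>i\<in>I. dh_chart U \<phi> (h i) x v)" by auto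
  then show ?thesis by (simp add: flux_def wedge134_sum[OF I(1)] sum_distrib_left)
qed

lemma flux_const:
  assumes U: "(U, \<phi>) \<in> A" and x: "x \<in> \<phi> ` U"
  shows "flux U \<phi> (\<lambda>p. c) x = 0"
proof -
  have "dh_chart U \<phi> (\<lambda>p. c) x = (\<lambda>v. 0)"
    unfolding dh_chart_def by (intro ext tangent_const[OF tvec_of_tangent[OF U]]) (use x in \<open>simp add: inv_into_into\<close>)
  then show ?thesis by (simp add: flux_def wedge134_def asum_zero)
qed

lemma flux_local:
  assumes U: "(U, \<phi>) \<in> A" and h: "h \<in> SF" and W: "open W" "q \<in> W" "W \<subseteq> U" "\<And>r. r \<in> W \<Longrightarrow> h r = 0"
  shows "flux U \<phi> h (\<phi> q) = 0"
proof -
  have q: "q \<in> U" using W by blast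
  have "tvec_of U \<phi> q v h = 0" for v
    using tangent_local[OF tvec_of_tangent[OF U q] h smooth_funs_const[of 0] W(1,2), of v] W(4)
      tangent_const[OF tvec_of_tangent[OF U q], of v 0] by simp
  then have "dh_chart U \<phi> h (\<phi> q) = (\<lambda>v. 0)"
    using chart_inv[OF U q] by (auto simp: dh_chart_def)
  then show ?thesis by (simp add: flux_def wedge134_def asum_zero)
qed

lemma dT_comp_derivative:
  assumes U: "(U, \<phi>) \<in> A" and x: "x \<in> \<phi> ` U"
  defines "dd \<equiv> \<lambda>m l i j k. frechet_derivative (\<lambda>y. frechet_derivative (T_comp U \<phi> i j k) (at y)
      (axis l 1)) (at x) (axis m 1)"
  shows "frechet_derivative (dT_comp U \<phi> l i j k) (at x) (axis m 1)
    = dd m l i j k - dd m i l j k + dd m j l i k - dd m k l i j"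
    and "dd m l i j k = dd l m i j k"
proof -
  let ?d = "\<lambda>l i j k y. frechet_derivative (T_comp U \<phi> i j k) (at y) (axis l 1)"
  have o: "open (\<phi> ` U)" by (rule chart_open(2)[OF U])
  have D: "(?d l i j k has_derivative frechet_derivative (?d l i j k) (at x)) (at x)" for l i j k
    by (rule smooth_on_has_derivative[OF smooth_on_frechet_derivative[OF T_chart_smooth(1)[OF U]] x])
  have "frechet_derivative (dT_comp U \<phi> l i j k) (at x)
      = frechet_derivative (\<lambda>y. ?d l i j k y - ?d i l j k y + ?d j l i k y - ?d k l i j y) (at x)"
    by (rule frechet_derivative_cong[OF o x]) (rule dT_chart_eq[OF U])
  also have "\<dots> = (\<lambda>v. frechet_derivative (?d l i j k) (at x) v - frechet_derivative (?d i l j k) (at x) v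
      + frechet_derivative (?d j l i k) (at x) v - frechet_derivative (?d k l i j) (at x) v)"
    by (rule frechet_derivative_at[symmetric]) (intro has_derivative_add has_derivative_diff D)
  finally show "frechet_derivative (dT_comp U \<phi> l i j k) (at x) (axis m 1)
    = dd m l i j k - dd m i l j k + dd m j l i k - dd m k l i j"
    by (simp add: dd_def)
  show "dd m l i j k = dd l m i j k"
    unfolding dd_def by (rule smooth_on_mixed_derivatives[OF o T_chart_smooth(1)[OF U] x])
qed

lemma flux_integral:
  assumes U: "(U, \<phi>) \<in> A" and h: "h \<in> SF" and K: "compact K" "K \<subseteq> U" and h0: "\<And>q. q \<notin> K \<Longrightarrow> h q = 0"
  shows "integral UNIV (ext0 (\<phi> ` U) (\<lambda>x. flux U \<phi> h x + h (inv_into U \<phi> x) * source U \<phi> x)) = 0"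
proof -
  let ?S = "\<phi> ` U"
  let ?h = "\<lambda>x. h (inv_into U \<phi> x)"
  let ?T = "\<lambda>p :: 8 \<Rightarrow> 8. T_comp U \<phi> (p 1) (p 2) (p 3)"
  let ?B = "\<lambda>p :: 8 \<Rightarrow> 8. dT_comp U \<phi> (p 4) (p 5) (p 6) (p 7)"
  let ?w = "\<lambda>(p :: 8 \<Rightarrow> 8) x. orientation U \<phi> x * (?h x * (?T p x * ?B p x))"
  let ?D = "\<lambda>f x v. frechet_derivative f (at x) v"
  have o: "open ?S" by (rule chart_open(2)[OF U])
  have sh: "smooth_on ?S ?h" by (rule smooth_funsD'[OF h U])
  have sT: "smooth_on ?S (?T p)" for p by (rule T_chart_smooth(1)[OF U])
  have sB: "smooth_on ?S (?B p)" for p by (rule T_chart_smooth(2)[OF U])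
  have sw: "smooth_on ?S (?w p)" for p
    by (intro smooth_on_mult o orientation_smooth[OF U] sh sT sB)
  have w0: "?w p (\<phi> q) = 0" if "q \<in> U" "q \<notin> K" for p q
    using chart_inv[OF U that(1)] h0[OF that(2)] by simp
  let ?f = "\<lambda>p. ext0 ?S (?w p)"
  have sf: "smooth_on UNIV (?f p)" for p
    by (rule ext0_smooth[where w = "?w p", OF U K sw w0])
  have int: "((\<lambda>x. ?D (?f p) x (axis (p 0) 1)) has_integral 0) UNIV" for p
  proof (rule has_integral_derivative_compact_support[where f = "?f p"
        and f' = "\<lambda>x. frechet_derivative (?f p) (at x)" and v = "axis (p 0) 1"])
    show "compact (\<phi> ` K)" by (rule chart_image_compact[OF U K])
    show "(?f p has_derivative frechet_derivative (?f p) (at x)) (at x)" for x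
      by (rule smooth_on_has_derivative[OF sf UNIV_I])
    show "continuous_on UNIV (\<lambda>x. ?D (?f p) x (axis (p 0) 1))"
      by (rule smooth_on_continuous[OF smooth_on_frechet_derivative[OF sf]])
    show "?f p x = 0" if "x \<notin> \<phi> ` K" for x
      by (rule ext0_local[where w = "?w p", OF U K w0 that])
  qed
  have "((\<lambda>x. \<Sum>p | p permutes (UNIV :: 8 set). of_int (sign p) * ?D (?f p) x (axis (p 0) 1)) has_integral
      (\<Sum>p | p permutes (UNIV :: 8 set). of_int (sign p) * 0)) UNIV"
    by (intro has_integral_sum has_integral_mult_right int) simp
  then have int0: "integral UNIV (\<lambda>x. asum (\<lambda>p. ?D (?f p) x (axis (p 0) 1))) = 0"
    by (simp add: asum_def integral_unique)
  have "asum (\<lambda>p. ?D (?f p) x (axis (p 0) 1)) = ext0 ?S (\<lambda>x. flux U \<phi> h x + ?h x * source U \<phi> x) x" for x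
  proof (cases "x \<in> ?S")
    case x: True
    obtain N where N: "open N" "x \<in> N" "N \<subseteq> ?S" "\<And>y. y \<in> N \<Longrightarrow> orientation U \<phi> y = orientation U \<phi> x"
      by (rule orientation_locally_constant[OF U x]) blast
    let ?s = "orientation U \<phi> x"
    have der: "?D (?f p) x v = ?s * (?D ?h x v * ?T p x * ?B p x + ?h x * (?D (?T p) x v * ?B p x) + ?h x * (?T p x * ?D (?B p) x v))" for p v
    proof -
      have "frechet_derivative (?f p) (at x) = frechet_derivative (\<lambda>y. ?s * (?h y * (?T p y * ?B p y))) (at x)"
        by (rule frechet_derivative_cong[OF N(1,2)]) (use N(3,4) in \<open>auto simp: ext0_def\<close>)
      also have "\<dots> = (\<lambda>v. ?s * (?h x * (?T p x * ?D (?B p) x v + ?D (?T p) x v * ?B p x) + ?D ?h x v * (?T p x * ?B p x)))"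
        by (rule frechet_derivative_at[symmetric])
          (intro has_derivative_mult_right has_derivative_mult smooth_on_has_derivative[OF sh x]
            smooth_on_has_derivative[OF sT x] smooth_on_has_derivative[OF sB x])
      finally show ?thesis by (simp add: algebra_simps)
    qed
    let ?d = "\<lambda>l i j k. ?D (T_comp U \<phi> i j k) x (axis l 1)"
    let ?dd = "\<lambda>m l i j k. ?D (\<lambda>y. ?D (T_comp U \<phi> i j k) y (axis l 1)) x (axis m 1)"
    have B: "asum (\<lambda>p. ?T p x * ?D (?B p) x (axis (p 0) 1)) = 0"
      unfolding dT_comp_derivative(1)[OF U x]
      using asum_second_exterior_derivative[of ?dd "\<lambda>i j k. T_comp U \<phi> i j k x", OF dT_comp_derivative(2)[OF U x]] .
    have "wedge44 (dT_chart U \<phi> x) (\<lambda>i. axis i 1)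
        = asum (\<lambda>p. (?d (p 0) (p 1) (p 2) (p 3) - ?d (p 1) (p 0) (p 2) (p 3) + ?d (p 2) (p 0) (p 1) (p 3) - ?d (p 3) (p
            0) (p 1) (p 2)) * ?B p x)"
      unfolding wedge44_def by (rule asum_cong) (simp only: dT_chart_eq[OF U x])
    also have "\<dots> = 4 * asum (\<lambda>p. ?D (?T p) x (axis (p 0) 1) * ?B p x)"
      by (rule asum_exterior_derivative[of ?d "\<lambda>i j k l. dT_comp U \<phi> i j k l x"])
    finally have T: "asum (\<lambda>p. ?D (?T p) x (axis (p 0) 1) * ?B p x) = wedge44 (dT_chart U \<phi> x) (\<lambda>i. axis i 1) / 4"
      by simp
    have H: "asum (\<lambda>p. ?D ?h x (axis (p 0) 1) * ?T p x * ?B p x) = wedge134 (dh_chart U \<phi> h x) (T_chart U \<phi>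
        x) (dT_chart U \<phi> x) (\<lambda>i. axis i 1)"
      unfolding wedge134_def by (simp only: dh_chart_eq[OF U x h])
    have "asum (\<lambda>p. ?D (?f p) x (axis (p 0) 1)) = flux U \<phi> h x + ?h x * source U \<phi> x"
      unfolding der asum_cmult asum_add B T H by (simp add: flux_def source_def algebra_simps)
    then show ?thesis using x by (simp add: ext0_def)
  next
    case False
    then have x: "x \<in> - \<phi> ` K" using K by blast
    have "frechet_derivative (?f p) (at x) = frechet_derivative (\<lambda>y. 0) (at x)" for p
      by (rule frechet_derivative_cong[OF open_Compl[OF compact_imp_closed[OF chart_image_compact[OF U K]]] x])
        (use ext0_local[where w = "?w p", OF U K w0] in auto)
    then have "?D (?f p) x v = 0" for p v by simp
    then show ?thesis using False by (simp add: ext0_def asum_zero)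
  qed
  then show ?thesis using int0 by simp
qed

lemma interior_mult_zero_pointwise:
  assumes contr: "\<And>k X Y. k \<in> {1, 2, 3} \<Longrightarrow> X \<in> VF \<Longrightarrow> Y \<in> VF \<Longrightarrow>
      interior_mult A g (kaehler_form g (J k)) \<beta> X Y q = 0"
    and U: "(U, \<phi>) \<in> A" and q: "q \<in> U"
  shows "source U \<phi> (\<phi> q) \<ge> 0"
    and "source U \<phi> (\<phi> q) = 0 \<Longrightarrow> dT_chart U \<phi> (\<phi> q) a b c d = 0"
proof -
  interpret H: hyperhermitian "g_chart U \<phi> q" "J_chart 1 U \<phi> q" "J_chart 2 U \<phi> q" "J_chart 3 U \<phi> q"
    by (rule hyperhermitian_chart[OF U q])
  have x: "\<phi> q \<in> \<phi> ` U" using q by simp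
  have inv: "inv_into U \<phi> (\<phi> q) = q" by (rule chart_inv[OF U q])
  have F: "F_chart U \<phi> q = (\<lambda>u v. H.kaehler1 u v)" by (intro ext) (rule F_chart_eq[OF U q])
  obtain E :: "8 \<Rightarrow> 'a vfield" where E: "\<And>i. E i \<in> VF" "\<And>i j. vf_inner g (E i) (E j) q = (if i = j then 1 else 0)"
    "\<And>F b X Y. interior_mult A g F b X Y q = 1 / 2 * (\<Sum>i\<in>UNIV. \<Sum>j\<in>UNIV. F (E i) (E j) q * b (E i) (E j) X Y q)"
    by (rule interior_mult_frame) blast
  have "\<exists>c. E i q = tvec_of U \<phi> q c" for i
    using tvec_of_surj[OF U q VF_tangent[OF E(1)]] by metis
  then obtain v where v: "\<And>i. E i q = tvec_of U \<phi> q (v i)" by metis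
  have on: "H.orthonormal v"
    using E(2) by (simp add: H.orthonormal_def vf_inner_def v g_chart_def)
  have c: "(\<Sum>i\<in>UNIV. \<Sum>j\<in>UNIV. g_chart U \<phi> q (v i) (J_chart k U \<phi> q (v j)) * dT_chart U \<phi>
      (\<phi> q) (v i) (v j) X Y) = 0"
    if k: "k \<in> {1, 2, 3}" for k X Y
  proof -
    let ?X = "vext q (tvec_of U \<phi> q X)" and ?Y = "vext q (tvec_of U \<phi> q Y)"
    note XY = vext[OF tvec_of_tangent[OF U q, of X]] vext[OF tvec_of_tangent[OF U q, of Y]]
    have "kaehler_form g (J k) (E i) (E j) q * \<beta> (E i) (E j) ?X ?Y q
        = g_chart U \<phi> q (v i) (J_chart k U \<phi> q (v j)) * dT_chart U \<phi> (\<phi> q) (v i) (v j) X Y" for i j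
      unfolding dT_at_eq[OF E(1) E(1) XY(1,3), symmetric]
      by (simp add: kaehler_form_def vf_inner_def vf_apply_def v J_chart[OF U q k] g_chart_def dT_chart_def Let_def inv XY)
    then show ?thesis
      using contr[OF k XY(1,3)] unfolding E(3) by simp
  qed
  have k: "(1::nat) \<in> {1, 2, 3}" "(2::nat) \<in> {1, 2, 3}" "(3::nat) \<in> {1, 2, 3}" by auto
  note main = H.contraction_free_self_dual[OF linear4_dT_chart[OF U x] alternating4_dT_chart[OF U x] on
      c[OF k(1)] c[OF k(2)] c[OF k(3)]]
  let ?w = "wedge44 (dT_chart U \<phi> (\<phi> q)) (\<lambda>i. axis i 1)"
  let ?o = "wedge2222 (F_chart U \<phi> q) (\<lambda>i. axis i 1)"
  have o: "?o \<noteq> 0" by (rule F_chart_nonzero[OF U q])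
  have "?w * ?o \<ge> 0" using main(1) by (simp only: F)
  then show "source U \<phi> (\<phi> q) \<ge> 0"
    using o by (auto simp: source_def orientation_def inv zero_le_mult_iff sgn_if)
  assume "source U \<phi> (\<phi> q) = 0"
  then have "?w = 0" using o by (simp add: source_def orientation_def inv sgn_zero_iff)
  then show "dT_chart U \<phi> (\<phi> q) a b c d = 0" by (rule main(2))
qed

lemma torsion_closed:
  assumes comp: "compact (UNIV :: 'a set)"
    and contr: "\<And>k X Y q. k \<in> {1, 2, 3} \<Longrightarrow> X \<in> VF \<Longrightarrow> Y \<in> VF \<Longrightarrow>
      interior_mult A g (kaehler_form g (J k)) \<beta> X Y q = 0"
    and WXYZ: "W \<in> VF" "X \<in> VF" "Y \<in> VF" "Z \<in> VF"
  shows "\<beta> W X Y Z p = 0"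
proof -
  have pos: "0 \<le> source U \<phi> x" if U: "(U, \<phi>) \<in> A" and x: "x \<in> \<phi> ` U" for U \<phi> x
  proof -
    from x obtain q where q: "x = \<phi> q" "q \<in> U" by (rule imageE)
    show ?thesis unfolding q(1) by (rule interior_mult_zero_pointwise(1)[OF contr U q(2)])
  qed
  have "\<exists>U \<phi>. (U, \<phi>) \<in> A \<and> p \<in> U \<and> source U \<phi> (\<phi> p) = 0"
    by (rule nonneg_exact_density_vanishes[OF comp, where \<delta> = flux and \<kappa> = source and p = p];
      (rule flux_continuous source_continuous pos flux_sum flux_const flux_local flux_transition flux_integral; assumption)?)
      blast
  then obtain U \<phi> where U: "(U, \<phi>) \<in> A" "p \<in> U" "source U \<phi> (\<phi> p) = 0" by blast
  have "dT_at p (W p) (X p) (Y p) (Z p) = 0"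
  proof -
    have "\<exists>c. V p = tvec_of U \<phi> p c" if "V \<in> VF" for V
      using tvec_of_surj[OF U(1,2) VF_tangent[OF that]] by metis
    then obtain a b c d where v: "W p = tvec_of U \<phi> p a" "X p = tvec_of U \<phi> p b" "Y p = tvec_of U \<phi> p c" "Z p = tvec_of U \<phi> p d"
      using WXYZ by metis
    have "dT_chart U \<phi> (\<phi> p) a b c d = 0"
      by (rule interior_mult_zero_pointwise(2)[OF contr U(1,2,3)])
    then show ?thesis using chart_inv[OF U(1,2)] by (simp add: dT_chart_def Let_def v)
  qed
  then show ?thesis using dT_at_eq[OF WXYZ] by simp
qed

end

theorem theorem1p5:
  fixes A :: "('a::{t2_space, second_countable_topology}, 8) atlas"
    and g :: "'a bilinear_field"
    and J :: "nat \<Rightarrow> 'a endo_field"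
    and D :: "'a connection"
  assumes "compact (UNIV :: 'a set)"
    and "almost_hyperhermitian A g J"
    and "AHKT_connection A g J D"
  shows "(\<forall>W\<in>vector_fields A. \<forall>X\<in>vector_fields A. \<forall>Y\<in>vector_fields A. \<forall>Z\<in>vector_fields A. \<forall>p.
            ext_deriv3 (torsion g D) W X Y Z p = 0)
     \<longleftrightarrow> (\<forall>a\<in>{1,2,3}. \<forall>X\<in>vector_fields A. \<forall>Y\<in>vector_fields A. \<forall>p.
            interior_mult A g (kaehler_form g (J a)) (ext_deriv3 (torsion g D)) X Y p = 0)"
proof -
  interpret ahkt_manifold A g J D
    by unfold_locales (use assms in \<open>simp_all add: almost_hyperhermitian_def\<close>)
  show ?thesis
  proof
    assume closed: "\<forall>W\<in>VF. \<forall>X\<in>VF. \<forall>Y\<in>VF. \<forall>Z\<in>VF. \<forall>p. ext_deriv3 (torsion g D) W X Y Z p = 0"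
    show "\<forall>a\<in>{1,2,3}. \<forall>X\<in>VF. \<forall>Y\<in>VF. \<forall>p. interior_mult A g (kaehler_form g (J a))
        (ext_deriv3 (torsion g D)) X Y p = 0"
    proof (intro ballI allI)
      fix a :: nat and X Y p assume XY: "X \<in> VF" "Y \<in> VF"
      obtain E :: "8 \<Rightarrow> 'a vfield" where E: "\<And>i. E i \<in> VF"
        "\<And>F b X Y. interior_mult A g F b X Y p = 1 / 2 * (\<Sum>i\<in>UNIV. \<Sum>j\<in>UNIV. F (E i) (E j) p * b (E i) (E j) X Y p)"
        by (rule interior_mult_frame) blast
      show "interior_mult A g (kaehler_form g (J a)) (ext_deriv3 (torsion g D)) X Y p = 0"
        unfolding E(2) using closed E(1) XY by simp
    qed
  next
    assume "\<forall>a\<in>{1,2,3}. \<forall>X\<in>VF. \<forall>Y\<in>VF. \<forall>p. interior_mult A g (kaehler_form g (J a))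
        (ext_deriv3 (torsion g D)) X Y p = 0"
    then show "\<forall>W\<in>VF. \<forall>X\<in>VF. \<forall>Y\<in>VF. \<forall>Z\<in>VF. \<forall>p. ext_deriv3 (torsion g D) W X Y Z p = 0"
      using torsion_closed[OF assms(1)] by blast
  qed
qed

end
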